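(* Let $\Omega\subset\mathbb{R}^n$ ($n\ge2$) be an NTA domain with $0\in\partial\Omega$, and assume that for some $x^0\in\Omega$ we have $u(x^0)=v(x^0)=1$ and $u,v\ge 0$ with $u=v=0$ on $\partial\Omega\cap B_1$. If for some $0<\beta<2$ and some $c>0$ one has $$u(x),\,v(x)\ \ge\ c\,(\operatorname{dist}(x,\partial\Omega))^{\beta},$$ then there exists a constant $C_0$ (depending on $\beta$, the NTA constants, and $\operatorname{dist}(x^0,\partial B_1)$) such that if $$-1\le\Delta u,\ \Delta v\le 1,$$ then $$\frac{v}{u}\le C_0\quad\text{in }\Omega\cap B_{1/2}.$$
   Context: $u,v$ are continuous functions on $\overline\Omega$, and the growth bound and the inequalities for the Laplacian $\Delta$ are understood in $\Omega$. $B_r(x)$ is the open ball of radius $r$ centered at $x$, and $B_r=B_r(0)$. A domain $\Omega\subset\mathbb{R}^n$ is a $1$-sided NTA domain with constant $K$ if: (D1) for every $x\in\partial\Omega$ and $0<r<\operatorname{diam}(\Omega)$ there is a ball $B_{r/K}(y)\subset\Omega\cap B_r(x)$; and (D2) for every $x,y\in\Omega$ there is a curve $\gamma:[0,1]\to\Omega$ with $\gamma(0)=x$, $\gamma(1)=y$, $l(\gamma([0,1]))\le K|x-y|$, and $\min\{l(\gamma([0,t])),l(\gamma([t,1]))\}\le K\operatorname{dist}(\gamma(t),\partial\Omega)$ for all $t\in[0,1]$, where $l$ denotes length. An NTA (nontangentially accessible, two-sided) domain is one for which, in addition, the complement of $\Omega$ also satisfies (D1), i.e. for every $x\in\partial\Omega$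 and $0<r<\operatorname{diam}(\Omega)$ there is a ball $B_{r/K}(y)\subset(\mathbb{R}^n\setminus\Omega)\cap B_r(x)$.
   Formalization: The constant C_0 may also depend on c (and the dimension n), and when x^0 lies outside B_1 it may additionally depend on dist(x^0, ∂Ω); with only the dependence listed in the statement the bound fails. *)

theory Defs
  imports "HOL-Analysis.Analysis"
begin

definition curve_length :: "(real \<Rightarrow> 'a::metric_space) \<Rightarrow> real \<Rightarrow> real \<Rightarrow> ereal" where
  "curve_length g a b =
     (SUP (m, s) \<in> {(m::nat, s::nat \<Rightarrow> real).
                      (\<forall>i\<le>m. s i \<in> {a..b}) \<and> (\<forall>i<m. s i \<le> s (Suc i))}.
        \<Sum>i<m. ereal (dist (g (s i)) (g (s (Suc i)))))"

text \<open>
  Condition (D1): \<open>A\<close> contains interior corkscrew balls at the boundary points of \<open>D\<close>.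
  It is used with \<open>A = D\<close> and with \<open>A = - D\<close>.  As \<^const>\<open>diameter\<close> is meaningful for
  bounded sets only, an unbounded \<open>D\<close>, which has infinite diameter, is treated separately.
\<close>

definition corkscrew :: "real \<Rightarrow> 'a::euclidean_space set \<Rightarrow> 'a set \<Rightarrow> bool" where
  "corkscrew K D A \<longleftrightarrow>
     (\<forall>x\<in>frontier D. \<forall>r>0. (bounded D \<longrightarrow> r < diameter D) \<longrightarrow>
        (\<exists>y. ball y (r / K) \<subseteq> A \<inter> ball x r))"

text \<open>
  Condition (D2).  Note that \<^const>\<open>infdist\<close> to the empty set is \<open>0\<close>, so this
  renders the distance to the boundary faithfully only for domains with nonempty boundary.
\<close>

definition curve_condition :: "real \<Rightarrow> 'a::euclidean_space set \<Rightarrow> bool" where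
  "curve_condition K D \<longleftrightarrow>
     (\<forall>x\<in>D. \<forall>y\<in>D. \<exists>g::real \<Rightarrow> 'a.
        continuous_on {0..1} g \<and> g ` {0..1} \<subseteq> D \<and> g 0 = x \<and> g 1 = y \<and>
        curve_length g 0 1 \<le> ereal (K * dist x y) \<and>
        (\<forall>t\<in>{0..1}. min (curve_length g 0 t) (curve_length g t 1)
                       \<le> ereal (K * infdist (g t) (frontier D))))"

text \<open>The requirement \<open>0 < K\<close> excludes degenerate (empty) corkscrew balls.\<close>

definition one_sided_NTA :: "real \<Rightarrow> 'a::euclidean_space set \<Rightarrow> bool" where
  "one_sided_NTA K D \<longleftrightarrow>
     0 < K \<and> open D \<and> connected D \<and> D \<noteq> {} \<and> corkscrew K D D \<and> curve_condition K D"

definition NTA :: "real \<Rightarrow> 'a::euclidean_space set \<Rightarrow> bool" where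
  "NTA K D \<longleftrightarrow> one_sided_NTA K D \<and> corkscrew K D (- D)"

definition partial_deriv :: "'a::euclidean_space \<Rightarrow> ('a \<Rightarrow> real) \<Rightarrow> 'a \<Rightarrow> real" where
  "partial_deriv b f x = frechet_derivative f (at x) b"

definition laplacian :: "('a::euclidean_space \<Rightarrow> real) \<Rightarrow> 'a \<Rightarrow> real" where
  "laplacian f x = (\<Sum>b\<in>Basis. partial_deriv b (partial_deriv b f) x)"

primrec C_class :: "nat \<Rightarrow> ('a::euclidean_space \<Rightarrow> real) \<Rightarrow> bool" where
  "C_class 0 f \<longleftrightarrow> continuous_on UNIV f"
| "C_class (Suc k) f \<longleftrightarrow>
     (\<forall>x. f differentiable (at x)) \<and> (\<forall>b\<in>Basis. C_class k (partial_deriv b f))"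

definition test_function :: "'a::euclidean_space set \<Rightarrow> ('a \<Rightarrow> real) \<Rightarrow> bool" where
  "test_function D \<phi> \<longleftrightarrow>
     (\<forall>k. C_class k \<phi>) \<and> compact (closure {x. \<phi> x \<noteq> 0}) \<and> closure {x. \<phi> x \<noteq> 0} \<subseteq> D"

text \<open>
  The functions of interest are merely continuous, so \<open>\<Delta> u \<ge> m\<close> and \<open>\<Delta> u \<le> m\<close> in \<open>D\<close>
  are understood in the sense of distributions.
\<close>

definition laplacian_ge :: "'a::euclidean_space set \<Rightarrow> ('a \<Rightarrow> real) \<Rightarrow> real \<Rightarrow> bool" where
  "laplacian_ge D u m \<longleftrightarrow>
     (\<forall>\<phi>. test_function D \<phi> \<and> (\<forall>x. 0 \<le> \<phi> x) \<longrightarrow>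
        (LINT x:D|lborel. m * \<phi> x) \<le> (LINT x:D|lborel. u x * laplacian \<phi> x))"

definition laplacian_le :: "'a::euclidean_space set \<Rightarrow> ('a \<Rightarrow> real) \<Rightarrow> real \<Rightarrow> bool" where
  "laplacian_le D u m \<longleftrightarrow>
     (\<forall>\<phi>. test_function D \<phi> \<and> (\<forall>x. 0 \<le> \<phi> x) \<longrightarrow>
        (LINT x:D|lborel. u x * laplacian \<phi> x) \<le> (LINT x:D|lborel. m * \<phi> x))"

end

theory Submission
  imports Defs
begin

text \<open>
  Averaging against a smooth radial weight turns the distributional bounds \<open>-1 \<le> \<Delta>u \<le> 1\<close> into
  approximate mean value properties with error \<open>O(r\<^sup>2)\<close>; nothing else about the Laplacian is used.
  The lower bound \<open>u \<ge> c dist\<^sup>\<beta>\<close> with \<open>\<beta> < 2\<close> absorbs these errors at every scale, so that \<open>u\<close> and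
  \<open>v\<close> satisfy a homogeneous interior Harnack inequality, hence one along the curves of (D2), and the
  Carleson estimate.  At a boundary point \<open>z\<close>, with \<open>r\<^sub>k = 2\<^sup>-\<^sup>kr\<close> and corkscrew points \<open>a\<^sub>k\<close> at scale
  \<open>r\<^sub>k\<close>, one shows inductively \<open>Q\<^sub>k u - v \<ge> - \<tau>\<^sub>k (Q\<^sub>k u + v)(a\<^sub>k)\<close> in \<open>\<Omega> \<inter> B(z, r\<^sub>k)\<close> for geometrically
  decaying \<open>\<tau>\<^sub>k\<close>: increasing \<open>Q\<^sub>k\<close> by a factor \<open>1 + O(\<tau>\<^sub>k)\<close> makes \<open>Q u - v\<close> nonnegative outside a thin
  layer around \<open>\<partial>\<Omega>\<close>, and inside the layer its negative part decays by a small factor per scale, up to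
  an error \<open>O(r\<^sub>k\<^sup>2)\<close>.  Hence \<open>v \<le> Q\<^sub>\<infinity> u\<close> near \<open>z\<close> with \<open>Q\<^sub>\<infinity>\<close> comparable to \<open>v(a\<^sub>0)/u(a\<^sub>0)\<close>.  When \<open>x\<^sub>0\<close>
  is close to the boundary, the same inequality with \<open>u\<close> and \<open>v\<close> exchanged bounds \<open>v(a\<^sub>0)/u(a\<^sub>0)\<close>.
\<close>

section \<open>Smooth radial bumps\<close>

text \<open>\<open>Q u - v\<close> solves no equation: its Laplacian is only bounded by 1 + Q, so
  every use of the maximum principle at scale r_k leaves an error of order (1 + Q) r_k^2. Since both
  functions grow at least like dist^\<beta>, the reference value (Q u + v)(a_k) is at least a
  constant times (1 + Q) r_k^\<beta>. The relative error is thus of order r_k^(2 - \<beta>) and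
  shrinks by 2^(\<beta> - 2) < 1 with each halving. This dictates the rate of \<tau>_k and makes the
  product of the factors 1 + O(\<tau>_k) converge. A single decay step at the boundary gains only a
  fixed factor 1 - \<theta>, whereas passing from a_k to a_(k+1) loses a Harnack constant. The thin
  layer is the remedy: if the positive part lives in a layer of relative width about 1/n, then n
  decay steps fit into one halving of the radius, and n is chosen to beat that loss. As u and v are
  merely continuous, maximum principles are run at a touching point by comparing mean values over
  small balls, with an explicit exponential as barrier.\<close>

definition flat_exp :: "nat \<Rightarrow> real \<Rightarrow> real" where
  "flat_exp k t = (if t \<le> 0 then 0 else exp (- inverse t) * inverse t ^ k)"

lemma flat_exp_nonneg: "0 \<le> flat_exp k t"
  by (simp add: flat_exp_def)

lemma flat_exp_nonpos_eq_0: "t \<le> 0 \<Longrightarrow> flat_exp k t = 0"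
  by (simp add: flat_exp_def)

text \<open>A single term of the exponential series suffices:
  \<open>inverse t ^ (k + m) / fact (k + m)\<close> is at most \<open>exp (inverse t)\<close>. The
  case \<open>m\<close> = 2 yields the derivative 0 at the origin, the case \<open>m\<close> = 0 a
  uniform bound.\<close>

lemma flat_exp_le_power:
  assumes "0 \<le> t"
  shows "flat_exp k t \<le> fact (k + m) * t ^ m"
proof (cases "t = 0")
  case False
  with assms have t: "0 < t" by simp
  have "inverse t ^ (k + m) / fact (k + m) \<le> exp (inverse t)"
  proof -
    have "(\<Sum>i\<in>{k + m}. inverse t ^ i /\<^sub>R fact i) \<le> (\<Sum>i. inverse t ^ i /\<^sub>R fact i)"
      using t by (intro sum_le_suminf summable_exp_generic) auto
    then show ?thesis
      by (simp add: exp_def divide_inverse_commute)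
  qed
  then have "inverse t ^ (k + m) \<le> fact (k + m) * exp (inverse t)"
    by (simp only: pos_divide_le_eq[OF fact_gt_zero] mult.commute)
  then have "exp (- inverse t) * inverse t ^ (k + m) \<le> fact (k + m)"
    by (simp only: pos_divide_le_eq[OF exp_gt_zero, symmetric] exp_minus divide_inverse mult.commute[of _ "exp _"])
      (simp only: pos_divide_le_eq[OF exp_gt_zero] divide_inverse_commute[symmetric] mult.commute)
  then have "exp (- inverse t) * inverse t ^ (k + m) * t ^ m \<le> fact (k + m) * t ^ m"
    using t by (intro mult_right_mono) auto
  moreover have "inverse t ^ (k + m) * t ^ m = inverse t ^ k"
    using t by (simp add: power_add field_simps)
  ultimately show ?thesis
    using t by (simp add: flat_exp_def mult.assoc)
qed (simp add: flat_exp_def)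

text \<open>This is the reason for the parameter \<open>k\<close>: differentiation maps the family
  e^(-1/t) t^(-k) into its own linear span.\<close>

lemma flat_exp_has_derivative:
  "(flat_exp k has_real_derivative flat_exp (k + 2) t - real k * flat_exp (k + 1) t) (at t)"
proof -
  consider "t < 0" | "t = 0" | "0 < t" by linarith
  then show ?thesis
  proof cases
    case 1
    have "((\<lambda>_. 0) has_real_derivative flat_exp (k + 2) t - real k * flat_exp (k + 1) t) (at t)"
      using 1 by (simp add: flat_exp_def)
    then show ?thesis
      by (rule has_field_derivative_transform_within_open[of _ _ _ "{..<0}"])
        (use 1 in \<open>auto simp: flat_exp_def\<close>)
  next
    case 2
    have "((\<lambda>h. flat_exp k h / h) \<longlongrightarrow> 0) (at 0)"
    proof (rule Lim_null_comparison)
      have "norm (flat_exp k h / h) \<le> fact (k + 2) * \<bar>h\<bar>" for h :: real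
      proof (cases "h \<le> 0")
        case True
        then show ?thesis
          by (simp only: flat_exp_nonpos_eq_0 div_0 norm_zero)
            (intro mult_nonneg_nonneg fact_ge_zero abs_ge_zero)
      next
        case False
        have "\<bar>flat_exp k h\<bar> = flat_exp k h"
          using flat_exp_nonneg by simp
        also have "\<dots> \<le> fact (k + 2) * h ^ 2"
          using False by (intro flat_exp_le_power) auto
        finally show ?thesis
          using False by (simp add: field_simps power2_eq_square)
      qed
      then show "\<forall>\<^sub>F h in at 0. norm (flat_exp k h / h) \<le> fact (k + 2) * \<bar>h\<bar>"
        by simp
      show "((\<lambda>h::real. fact (k + 2) * \<bar>h\<bar>) \<longlongrightarrow> 0) (at 0)"
        by (auto intro!: tendsto_eq_intros)
    qed
    then show ?thesis
      using 2 by (simp add: DERIV_def flat_exp_def)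
  next
    case 3
    have "((\<lambda>t. exp (- inverse t) * inverse t ^ k) has_real_derivative
            flat_exp (k + 2) t - real k * flat_exp (k + 1) t) (at t)"
      using 3
      apply (auto intro!: derivative_eq_intros simp: flat_exp_def)
      apply (cases k)
       apply (auto simp: field_simps power2_eq_square)
      done
    then show ?thesis
      by (rule has_field_derivative_transform_within_open[of _ _ _ "{0<..}"])
        (use 3 in \<open>auto simp: flat_exp_def\<close>)
  qed
qed

lemma continuous_on_flat_exp [continuous_intros]:
  assumes "continuous_on S f"
  shows "continuous_on S (\<lambda>x. flat_exp k (f x))"
proof -
  have "continuous_on UNIV (flat_exp k)"
    using flat_exp_has_derivative DERIV_isCont continuous_at_imp_continuous_on by blast
  then show ?thesis
    using assms continuous_on_compose2 by blast
qed

definition gap :: "'a::euclidean_space \<Rightarrow> real \<Rightarrow> 'a \<Rightarrow> real" where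
  "gap a r x = 1 - (x - a) \<bullet> (x - a) / r\<^sup>2"

text \<open>Chosen so that each member is differentiable and its directional derivatives are members
  again; smoothness of every order is then an induction on the order alone.\<close>

inductive bump_algebra :: "'a::euclidean_space \<Rightarrow> real \<Rightarrow> ('a \<Rightarrow> real) \<Rightarrow> bool"
  for a r where
  const: "bump_algebra a r (\<lambda>_. c)"
| inner: "bump_algebra a r (\<lambda>x. x \<bullet> b)"
| flat: "bump_algebra a r (\<lambda>x. flat_exp k (gap a r x))"
| add: "bump_algebra a r f \<Longrightarrow> bump_algebra a r g \<Longrightarrow> bump_algebra a r (\<lambda>x. f x + g x)"
| mult: "bump_algebra a r f \<Longrightarrow> bump_algebra a r g \<Longrightarrow> bump_algebra a r (\<lambda>x. f x * g x)"

lemma flat_exp_gap_has_derivative: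
  "((\<lambda>x. flat_exp k (gap a r x)) has_derivative
     (\<lambda>h. (flat_exp (k + 2) (gap a r x) - real k * flat_exp (k + 1) (gap a r x)) *
       (- 2 / r\<^sup>2 * (x \<bullet> h - a \<bullet> h)))) (at x)"
proof -
  have "((gap a r) has_derivative (\<lambda>h. - 2 / r\<^sup>2 * (x \<bullet> h - a \<bullet> h))) (at x)"
    unfolding gap_def divide_inverse
    by (auto intro!: derivative_eq_intros ext
        simp: inner_diff_left inner_diff_right inner_commute algebra_simps)
  from DERIV_compose_FDERIV[OF flat_exp_has_derivative this] show ?thesis
    by (simp add: mult.commute)
qed

lemma bump_algebra_has_derivative:
  assumes "bump_algebra a r f"
  shows "\<exists>f'. (\<forall>x. (f has_derivative f' x) (at x)) \<and> (\<forall>b. bump_algebra a r (\<lambda>x. f' x b))"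
  using assms
proof induction
  case (const c)
  show ?case
    by (intro exI[of _ "\<lambda>_ _. 0"]) (auto intro: bump_algebra.const)
next
  case (inner b)
  show ?case
    by (intro exI[of _ "\<lambda>_ h. h \<bullet> b"]) (auto intro!: derivative_eq_intros bump_algebra.const)
next
  case (flat k)
  have "bump_algebra a r (\<lambda>x. (flat_exp (k + 2) (gap a r x) + (- real k) * flat_exp (k + 1) (gap a r x)) *
       (- 2 / r\<^sup>2 * (x \<bullet> b + (- (a \<bullet> b)))))" for b
    by (intro bump_algebra.intros)
  then show ?case
    using flat_exp_gap_has_derivative[of k a r] by (force intro!: exI)
next
  case (add f g)
  then obtain f' g' where
    "\<forall>x. (f has_derivative f' x) (at x)" "\<forall>b. bump_algebra a r (\<lambda>x. f' x b)"
    "\<forall>x. (g has_derivative g' x) (at x)" "\<forall>b. bump_algebra a r (\<lambda>x. g' x b)" by blast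
  then show ?case
    by (intro exI[of _ "\<lambda>x h. f' x h + g' x h"])
      (auto intro: has_derivative_add bump_algebra.add)
next
  case (mult f g)
  then obtain f' g' where
    "\<forall>x. (f has_derivative f' x) (at x)" "\<forall>b. bump_algebra a r (\<lambda>x. f' x b)"
    "\<forall>x. (g has_derivative g' x) (at x)" "\<forall>b. bump_algebra a r (\<lambda>x. g' x b)" by blast
  with mult.hyps show ?case
    by (intro exI[of _ "\<lambda>x h. f x * g' x h + f' x h * g x"])
      (auto intro!: has_derivative_mult bump_algebra.add bump_algebra.mult)
qed

lemma bump_algebra_C_class:
  assumes "bump_algebra a r f"
  shows "C_class k f"
  using assms
proof (induction k arbitrary: f)
  case 0
  then show ?case
    using bump_algebra_has_derivative has_derivative_continuous continuous_at_imp_continuous_on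
    by (metis C_class.simps(1))
next
  case (Suc k)
  obtain f' where f': "\<And>x. (f has_derivative f' x) (at x)" "\<And>b. bump_algebra a r (\<lambda>x. f' x b)"
    using bump_algebra_has_derivative[OF Suc.prems] by blast
  then have "partial_deriv b f = (\<lambda>x. f' x b)" for b
    using frechet_derivative_at[OF f'(1)] by (simp add: partial_deriv_def fun_eq_iff)
  with f' Suc.IH show ?case
    by (auto simp: differentiable_def)
qed

definition bump :: "'a::euclidean_space \<Rightarrow> real \<Rightarrow> 'a \<Rightarrow> real" where
  "bump a r x = flat_exp 0 (gap a r x)"

lemma flat_exp_gap_eq_0:
  assumes "0 < r" "x \<notin> ball a r"
  shows "flat_exp k (gap a r x) = 0"
proof -
  have "r\<^sup>2 \<le> (norm (x - a))\<^sup>2"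
    using assms by (intro power_mono) (auto simp: dist_norm norm_minus_commute)
  then show ?thesis
    using assms by (intro flat_exp_nonpos_eq_0) (simp add: gap_def power2_norm_eq_inner)
qed

lemma test_function_bump:
  assumes "0 < r" "cball a r \<subseteq> D"
  shows "test_function D (bump a r)"
proof -
  have "{x. bump a r x \<noteq> 0} \<subseteq> cball a r"
    using flat_exp_gap_eq_0[OF assms(1)] by (force simp: bump_def)
  then have *: "closure {x. bump a r x \<noteq> 0} \<subseteq> cball a r"
    by (simp add: closure_minimal)
  have "bump_algebra a r (bump a r)"
    unfolding bump_def by (rule bump_algebra.flat)
  with * assms show ?thesis
    unfolding test_function_def
    by (metis bump_algebra_C_class bounded_cball bounded_subset closed_closure
        compact_eq_bounded_closed order_trans)
qed

lemma laplacian_bump: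
  fixes a :: "'a::euclidean_space"
  shows "laplacian (bump a r) x =
    (flat_exp 4 (gap a r x) - 2 * flat_exp 3 (gap a r x)) * (4 * ((x - a) \<bullet> (x - a)) / r ^ 4)
    - flat_exp 2 (gap a r x) * (2 * real DIM('a) / r\<^sup>2)"
proof -
  have 1: "partial_deriv b (bump a r) = (\<lambda>x. flat_exp 2 (gap a r x) * (- 2 / r\<^sup>2 * (x \<bullet> b - a \<bullet> b)))"
    for b :: 'a
    using frechet_derivative_at[OF flat_exp_gap_has_derivative[of 0 a r]]
    unfolding partial_deriv_def fun_eq_iff bump_def by (simp add: numeral_2_eq_2)
  have 2: "((\<lambda>x. flat_exp 2 (gap a r x)) has_derivative
      (\<lambda>h. (flat_exp 4 (gap a r x) - 2 * flat_exp 3 (gap a r x)) *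
        (- 2 / r\<^sup>2 * (x \<bullet> h - a \<bullet> h)))) (at x)"
    using flat_exp_gap_has_derivative[of 2 a r x] by simp
  let ?D = "\<lambda>b x. (flat_exp 4 (gap a r x) - 2 * flat_exp 3 (gap a r x)) * (4 * ((x - a) \<bullet> b)\<^sup>2 / r ^ 4)
    - flat_exp 2 (gap a r x) * (2 / r\<^sup>2)"
  have "partial_deriv b (partial_deriv b (bump a r)) x = ?D b x" if "b \<in> Basis" for b
  proof -
    have "((\<lambda>x. flat_exp 2 (gap a r x) * (- 2 / r\<^sup>2 * (x \<bullet> b - a \<bullet> b))) has_derivative
       (\<lambda>h. flat_exp 2 (gap a r x) * (- 2 / r\<^sup>2 * (h \<bullet> b)) +
         ((flat_exp 4 (gap a r x) - 2 * flat_exp 3 (gap a r x)) *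
       (- 2 / r\<^sup>2 * (x \<bullet> h - a \<bullet> h))) * (- 2 / r\<^sup>2 * (x \<bullet> b - a \<bullet> b)))) (at x)"
      unfolding divide_inverse by (rule has_derivative_mult[OF 2[unfolded divide_inverse]])
        (auto intro!: derivative_eq_intros)
    from fun_cong[OF frechet_derivative_at[OF this], of b] that show ?thesis
      unfolding 1 partial_deriv_def[of b "\<lambda>x. flat_exp 2 (gap a r x) * (- 2 / r\<^sup>2 * (x \<bullet> b - a \<bullet> b))"]
      by (simp only: inner_same_Basis) (simp add: inner_diff_left power2_eq_square power4_eq_xxxx field_simps)
  qed
  then have "laplacian (bump a r) x = (\<Sum>b\<in>Basis. ?D b x)"
    by (simp add: laplacian_def)
  also have "\<dots> = (flat_exp 4 (gap a r x) - 2 * flat_exp 3 (gap a r x)) * (4 * (\<Sum>b\<in>Basis. ((x - a) \<bullet> b)\<^sup>2) / r ^ 4)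
     - flat_exp 2 (gap a r x) * (2 * real DIM('a) / r\<^sup>2)"
    by (simp add: sum_subtractf sum_distrib_left sum_divide_distrib algebra_simps)
  also have "(\<Sum>b\<in>Basis. ((x - a) \<bullet> b)\<^sup>2) = (x - a) \<bullet> (x - a)"
    by (simp add: euclidean_inner[of "x - a" "x - a"] power2_eq_square)
  finally show ?thesis .
qed

section \<open>Mean values of functions with bounded Laplacian\<close>

text \<open>The index 2 comes from the first derivative of \<open>bump 0 1\<close>, whose gradient
  at \<open>y\<close> is -2 times \<open>weight y *\<^sub>R y\<close>.\<close>

definition weight :: "'a::euclidean_space \<Rightarrow> real" where
  "weight y = flat_exp 2 (gap 0 1 y)"

text \<open>A stand-in for r^2 times the Laplacian that makes sense for continuous functions. It is
  not normalised: the total mass of the weight enters later estimates as \<open>Z\<close>.\<close>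

definition defect :: "('a::euclidean_space \<Rightarrow> real) \<Rightarrow> 'a \<Rightarrow> real \<Rightarrow> real" where
  "defect f x r = (LINT y:cball 0 1|lborel. weight y * (f (x + r *\<^sub>R y) - f x))"

lemma set_integrable_compact:
  fixes f :: "'a::euclidean_space \<Rightarrow> real"
  assumes "compact S" "continuous_on S f"
  shows "set_integrable lborel S f"
  unfolding set_integrable_def using borel_integrable_compact[OF assms] .

text \<open>Used to exchange a domain for a ball or a fixed box when the integrand is supported in a
  ball inside both.\<close>

lemma set_integral_support_cong:
  fixes f g :: "'a \<Rightarrow> real"
  assumes "S \<subseteq> A" "S \<subseteq> B" "\<And>x. x \<in> S \<Longrightarrow> f x = g x"
    "\<And>x. x \<notin> S \<Longrightarrow> f x = 0" "\<And>x. x \<notin> S \<Longrightarrow> g x = 0"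
  shows "(LINT x:A|M. f x) = (LINT x:B|M. g x)"
  unfolding set_lebesgue_integral_def
proof (rule Bochner_Integration.integral_cong)
  show "indicat_real A x *\<^sub>R f x = indicat_real B x *\<^sub>R g x" if "x \<in> space M" for x
    using assms by (cases "x \<in> S") (auto simp: indicator_def)
qed simp

lemma set_integral_nonneg_subset_mono:
  fixes f :: "'a \<Rightarrow> real"
  assumes "set_integrable M A f" "set_integrable M B f" "A \<subseteq> B" "\<And>x. x \<in> B \<Longrightarrow> 0 \<le> f x"
  shows "(LINT x:A|M. f x) \<le> (LINT x:B|M. f x)"
  using assms unfolding set_integrable_def set_lebesgue_integral_def
  by (intro integral_mono) (auto simp: indicator_def)

lemma set_integral_const_cball:
  fixes x :: "'a::euclidean_space" and c :: real
  shows "(LINT z:cball x r|lborel. c) = measure lborel (cball x r) * c"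
  unfolding real_scaleR_def[symmetric]
proof (rule set_integral_const)
  show "emeasure lborel (cball x r) \<noteq> \<infinity>"
    by (rule less_imp_neq[OF emeasure_lborel_cball_finite])
qed simp

lemma continuous_on_gap [continuous_intros]:
  "continuous_on S f \<Longrightarrow> continuous_on S (\<lambda>x. gap a r (f x))"
  by (auto simp: gap_def divide_inverse intro!: continuous_intros)

lemma continuous_on_weight [continuous_intros]:
  "continuous_on S f \<Longrightarrow> continuous_on S (\<lambda>x. weight (f x))"
  by (auto simp: weight_def intro!: continuous_intros)

lemma weight_nonneg: "0 \<le> weight y"
  by (simp add: weight_def flat_exp_nonneg)

lemma weight_le: "weight y \<le> 2"
proof (cases "gap 0 1 y \<le> 0")
  case False
  then have "flat_exp 2 (gap 0 1 y) \<le> fact (2 + 0) * gap 0 1 y ^ 0"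
    by (intro flat_exp_le_power) auto
  then show ?thesis by (simp add: weight_def)
qed (simp add: weight_def flat_exp_def)

text \<open>On this ball \<open>gap 0 1 y\<close> lies between 7/16 and 1, whence the exponent
  16/7.\<close>

lemma weight_ge:
  fixes y :: "'a::euclidean_space"
  assumes "norm y \<le> 3/4"
  shows "exp (- (16/7)) \<le> weight y"
proof -
  have "(norm y)\<^sup>2 \<le> (3/4)\<^sup>2"
    using assms by (intro power_mono) auto
  then have "y \<bullet> y \<le> 9/16"
    by (simp add: dot_square_norm power_divide)
  then have g: "7/16 \<le> gap 0 1 y" "gap 0 1 y \<le> 1"
    by (auto simp: gap_def)
  then have i: "inverse (gap 0 1 y) \<le> 16/7" "1 \<le> inverse (gap 0 1 y)"
    by (auto simp: field_simps)
  then have "exp (- (16/7)) * 1 \<le> exp (- inverse (gap 0 1 y)) * inverse (gap 0 1 y) ^ 2"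
    by (intro mult_mono one_le_power) auto
  then show ?thesis
    using g by (simp add: weight_def flat_exp_def)
qed

section \<open>Weighted averages over balls of radius r\<close>

lemma gap_scale:
  assumes "0 < r"
  shows "gap 0 1 y = gap x r (x + r *\<^sub>R y)"
  using assms by (simp add: gap_def power2_eq_square)

lemma lborel_integral_affine:
  fixes f :: "'a::euclidean_space \<Rightarrow> real"
  assumes [measurable]: "f \<in> borel_measurable borel" and r: "r \<noteq> 0"
  shows "integral\<^sup>L lborel f = \<bar>r\<bar> ^ DIM('a) * (LINT y|lborel. f (x + r *\<^sub>R y))"
proof -
  have "integral\<^sup>L lborel f = integral\<^sup>L (density (distr lborel borel (\<lambda>y. x + r *\<^sub>R y)) (\<lambda>_. ennreal (\<bar>r\<bar> ^ DIM('a)))) f"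
    using lborel_affine[of r x] r by simp
  also have "\<dots> = \<bar>r\<bar> ^ DIM('a) * (LINT y|lborel. f (x + r *\<^sub>R y))"
    using r by (subst integral_density) (auto simp: integral_distr)
  finally show ?thesis .
qed

lemma weight_average_eq:
  fixes f :: "'a::euclidean_space \<Rightarrow> real"
  assumes r: "0 < r" and f: "continuous_on (cball x r) f"
  shows "(LINT y:cball 0 1|lborel. weight y * f (x + r *\<^sub>R y)) =
    (LINT z:cball x r|lborel. flat_exp 2 (gap x r z) * f z) / r ^ DIM('a)"
proof -
  let ?F = "\<lambda>z. indicator (cball x r) z *\<^sub>R (flat_exp 2 (gap x r z) * f z)"
  have "set_integrable lborel (cball x r) (\<lambda>z. flat_exp 2 (gap x r z) * f z)"
    by (intro set_integrable_compact continuous_intros f) auto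
  then have "?F \<in> borel_measurable borel"
    unfolding set_integrable_def by auto
  from lborel_integral_affine[OF this, of r x] r
  have "(LINT z:cball x r|lborel. flat_exp 2 (gap x r z) * f z) = r ^ DIM('a) * (LINT y|lborel. ?F (x + r *\<^sub>R y))"
    by (simp add: set_lebesgue_integral_def)
  also have "(\<lambda>y. ?F (x + r *\<^sub>R y)) = (\<lambda>y. indicator (cball 0 1) y *\<^sub>R (weight y * f (x + r *\<^sub>R y)))"
  proof
    fix y :: 'a
    have "x + r *\<^sub>R y \<in> cball x r \<longleftrightarrow> y \<in> cball 0 1"
      using r by (simp add: dist_norm)
    moreover have "flat_exp 2 (gap x r (x + r *\<^sub>R y)) = weight y"
      by (simp only: weight_def gap_scale[OF r, of y x])
    ultimately show "?F (x + r *\<^sub>R y) = indicator (cball 0 1) y *\<^sub>R (weight y * f (x + r *\<^sub>R y))"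
      by (simp only: indicator_def)
  qed
  finally show ?thesis
    using r by (simp add: set_lebesgue_integral_def)
qed

lemma add_scaleR_in_cball:
  fixes x :: "'a::euclidean_space"
  assumes "0 < r" "y \<in> cball 0 1"
  shows "x + r *\<^sub>R y \<in> cball x r"
  using assms by (simp add: dist_norm)

lemma continuous_on_affine_cball:
  fixes f :: "'a::euclidean_space \<Rightarrow> real"
  assumes "0 < r" "continuous_on (cball x r) f"
  shows "continuous_on (cball 0 1) (\<lambda>y. f (x + r *\<^sub>R y))"
  by (rule continuous_on_compose2[OF assms(2)]) (use assms(1) in \<open>auto intro!: continuous_intros simp: dist_norm\<close>)

lemma defect_eq:
  fixes f :: "'a::euclidean_space \<Rightarrow> real"
  assumes "0 < r" "continuous_on (cball x r) f"
  shows "defect f x r = (LINT y:cball 0 1|lborel. weight y * f (x + r *\<^sub>R y))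
    - (LINT y:cball 0 1|lborel. weight (y::'a)) * f x"
proof -
  have "set_integrable lborel (cball 0 1) (\<lambda>y. weight y * f (x + r *\<^sub>R y))"
    by (intro set_integrable_compact continuous_intros continuous_on_affine_cball assms) auto
  moreover have "set_integrable lborel (cball 0 1) (\<lambda>y::'a. weight y * f x)"
    by (intro set_integrable_compact continuous_intros) auto
  ultimately show ?thesis
    by (simp add: defect_def right_diff_distrib)
qed

lemma weight_mass_pos: "0 < (LINT y:cball 0 1|lborel. weight (y::'a::euclidean_space))"
proof -
  have "0 < (LINT y:cball (0::'a) (3/4)|lborel. exp (- 16/7 :: real)) "
    if "measure lborel (cball 0 (3/4) :: 'a set) > 0"
    using that by (simp add: set_integral_const_cball)
  moreover have "measure lborel (cball 0 (3/4) :: 'a set) > 0"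
    by (simp add: content_cball_pos)
  moreover have "(LINT y:cball (0::'a) (3/4)|lborel. exp (- 16/7 :: real)) \<le> (LINT y:cball 0 (3/4)|lborel. weight (y::'a))"
    by (intro set_integral_mono set_integrable_compact continuous_intros) (auto simp: weight_ge)
  moreover have "(LINT y:cball 0 (3/4)|lborel. weight (y::'a)) \<le> (LINT y:cball 0 1|lborel. weight (y::'a))"
    by (rule set_integral_nonneg_subset_mono)
      (auto simp: weight_nonneg intro!: set_integrable_compact continuous_intros)
  ultimately show ?thesis by linarith
qed

text \<open>At a maximum of \<open>f - g\<close> the nonnegative weight preserves the inequality
  between the increments. In the maximum principle this replaces the comparison of second
  derivatives.\<close>

lemma defect_mono:
  fixes f g :: "'a::euclidean_space \<Rightarrow> real"
  assumes r: "0 < r" and f: "continuous_on (cball x r) f" and g: "continuous_on (cball x r) g"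
    and le: "\<And>z. z \<in> cball x r \<Longrightarrow> f z - f x \<le> g z - g x"
  shows "defect f x r \<le> defect g x r"
  unfolding defect_def
  by (intro set_integral_mono set_integrable_compact continuous_intros continuous_on_affine_cball r f g)
    (use le add_scaleR_in_cball[OF r] in \<open>auto intro!: mult_left_mono weight_nonneg\<close>)

lemma defect_lincomb:
  fixes f g :: "'a::euclidean_space \<Rightarrow> real"
  assumes r: "0 < r" and f: "continuous_on (cball x r) f" and g: "continuous_on (cball x r) g"
  shows "defect (\<lambda>z. a * f z + b * g z) x r = a * defect f x r + b * defect g x r"
proof -
  have "set_integrable lborel (cball 0 1) (\<lambda>y. weight y * (f (x + r *\<^sub>R y) - f x))"
       "set_integrable lborel (cball 0 1) (\<lambda>y. weight y * (g (x + r *\<^sub>R y) - g x))"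
    by (intro set_integrable_compact continuous_intros continuous_on_affine_cball r f g; simp)+
  then have "(LINT y:cball 0 1|lborel. a * (weight y * (f (x + r *\<^sub>R y) - f x)) + b * (weight y * (g (x + r *\<^sub>R y) - g x)))
    = a * defect f x r + b * defect g x r"
    unfolding defect_def by simp
  then show ?thesis
    by (simp add: defect_def algebra_simps)
qed

lemma laplacian_bump_eq_0:
  assumes "0 < r" "z \<notin> ball x r"
  shows "laplacian (bump x r) z = 0"
  using assms by (simp add: laplacian_bump flat_exp_gap_eq_0)

lemma bump_integral_le:
  fixes x :: "'a::euclidean_space"
  assumes "0 < r" "cball x r \<subseteq> D"
  shows "(LINT z:D|lborel. bump x r z) \<le> unit_ball_vol DIM('a) * r ^ DIM('a)"
proof -
  have b: "bump x r z \<le> 1" for z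
    by (simp add: bump_def flat_exp_def)
  have "(LINT z:D|lborel. bump x r z) = (LINT z:cball x r|lborel. bump x r z)"
    by (rule set_integral_support_cong[of "ball x r"])
      (use assms in \<open>auto simp: bump_def flat_exp_gap_eq_0\<close>)
  also have "\<dots> \<le> (LINT z:cball x r|lborel. 1)"
    unfolding bump_def
    by (intro set_integral_mono set_integrable_compact continuous_intros)
      (use b in \<open>auto simp: bump_def\<close>)
  also have "\<dots> = measure lborel (cball x r)"
    by (simp add: set_integral_const_cball)
  finally show ?thesis
    using assms by (simp add: content_cball)
qed

text \<open>
  The average of \<open>u\<close> against the rescaled weight has \<open>r\<close>-derivative a multiple of \<open>\<integral> u \<Delta>\<phi>\<close>
  with \<open>\<phi>\<close> the bump of radius \<open>r\<close>, because \<open>weight y *\<^sub>R y\<close> is a gradient.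
\<close>

lemma abs_defect_le:
  fixes u :: "'a::euclidean_space \<Rightarrow> real"
  assumes u: "continuous_on D u" and R: "0 < R" "cball x R \<subseteq> D"
    and ge: "laplacian_ge D u (-1)" and le: "laplacian_le D u 1"
  shows "\<bar>defect u x R\<bar> \<le> unit_ball_vol DIM('a) * R\<^sup>2"
proof -
  let ?V = "unit_ball_vol DIM('a)" and ?n = "DIM('a)"
  let ?Z = "LINT y:cball 0 1|lborel. weight (y::'a)"
  \<comment> \<open>Extending \<open>u\<close> off the ball lets the integrals for all radii run
    over one fixed box with a jointly continuous integrand, as differentiation under the integral
    sign requires.\<close>
  obtain U where U: "continuous_on UNIV U" and Uu: "\<And>z. z \<in> cball x R \<Longrightarrow> U z = u z"
    using Tietze_unbounded[of "cball x R" u UNIV] continuous_on_subset[OF u R(2)] by auto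
  obtain a b where box: "cball x R \<subseteq> cbox a b"
    using bounded_subset_cbox_symmetric[OF bounded_cball] by blast
  define M where "M r = integral (cbox a b) (\<lambda>z. U z * (flat_exp 2 (gap x r z) / r ^ ?n))" for r
  have contU: "continuous_on S U" for S
    using U continuous_on_subset by blast
  have M_eq: "M r = (LINT y:cball 0 1|lborel. weight y * U (x + r *\<^sub>R y))" if "0 < r" "r \<le> R" for r
  proof -
    have "set_integrable lborel (cbox a b) (\<lambda>z. U z * (flat_exp 2 (gap x r z) / r ^ ?n))"
      by (intro set_integrable_compact continuous_intros contU) (use that in auto)
    then have "M r = (LINT z:cbox a b|lborel. U z * (flat_exp 2 (gap x r z) / r ^ ?n))"
      unfolding M_def by (rule set_borel_integral_eq_integral(2)[symmetric])
    also have "\<dots> = (LINT z:cball x r|lborel. (flat_exp 2 (gap x r z) * U z) / r ^ ?n)"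
      by (rule set_integral_support_cong[of "ball x r"])
        (use that box in \<open>auto simp: flat_exp_gap_eq_0\<close>)
    finally show ?thesis
      using weight_average_eq[OF that(1) contU] by simp
  qed
  \<comment> \<open>The derivative of \<open>flat_exp 2 (gap x r z) / r ^ n\<close> in
    \<open>r\<close>, with n the dimension, is exactly this multiple of the Laplacian of the bump;
    hence the distributional bounds control it.\<close>
  define M' where "M' r = integral (cbox a b) (\<lambda>z. U z * (r / (2 * r ^ ?n) * laplacian (bump x r) z))" for r
  have M'_le: "\<bar>M' r\<bar> \<le> ?V * R" if r: "0 < r" "r \<le> R" for r
  proof -
    have cr: "cball x r \<subseteq> D" and cR: "cball x r \<subseteq> cball x R"
      using r R by auto
    have "set_integrable lborel (cbox a b) (\<lambda>z. U z * (r / (2 * r ^ ?n) * laplacian (bump x r) z))"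
      unfolding laplacian_bump
      by (intro set_integrable_compact continuous_intros contU) (use r in auto)
    then have "M' r = (LINT z:cbox a b|lborel. U z * (r / (2 * r ^ ?n) * laplacian (bump x r) z))"
      unfolding M'_def by (rule set_borel_integral_eq_integral(2)[symmetric])
    also have "\<dots> = (LINT z:D|lborel. r / (2 * r ^ ?n) * (u z * laplacian (bump x r) z))"
    proof (rule set_integral_support_cong[of "ball x r"])
      show "ball x r \<subseteq> cbox a b"
        by (rule order_trans[OF ball_subset_cball order_trans[OF cR box]])
      show "ball x r \<subseteq> D"
        by (rule order_trans[OF ball_subset_cball cr])
      show "U z * (r / (2 * r ^ ?n) * laplacian (bump x r) z) = r / (2 * r ^ ?n) * (u z * laplacian (bump x r) z)"
        if "z \<in> ball x r" for z
        using Uu[of z] that r by auto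
    qed (use r in \<open>auto simp: laplacian_bump_eq_0\<close>)
    finally have M': "M' r = r / (2 * r ^ ?n) * (LINT z:D|lborel. u z * laplacian (bump x r) z)"
      by simp
    have tf: "test_function D (bump x r) \<and> (\<forall>z. 0 \<le> bump x r z)"
      using test_function_bump[OF r(1) cr] by (auto simp: bump_def flat_exp_nonneg)
    have "\<bar>LINT z:D|lborel. u z * laplacian (bump x r) z\<bar> \<le> (LINT z:D|lborel. bump x r z)"
    proof -
      have "(LINT z:D|lborel. -1 * bump x r z) \<le> (LINT z:D|lborel. u z * laplacian (bump x r) z)"
        using ge tf unfolding laplacian_ge_def by blast
      moreover have "(LINT z:D|lborel. u z * laplacian (bump x r) z) \<le> (LINT z:D|lborel. 1 * bump x r z)"
        using le tf unfolding laplacian_le_def by blast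
      ultimately show ?thesis
        by (simp only: set_integral_mult_right)
    qed
    also have "\<dots> \<le> ?V * r ^ ?n"
      by (rule bump_integral_le[OF r(1) cr])
    finally have "\<bar>M' r\<bar> \<le> r / (2 * r ^ ?n) * (?V * r ^ ?n)"
      unfolding M' abs_mult using r by (intro mult_mono) auto
    also have "\<dots> = ?V * (r / 2)"
      using r by simp
    also have "\<dots> \<le> ?V * R"
      using r by (intro mult_left_mono) auto
    finally show ?thesis .
  qed
  have deriv: "(M has_field_derivative M' r) (at r within {e..R})" if e: "0 < e" and r: "r \<in> {e..R}" for e r
    unfolding M_def M'_def
  proof (rule leibniz_rule_field_derivative[of "{e..R}" a b])
    show "((\<lambda>r. U z * (flat_exp 2 (gap x r z) / r ^ ?n)) has_field_derivative
        U z * (r / (2 * r ^ ?n) * laplacian (bump x r) z)) (at r within {e..R})"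
      if "r \<in> {e..R}" for r z
    proof -
      have r: "0 < r" using that e by auto
      have gap: "((\<lambda>r. gap x r z) has_real_derivative 2 * ((z - x) \<bullet> (z - x)) / r ^ 3) (at r within {e..R})"
        unfolding gap_def using r
        by (auto intro!: derivative_eq_intros simp: field_simps power2_eq_square power3_eq_cube)
      have "((\<lambda>r. flat_exp 2 (gap x r z)) has_real_derivative
        (flat_exp 4 (gap x r z) - 2 * flat_exp 3 (gap x r z)) * (2 * ((z - x) \<bullet> (z - x)) / r ^ 3)) (at r within {e..R})"
        using DERIV_chain2[OF flat_exp_has_derivative gap, of 2] by simp
      then have "((\<lambda>r. flat_exp 2 (gap x r z) / r ^ ?n) has_real_derivative
        ((flat_exp 4 (gap x r z) - 2 * flat_exp 3 (gap x r z)) * (2 * ((z - x) \<bullet> (z - x)) / r ^ 3) * r ^ ?n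
         - flat_exp 2 (gap x r z) * (?n * r ^ (?n - 1))) / (r ^ ?n * r ^ ?n)) (at r within {e..R})"
        using r by (intro DERIV_divide) (auto intro!: derivative_eq_intros)
      moreover have "((flat_exp 4 (gap x r z) - 2 * flat_exp 3 (gap x r z)) * (2 * ((z - x) \<bullet> (z - x)) / r ^ 3) * r ^ ?n
         - flat_exp 2 (gap x r z) * (?n * r ^ (?n - 1))) / (r ^ ?n * r ^ ?n) =
         r / (2 * r ^ ?n) * laplacian (bump x r) z"
      proof -
        obtain k where k: "?n = Suc k"
          using DIM_positive[where 'a='a] gr0_implies_Suc by blast
        have *: "(F * (2 * w / r ^ 3) * r ^ Suc k - G * (N * r ^ (Suc k - 1))) / (r ^ Suc k * r ^ Suc k) =
          r / (2 * r ^ Suc k) * (F * (4 * w / r ^ 4) - G * (2 * N / r\<^sup>2))" for F G w N :: real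
          using r by (simp add: field_simps power2_eq_square power3_eq_cube power4_eq_xxxx)
        show ?thesis
          unfolding laplacian_bump k by (rule *)
      qed
      ultimately show ?thesis
        by (intro DERIV_cmult) simp
    qed
    show "(\<lambda>z. U z * (flat_exp 2 (gap x r z) / r ^ ?n)) integrable_on cbox a b" if "r \<in> {e..R}" for r
      by (intro integrable_continuous continuous_intros contU) (use that e in auto)
    have "continuous_on ({e..R} \<times> cbox a b) (\<lambda>p. U (snd p) * (fst p / (2 * fst p ^ ?n) * laplacian (bump x (fst p)) (snd p)))"
      unfolding laplacian_bump gap_def
      by (intro continuous_intros continuous_on_compose2[OF U]) (use e in auto)
    then show "continuous_on ({e..R} \<times> cbox a b) (\<lambda>(r, z). U z * (r / (2 * r ^ ?n) * laplacian (bump x r) z))"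
      by (simp add: case_prod_beta)
  qed (use r in auto)
  have Ux: "U x = u x"
    using Uu R by simp
  \<comment> \<open>The average is differentiated only on [q, R] with q > 0. Continuity of
    \<open>U\<close> at \<open>x\<close> brings \<open>M q\<close> within \<open>e\<close> of
    \<open>?Z * u x\<close>, and the derivative bound covers the rest of the interval.\<close>
  have "\<bar>M R - ?Z * u x\<bar> \<le> ?V * R\<^sup>2 + e" if e: "0 < e" for e
  proof -
    have "isCont U x"
      using U continuous_on_eq_continuous_at open_UNIV by blast
    moreover have "0 < e / ?Z"
      using e weight_mass_pos[where 'a='a] by simp
    ultimately obtain d where d: "0 < d" "\<And>z. dist z x < d \<Longrightarrow> dist (U z) (U x) < e / ?Z"
      unfolding continuous_at_eps_delta by blast
    define q where "q = min R (d / 2)"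
    have q: "0 < q" "q \<le> R" "q < d"
      using d R by (auto simp: q_def)
    have dU: "\<bar>U (x + q *\<^sub>R y) - U x\<bar> \<le> e / ?Z" if "y \<in> cball 0 1" for y
    proof -
      have "norm (q *\<^sub>R y) \<le> q * 1"
        unfolding norm_scaleR using that q by (intro mult_mono) auto
      then have "dist (x + q *\<^sub>R y) x < d"
        using q unfolding dist_norm by (simp only: add_diff_cancel_left')
      from d(2)[OF this] show ?thesis by (simp add: dist_real_def)
    qed
    have int: "set_integrable lborel (cball 0 1) (\<lambda>y. weight y * U (x + q *\<^sub>R y))"
        "set_integrable lborel (cball 0 1) (\<lambda>y::'a. weight y * c)" for c
      by (intro set_integrable_compact continuous_intros continuous_on_compose2[OF U]; simp)+
    have "M q \<le> (LINT y:cball (0::'a) 1|lborel. weight y * (U x + e / ?Z))"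
      unfolding M_eq[OF q(1,2)]
    proof (rule set_integral_mono)
      show "weight y * U (x + q *\<^sub>R y) \<le> weight y * (U x + e / ?Z)" if "y \<in> cball 0 1" for y
        using dU[OF that] by (intro mult_left_mono weight_nonneg) linarith
    qed (rule int)+
    moreover have "(LINT y:cball (0::'a) 1|lborel. weight y * (U x - e / ?Z)) \<le> M q"
      unfolding M_eq[OF q(1,2)]
    proof (rule set_integral_mono)
      show "weight y * (U x - e / ?Z) \<le> weight y * U (x + q *\<^sub>R y)" if "y \<in> cball 0 1" for y
        using dU[OF that] by (intro mult_left_mono weight_nonneg) linarith
    qed (rule int)+
    ultimately have "?Z * (U x - e / ?Z) \<le> M q" "M q \<le> ?Z * (U x + e / ?Z)"
      by (simp_all only: set_integral_mult_left)
    then have "\<bar>M q - ?Z * u x\<bar> \<le> e"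
      using weight_mass_pos[where 'a='a] by (simp add: Ux algebra_simps abs_le_iff)
    moreover have "norm (M R - M q) \<le> ?V * R * norm (R - q)"
      by (rule field_differentiable_bound[of "{q..R}" M M'])
        (use deriv[OF q(1)] M'_le q in auto)
    moreover have "?V * R * norm (R - q) \<le> ?V * R * R"
      using q R by (intro mult_left_mono) auto
    ultimately show ?thesis
      by (simp add: power2_eq_square algebra_simps)
  qed
  then have "\<bar>M R - ?Z * u x\<bar> \<le> ?V * R\<^sup>2"
    by (rule field_le_epsilon)
  moreover have "M R = (LINT y:cball 0 1|lborel. weight y * u (x + R *\<^sub>R y))"
    unfolding M_eq[OF R(1) order_refl] set_lebesgue_integral_def
    by (rule Bochner_Integration.integral_cong)
      (use Uu add_scaleR_in_cball[OF R(1)] in \<open>auto simp: indicator_def\<close>)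
  ultimately show ?thesis
    using defect_eq[OF R(1) continuous_on_subset[OF u R(2)]] by simp
qed

section \<open>Pointwise Harnack inequality and an exponential barrier\<close>

text \<open>The weight is bounded by 2, so the value at \<open>y\<close> is controlled by the plain
  integral over \<open>cball y r\<close> and an error. That ball lies in
  \<open>cball x (2 * r)\<close>, where the weight of radius \<open>4 * r\<close> about
  \<open>x\<close> is bounded below, so for nonnegative \<open>u\<close> the same integral is
  dominated by the average at \<open>x\<close>.\<close>

lemma harnack_defect:
  obtains C where "0 < C"
    "\<And>(u :: 'a::euclidean_space \<Rightarrow> real) x y r m.
      \<lbrakk>0 < r; dist x y \<le> r; continuous_on (cball x (4 * r)) u; \<And>z. z \<in> cball x (4 * r) \<Longrightarrow> 0 \<le> u z;
       \<bar>defect u x (4 * r)\<bar> \<le> m * r\<^sup>2; \<bar>defect u y r\<bar> \<le> m * r\<^sup>2\<rbrakk> \<Longrightarrow> u y \<le> C * (u x + m * r\<^sup>2)"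
proof -
  let ?n = "DIM('a)"
  define Z where "Z = (LINT y:cball 0 1|lborel. weight (y::'a))"
  define w where "w = exp (- (16/7) :: real)"
  define C where "C = 2 * 4 ^ ?n / w + (2 * 4 ^ ?n / w + 1) / Z"
  have Z: "0 < Z" unfolding Z_def by (rule weight_mass_pos)
  have w: "0 < w" by (simp add: w_def)
  show thesis
  proof
    show "0 < C" using Z w unfolding C_def by (intro add_pos_pos divide_pos_pos) auto
    fix u :: "'a \<Rightarrow> real" and x y :: 'a and r m :: real
    assume r: "0 < r" and xy: "dist x y \<le> r" and u: "continuous_on (cball x (4 * r)) u"
      and u0: "\<And>z. z \<in> cball x (4 * r) \<Longrightarrow> 0 \<le> u z"
      and dx: "\<bar>defect u x (4 * r)\<bar> \<le> m * r\<^sup>2" and dy: "\<bar>defect u y r\<bar> \<le> m * r\<^sup>2"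
    have sub: "cball y r \<subseteq> cball x (4 * r)" "cball y r \<subseteq> cball x (2 * r)"
      using xy r by (auto intro!: subset_cball simp: cball_subset_cball_iff dist_commute)
    have uy: "continuous_on (cball y r) u"
      by (rule continuous_on_subset[OF u sub(1)])
    define J where "J = (LINT z:cball y r|lborel. u z)"
    have "(LINT z:cball y r|lborel. flat_exp 2 (gap y r z) * u z) \<le> (LINT z:cball y r|lborel. 2 * u z)"
    proof (intro set_integral_mono set_integrable_compact continuous_intros uy compact_cball)
      fix z assume "z \<in> cball y r"
      moreover have "flat_exp 2 (gap y r z) \<le> 2"
        using weight_le[of "(z - y) /\<^sub>R r"] r
        unfolding weight_def gap_scale[OF r, of _ y] by simp
      ultimately show "flat_exp 2 (gap y r z) * u z \<le> 2 * u z"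
        using u0 sub by (intro mult_right_mono) auto
    qed
    then have "Z * u y \<le> 2 * J / r ^ ?n - defect u y r"
      unfolding defect_eq[OF r uy] weight_average_eq[OF r uy] Z_def J_def
      using r by (simp add: divide_right_mono)
    then have up: "Z * u y \<le> 2 * (J / r ^ ?n) + m * r\<^sup>2"
      using dy by simp
    have r4: "0 < 4 * r" using r by simp
    have "w * J \<le> (LINT z:cball y r|lborel. flat_exp 2 (gap x (4 * r) z) * u z)"
    proof -
      have "(LINT z:cball y r|lborel. w * u z) \<le> (LINT z:cball y r|lborel. flat_exp 2 (gap x (4 * r) z) * u z)"
      proof (intro set_integral_mono set_integrable_compact continuous_intros uy compact_cball)
        fix z assume z: "z \<in> cball y r"
        then have "dist x z \<le> 2 * r"
          using sub by auto
        then have "norm ((z - x) /\<^sub>R (4 * r)) \<le> 3/4"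
          using r unfolding norm_scaleR by (simp add: dist_norm norm_minus_commute field_simps)
        then have "w \<le> flat_exp 2 (gap x (4 * r) z)"
          using weight_ge[of "(z - x) /\<^sub>R (4 * r)"] r
          unfolding weight_def gap_scale[OF r4, of _ x] w_def by simp
        then show "w * u z \<le> flat_exp 2 (gap x (4 * r) z) * u z"
          using u0 sub z by (intro mult_right_mono) auto
      qed
      then show ?thesis by (simp add: J_def)
    qed
    also have "\<dots> \<le> (LINT z:cball x (4 * r)|lborel. flat_exp 2 (gap x (4 * r) z) * u z)"
      by (intro set_integral_nonneg_subset_mono set_integrable_compact continuous_intros u uy sub
          compact_cball mult_nonneg_nonneg flat_exp_nonneg u0)
    also have "\<dots> = (4 * r) ^ ?n * (Z * u x + defect u x (4 * r))"
      unfolding defect_eq[OF r4 u] weight_average_eq[OF r4 u] Z_def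
      using r by simp
    also have "\<dots> \<le> (4 * r) ^ ?n * (Z * u x + m * r\<^sup>2)"
      using dx r by (intro mult_left_mono) auto
    finally have "J / r ^ ?n \<le> 4 ^ ?n / w * (Z * u x + m * r\<^sup>2)"
      using r w by (simp add: power_mult_distrib field_simps)
    with up have "Z * u y \<le> 2 * (4 ^ ?n / w * (Z * u x + m * r\<^sup>2)) + m * r\<^sup>2"
      by linarith
    then have "u y \<le> (2 * (4 ^ ?n / w * (Z * u x + m * r\<^sup>2)) + m * r\<^sup>2) / Z"
      using Z by (simp add: field_simps)
    also have "\<dots> = 2 * 4 ^ ?n / w * u x + (2 * 4 ^ ?n / w + 1) / Z * (m * r\<^sup>2)"
      using Z w by (simp add: field_simps)
    also have "\<dots> \<le> C * u x + C * (m * r\<^sup>2)"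
    proof (intro add_mono mult_right_mono)
      show "0 \<le> u x" using u0 r by simp
      show "0 \<le> m * r\<^sup>2" using dx by linarith
      show "2 * 4 ^ ?n / w \<le> C" "(2 * 4 ^ ?n / w + 1) / Z \<le> C"
        using Z w by (auto simp: C_def)
    qed
    finally show "u y \<le> C * (u x + m * r\<^sup>2)"
      by (simp add: distrib_left)
  qed
qed

section \<open>Moments of the weight and the exponential barrier\<close>

lemma weight_first_moment: "(LINT y:cball 0 1|lborel. weight y * (p \<bullet> y)) = (0::real)"
  for p :: "'a::euclidean_space"
proof -
  let ?F = "\<lambda>y. indicator (cball 0 1) y *\<^sub>R (weight y * (p \<bullet> y))"
  have "set_integrable lborel (cball 0 1) (\<lambda>y. weight y * (p \<bullet> y))"
    by (intro set_integrable_compact continuous_intros) auto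
  then have "?F \<in> borel_measurable borel"
    unfolding set_integrable_def by auto
  from lborel_integral_affine[OF this, of "-1" 0]
  have "integral\<^sup>L lborel ?F = (LINT y|lborel. ?F (- y))"
    by simp
  also have "(\<lambda>y. ?F (- y)) = (\<lambda>y. - ?F y)"
    by (auto simp: fun_eq_iff indicator_def weight_def gap_def)
  finally show ?thesis
    by (simp add: set_lebesgue_integral_def)
qed

text \<open>The mass is found in the ball of radius 1/4 about e/2, with e the unit vector along
  \<open>p\<close>: there the inner product of e and y is at least 1/4, and the norm of y is at most
  3/4, so that \<open>weight_ge\<close> applies.\<close>

lemma weight_second_moment:
  obtains c where "0 < c"
    "\<And>p :: 'a::euclidean_space. c * (norm p)\<^sup>2 \<le> (LINT y:cball 0 1|lborel. weight y * (p \<bullet> y)\<^sup>2)"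
proof
  define c where "c = exp (- (16/7)) / 16 * measure lborel (cball (0::'a) (1/4))"
  show "0 < c" by (simp add: c_def content_cball_pos)
  fix p :: 'a
  let ?I = "\<lambda>S. LINT y:S|lborel. weight y * (p \<bullet> y)\<^sup>2"
  show "c * (norm p)\<^sup>2 \<le> ?I (cball 0 1)"
  proof (cases "p = 0")
    case False
    define e where "e = p /\<^sub>R norm p"
    have e: "norm e = 1" "p = norm p *\<^sub>R e"
      using False by (auto simp: e_def)
    have near: "norm y \<le> 3/4" "1/4 \<le> e \<bullet> y" if "y \<in> cball (e /\<^sub>R 2) (1/4)" for y
    proof -
      have d: "norm (y - e /\<^sub>R 2) \<le> 1/4"
        using that by (simp add: dist_norm norm_minus_commute)
      have "norm y \<le> norm (y - e /\<^sub>R 2) + norm (e /\<^sub>R 2)"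
        by (metis diff_add_cancel norm_triangle_ineq)
      with d e show "norm y \<le> 3/4" by simp
      have "\<bar>e \<bullet> (y - e /\<^sub>R 2)\<bar> \<le> 1 * (1/4)"
        using Cauchy_Schwarz_ineq2[of e "y - e /\<^sub>R 2"] d e by simp
      moreover have "e \<bullet> (y - e /\<^sub>R 2) = e \<bullet> y - 1/2"
        using e by (simp add: inner_diff_right dot_square_norm)
      ultimately show "1/4 \<le> e \<bullet> y" by linarith
    qed
    have "c * (norm p)\<^sup>2 = (LINT y:cball (e /\<^sub>R 2) (1/4)|lborel. exp (- (16/7)) * ((norm p)\<^sup>2 / 16))"
      by (simp add: set_integral_const_cball c_def content_cball)
    also have "\<dots> \<le> ?I (cball (e /\<^sub>R 2) (1/4))"
    proof (intro set_integral_mono set_integrable_compact continuous_intros compact_cball)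
      fix y assume y: "y \<in> cball (e /\<^sub>R 2) (1/4)"
      have "norm p * (1/4) \<le> norm p * (e \<bullet> y)"
        using near[OF y] by (intro mult_left_mono) auto
      then have "norm p / 4 \<le> p \<bullet> y"
        by (subst e(2)) simp
      then have "(norm p / 4)\<^sup>2 \<le> (p \<bullet> y)\<^sup>2"
        by (intro power_mono) auto
      then show "exp (- (16/7)) * ((norm p)\<^sup>2 / 16) \<le> weight y * (p \<bullet> y)\<^sup>2"
        using weight_ge[OF near(1)[OF y]]
        by (intro mult_mono) (auto simp: power_divide weight_nonneg)
    qed
    also have "\<dots> \<le> ?I (cball 0 1)"
    proof (intro set_integral_nonneg_subset_mono set_integrable_compact continuous_intros compact_cball)
      show "cball (e /\<^sub>R 2) (1/4) \<subseteq> cball 0 1"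
        using near(1) by force
    qed (simp add: weight_nonneg)
    finally show ?thesis .
  qed simp
qed

text \<open>This squares 1 + t/2 \<le> exp (t/2), whose left side is nonnegative for t \<ge> -2. The
  quadratic gain is what makes the exponential barrier strict.\<close>

lemma exp_minus_one_ge:
  fixes t :: real
  assumes "-2 \<le> t"
  shows "t + t\<^sup>2 / 4 \<le> exp t - 1"
proof -
  have "(1 + t / 2)\<^sup>2 \<le> (exp (t / 2))\<^sup>2"
    using assms exp_ge_add_one_self[of "t / 2"] by (intro power_mono) auto
  also have "\<dots> = exp t"
    by (simp flip: exp_double)
  finally show ?thesis
    by (simp add: power2_eq_square field_simps)
qed

text \<open>The classical barrier, strictly subharmonic away from its centre: for large
  \<open>\<alpha>\<close> the second moment of the gradient term, of order \<alpha>^2, outweighs the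
  negative contributions of order \<alpha>. As the defect sees a whole ball, this is claimed for
  radii up to a fixed fraction of \<open>s\<close>.\<close>

lemma exp_barrier:
  fixes \<kappa> :: real
  assumes \<kappa>: "0 < \<kappa>"
  obtains \<alpha> q where "0 < \<alpha>" "0 < q"
    "\<And>(x::'a::euclidean_space) y\<^sub>0 s r. \<lbrakk>0 < s; 0 < r; r \<le> q * s; \<kappa> * s \<le> dist x y\<^sub>0; dist x y\<^sub>0 \<le> 4 * s\<rbrakk> \<Longrightarrow>
       \<alpha> * exp (- 16 * \<alpha>) * (r / s)\<^sup>2 \<le> defect (\<lambda>z. exp (- \<alpha> * (dist z y\<^sub>0 / s)\<^sup>2)) x r"
proof -
  obtain c where c: "0 < c"
    and c_le: "\<And>p :: 'a. c * (norm p)\<^sup>2 \<le> (LINT y:cball 0 1|lborel. weight y * (p \<bullet> y)\<^sup>2)"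
    by (fact weight_second_moment)
  define Z where "Z = (LINT y:cball 0 1|lborel. weight (y::'a))"
  have Z: "0 < Z" unfolding Z_def by (rule weight_mass_pos)
  \<comment> \<open>Makes \<alpha>/2 * c * \<kappa>^2 equal to Z + 2: Z cancels the contribution of
    |y|^2, 1 pays for the fourth-order error, and 1 remains as surplus. In \<open>q\<close>, the
    entry 2 / (9 * \<alpha>) keeps the exponent at least -2, and 4 / (\<alpha> * Z) tames the
    fourth-order error.\<close>
  define \<alpha> where "\<alpha> = 2 * (Z + 2) / (c * \<kappa>\<^sup>2)"
  define q where "q = min 1 (min (2 / (9 * \<alpha>)) (4 / (\<alpha> * Z)))"
  have \<alpha>: "0 < \<alpha>" using Z c \<kappa> by (simp add: \<alpha>_def)
  have q: "0 < q" using \<alpha> Z by (simp add: q_def)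
  show thesis
  proof (rule that[OF \<alpha> q])
    fix x y\<^sub>0 :: 'a and s r :: real
    assume s: "0 < s" and r: "0 < r" "r \<le> q * s" and x: "\<kappa> * s \<le> dist x y\<^sub>0" "dist x y\<^sub>0 \<le> 4 * s"
    let ?E = "\<lambda>z. exp (- \<alpha> * (dist z y\<^sub>0 / s)\<^sup>2)"
    define p where "p = (x - y\<^sub>0) /\<^sub>R s"
    define \<epsilon> where "\<epsilon> = r / s"
    have \<epsilon>: "0 < \<epsilon>" "\<epsilon> \<le> q" using r s by (auto simp: \<epsilon>_def field_simps)
    have np: "norm p = dist x y\<^sub>0 / s"
      using s unfolding p_def norm_scaleR by (simp add: dist_norm field_simps)
    have p: "\<kappa> \<le> norm p" "norm p \<le> 4"
      unfolding np using x s by (simp_all add: pos_le_divide_eq pos_divide_le_eq)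
    have \<epsilon>1: "\<epsilon> \<le> 1" and \<epsilon>2: "9 * \<alpha> * \<epsilon> \<le> 2" and \<epsilon>3: "\<alpha> * Z * \<epsilon> \<le> 4"
      using \<epsilon> \<alpha> Z by (auto simp: q_def field_simps)
    have lower: "?E x * (- (2 * \<alpha> * \<epsilon>) * (p \<bullet> y) + (- (\<alpha> * \<epsilon>\<^sup>2) - \<alpha>\<^sup>2 * \<epsilon> ^ 4 / 4) + \<alpha>\<^sup>2 * \<epsilon>\<^sup>2 / 2 * (p \<bullet> y)\<^sup>2)
      \<le> ?E (x + r *\<^sub>R y) - ?E x" if y: "y \<in> cball 0 1" for y
    proof -
      have ny: "norm y \<le> 1" using y by simp
      define a where "a = 2 * \<alpha> * \<epsilon> * (p \<bullet> y)"
      define b where "b = \<alpha> * \<epsilon>\<^sup>2 * (norm y)\<^sup>2"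
      have b: "0 \<le> b" "b \<le> \<alpha> * \<epsilon>\<^sup>2"
        using \<alpha> ny by (auto simp: b_def mult_left_le power_le_one)
      have "\<bar>p \<bullet> y\<bar> \<le> 4 * 1"
        using Cauchy_Schwarz_ineq2[of p y] p ny mult_mono[of "norm p" 4 "norm y" 1] by simp
      then have "\<bar>a\<bar> \<le> 2 * \<alpha> * \<epsilon> * 4"
        unfolding a_def abs_mult using \<alpha> \<epsilon> by (intro mult_mono) auto
      moreover have "\<alpha> * \<epsilon>\<^sup>2 \<le> \<alpha> * \<epsilon>"
        using \<alpha> \<epsilon> \<epsilon>1 by (simp add: power2_eq_square mult_left_le)
      ultimately have t2: "-2 \<le> - a - b"
        using b \<epsilon>2 by linarith
      have "(x + r *\<^sub>R y - y\<^sub>0) /\<^sub>R s = p + \<epsilon> *\<^sub>R y"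
        by (simp add: p_def \<epsilon>_def scaleR_add_right scaleR_diff_right divide_inverse mult.commute)
      then have "dist (x + r *\<^sub>R y) y\<^sub>0 / s = norm (p + \<epsilon> *\<^sub>R y)"
        using s by (metis dist_norm divide_inverse_commute norm_scaleR abs_of_pos positive_imp_inverse_positive)
      then have "(dist (x + r *\<^sub>R y) y\<^sub>0 / s)\<^sup>2 = (norm p)\<^sup>2 + 2 * \<epsilon> * (p \<bullet> y) + \<epsilon>\<^sup>2 * (norm y)\<^sup>2"
        unfolding power2_norm_eq_inner
        by (simp add: power2_norm_eq_inner inner_add_left inner_add_right inner_commute[of y p])
          (simp add: power2_eq_square algebra_simps)
      then have e: "?E (x + r *\<^sub>R y) = ?E x * exp (- a - b)"
        by (simp add: a_def b_def np algebra_simps flip: exp_add)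
      have i1: "?E x * (- a - b + (- a - b)\<^sup>2 / 4) \<le> ?E x * (exp (- a - b) - 1)"
        using exp_minus_one_ge[OF t2] by (intro mult_left_mono) auto
      have i2: "?E x * (- a + (- (\<alpha> * \<epsilon>\<^sup>2) - \<alpha>\<^sup>2 * \<epsilon> ^ 4 / 4) + a\<^sup>2 / 8) \<le> ?E x * (- a - b + (- a - b)\<^sup>2 / 4)"
      proof (rule mult_left_mono)
        \<comment> \<open>Absorbs the mixed term \<open>a * b\<close>, which is cubic in \<epsilon>,
          at the price of half of the quadratic gain.\<close>
        have "0 \<le> (a + 2 * b)\<^sup>2" by simp
        then have "a\<^sup>2 / 8 - b\<^sup>2 / 4 \<le> (- a - b)\<^sup>2 / 4"
          by (simp add: power2_eq_square algebra_simps)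
        moreover have "b\<^sup>2 \<le> (\<alpha> * \<epsilon>\<^sup>2)\<^sup>2"
          using b by (intro power_mono) auto
        moreover have "(\<alpha> * \<epsilon>\<^sup>2)\<^sup>2 = \<alpha>\<^sup>2 * \<epsilon> ^ 4"
          by (simp add: power_mult_distrib)
        ultimately show "- a + (- (\<alpha> * \<epsilon>\<^sup>2) - \<alpha>\<^sup>2 * \<epsilon> ^ 4 / 4) + a\<^sup>2 / 8 \<le> - a - b + (- a - b)\<^sup>2 / 4"
          using b by linarith
      qed simp
      have "- (2 * \<alpha> * \<epsilon>) * (p \<bullet> y) + (- (\<alpha> * \<epsilon>\<^sup>2) - \<alpha>\<^sup>2 * \<epsilon> ^ 4 / 4) + \<alpha>\<^sup>2 * \<epsilon>\<^sup>2 / 2 * (p \<bullet> y)\<^sup>2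
        = - a + (- (\<alpha> * \<epsilon>\<^sup>2) - \<alpha>\<^sup>2 * \<epsilon> ^ 4 / 4) + a\<^sup>2 / 8"
        by (simp add: a_def power2_eq_square)
      then show ?thesis
        using order_trans[OF i2 i1] unfolding e by (simp only: right_diff_distrib mult_1_right)
    qed
    have cE: "continuous_on S ?E" for S
      using s by (intro continuous_intros) auto
    have int: "set_integrable lborel (cball 0 1) (\<lambda>y::'a. k * (weight y * (p \<bullet> y)))"
        "set_integrable lborel (cball 0 1) (\<lambda>y::'a. k * weight y)"
        "set_integrable lborel (cball 0 1) (\<lambda>y::'a. k * (weight y * (p \<bullet> y)\<^sup>2))" for k
      by (intro set_integrable_compact continuous_intros; simp)+
    let ?A = "?E x * - (2 * \<alpha> * \<epsilon>)" and ?B = "?E x * (- (\<alpha> * \<epsilon>\<^sup>2) - \<alpha>\<^sup>2 * \<epsilon> ^ 4 / 4)"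
      and ?C = "?E x * (\<alpha>\<^sup>2 * \<epsilon>\<^sup>2 / 2)"
    have "\<alpha> * exp (- 16 * \<alpha>) * (r / s)\<^sup>2 \<le> ?E x * (\<epsilon>\<^sup>2 * \<alpha>)"
    proof -
      have "(norm p)\<^sup>2 \<le> 4\<^sup>2"
        using p by (intro power_mono) auto
      then have "- 16 * \<alpha> \<le> - \<alpha> * (dist x y\<^sub>0 / s)\<^sup>2"
        using \<alpha> unfolding np by simp
      then have "exp (- 16 * \<alpha>) * (\<epsilon>\<^sup>2 * \<alpha>) \<le> ?E x * (\<epsilon>\<^sup>2 * \<alpha>)"
        using \<alpha> by (intro mult_right_mono) auto
      then show ?thesis by (simp add: \<epsilon>_def mult.commute mult.left_commute)
    qed
    also have "\<dots> \<le> ?E x * (\<epsilon>\<^sup>2 * (- \<alpha> * Z - \<alpha> * (\<alpha> * Z * \<epsilon>\<^sup>2) / 4 + \<alpha>\<^sup>2 / 2 * (c * (norm p)\<^sup>2)))"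
    proof (intro mult_left_mono)
      have "\<alpha> * Z * \<epsilon>\<^sup>2 \<le> \<alpha> * Z * \<epsilon>"
        using \<alpha> Z \<epsilon> \<epsilon>1 by (simp add: power2_eq_square mult_left_le)
      then have "\<alpha> * (\<alpha> * Z * \<epsilon>\<^sup>2) \<le> \<alpha> * 4"
        using \<alpha> \<epsilon>3 by (intro mult_left_mono) linarith+
      moreover have "\<alpha> * (\<alpha> / 2 * (c * \<kappa>\<^sup>2)) \<le> \<alpha> * (\<alpha> / 2 * (c * (norm p)\<^sup>2))"
        using \<alpha> c \<kappa> p by (intro mult_left_mono power_mono) auto
      moreover have "\<alpha> / 2 * (c * \<kappa>\<^sup>2) = Z + 2"
        using c \<kappa> by (simp add: \<alpha>_def)
      ultimately show "\<alpha> \<le> - \<alpha> * Z - \<alpha> * (\<alpha> * Z * \<epsilon>\<^sup>2) / 4 + \<alpha>\<^sup>2 / 2 * (c * (norm p)\<^sup>2)"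
        by (simp add: power2_eq_square algebra_simps)
    qed auto
    also have "\<dots> = ?A * 0 + ?B * Z + ?C * (c * (norm p)\<^sup>2)"
      by (simp add: power2_eq_square power4_eq_xxxx algebra_simps)
    also have "\<dots> \<le> ?A * 0 + ?B * Z + ?C * (LINT y:cball 0 1|lborel. weight y * (p \<bullet> y)\<^sup>2)"
      using c_le[of p] by (intro add_left_mono mult_left_mono) auto
    also have "\<dots> = (LINT y:cball 0 1|lborel. ?A * (weight y * (p \<bullet> y)) + ?B * weight y + ?C * (weight y * (p \<bullet> y)\<^sup>2))"
      using int(1)[of ?A] int(2)[of ?B] int(3)[of ?C]
      by (simp only: set_integral_add set_integral_mult_right weight_first_moment Z_def)
    also have "\<dots> \<le> defect ?E x r"
      unfolding defect_def
    proof (rule set_integral_mono)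
      show "set_integrable lborel (cball 0 1) (\<lambda>y. ?A * (weight y * (p \<bullet> y)) + ?B * weight y + ?C * (weight y * (p \<bullet> y)\<^sup>2))"
        using int by (intro set_integral_add(1))
      show "set_integrable lborel (cball 0 1) (\<lambda>y. weight y * (?E (x + r *\<^sub>R y) - ?E x))"
        using s by (intro set_integrable_compact continuous_intros) auto
      show "?A * (weight y * (p \<bullet> y)) + ?B * weight y + ?C * (weight y * (p \<bullet> y)\<^sup>2) \<le> weight y * (?E (x + r *\<^sub>R y) - ?E x)"
        if "y \<in> cball 0 1" for y
        using mult_left_mono[OF lower[OF that] weight_nonneg[of y]] by (simp add: algebra_simps)
    qed
    finally show "\<alpha> * exp (- 16 * \<alpha>) * (r / s)\<^sup>2 \<le> defect ?E x r" .
  qed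
qed

section \<open>Harnack chains and decay at the boundary\<close>

lemma ball_infdist_frontier_subset:
  fixes x :: "'a::euclidean_space"
  assumes "x \<in> \<Omega>"
  shows "ball x (infdist x (frontier \<Omega>)) \<subseteq> \<Omega>"
proof (rule ccontr)
  let ?B = "ball x (infdist x (frontier \<Omega>))"
  assume "\<not> ?B \<subseteq> \<Omega>"
  then obtain y where y: "y \<in> ?B - \<Omega>" by blast
  then have "0 < infdist x (frontier \<Omega>)"
    using le_less_trans[OF zero_le_dist[of x y]] by simp
  then have "x \<in> ?B \<inter> \<Omega>" using assms by simp
  then have "?B \<inter> \<Omega> \<noteq> {} \<and> ?B - \<Omega> \<noteq> {}" using y by blast
  then obtain w where "w \<in> ?B" "w \<in> frontier \<Omega>"
    using connected_Int_frontier[of ?B \<Omega>] by auto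
  then show False
    using infdist_le[of w "frontier \<Omega>" x] by auto
qed

lemma frontier_disjoint_open: "open \<Omega> \<Longrightarrow> x \<in> frontier \<Omega> \<Longrightarrow> x \<notin> \<Omega>"
  by (simp add: frontier_def interior_open)

lemma infdist_frontier_ge:
  fixes x :: "'a::euclidean_space"
  assumes "open \<Omega>" "frontier \<Omega> \<noteq> {}" "ball x r \<subseteq> \<Omega>"
  shows "r \<le> infdist x (frontier \<Omega>)"
  unfolding infdist_notempty[OF assms(2)]
proof (rule cINF_greatest[OF assms(2)])
  fix w assume "w \<in> frontier \<Omega>"
  then have "w \<notin> ball x r"
    using assms frontier_disjoint_open by blast
  then show "r \<le> dist x w" by simp
qed

lemma nearest_frontier_point:
  fixes x :: "'a::euclidean_space"
  assumes "frontier \<Omega> \<noteq> {}"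
  obtains z where "z \<in> frontier \<Omega>" "dist x z = infdist x (frontier \<Omega>)"
  using infdist_attains_inf[OF frontier_closed assms, of x] by metis

lemma infdist_frontier_pos:
  fixes x :: "'a::euclidean_space"
  assumes "open \<Omega>" "frontier \<Omega> \<noteq> {}" "x \<in> \<Omega>"
  shows "0 < infdist x (frontier \<Omega>)"
  using in_closed_iff_infdist_zero[OF frontier_closed assms(2), of x] frontier_disjoint_open[OF assms(1), of x]
    assms(3) infdist_nonneg[of x "frontier \<Omega>"] by linarith

section \<open>Curve length and Harnack chains\<close>

lemma curve_length_le_iff:
  "curve_length g a b \<le> ereal L \<longleftrightarrow>
    (\<forall>m s. (\<forall>i\<le>m. s i \<in> {a..b}) \<longrightarrow> (\<forall>i<m. s i \<le> s (Suc i)) \<longrightarrow>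
      (\<Sum>i<m. dist (g (s i)) (g (s (Suc i)))) \<le> L)"
  by (auto simp: curve_length_def SUP_le_iff)

lemma dist_le_curve_length:
  assumes "curve_length g a b \<le> ereal L" "a \<le> b"
  shows "dist (g a) (g b) \<le> L"
proof -
  have "(\<Sum>i<1. dist (g (case_nat a (\<lambda>_. b) i)) (g (case_nat a (\<lambda>_. b) (Suc i)))) \<le> L"
    using assms(1)[unfolded curve_length_le_iff, rule_format, of 1 "case_nat a (\<lambda>_. b)"] assms(2)
    by (auto split: nat.splits)
  then show ?thesis by simp
qed

lemma curve_length_tail:
  assumes L: "curve_length g a b \<le> ereal L" and t: "a \<le> t" "t \<le> b"
  shows "curve_length g t b \<le> ereal (L - dist (g a) (g t))"
  unfolding curve_length_le_iff
proof (intro allI impI)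
  fix m :: nat and s :: "nat \<Rightarrow> real"
  assume s: "\<forall>i\<le>m. s i \<in> {t..b}" "\<forall>i<m. s i \<le> s (Suc i)"
  \<comment> \<open>Prefixing \<open>a\<close> and \<open>t\<close> adds the segment from
    \<open>g a\<close> to \<open>g t\<close>; the extra segment from \<open>g t\<close> to
    \<open>g (s 0)\<close> only enlarges the sum and is dropped at the end.\<close>
  define s' where "s' = case_nat a (case_nat t s)"
  have "s' i \<in> {a..b}" if "i \<le> Suc (Suc m)" for i
    using that s(1) t by (force simp: s'_def split: nat.splits)
  moreover have "s' i \<le> s' (Suc i)" if "i < Suc (Suc m)" for i
    using that s t by (auto simp: s'_def split: nat.splits)
  ultimately have "(\<Sum>i<Suc (Suc m). dist (g (s' i)) (g (s' (Suc i)))) \<le> L"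
    using L unfolding curve_length_le_iff by blast
  then have "dist (g a) (g t) + (dist (g t) (g (s 0)) + (\<Sum>i<m. dist (g (s i)) (g (s (Suc i))))) \<le> L"
    by (simp only: sum.lessThan_Suc_shift) (simp add: s'_def)
  then show "(\<Sum>i<m. dist (g (s i)) (g (s (Suc i)))) \<le> L - dist (g a) (g t)"
    using zero_le_dist[of "g t" "g (s 0)"] by linarith
qed

text \<open>The intermediate value theorem supplies a next point at distance exactly
  \<open>h\<close>, and reaching it uses up at least \<open>h\<close> of the remaining length. So
  \<open>N\<close> full hops suffice, with one more factor for the final short one.\<close>

lemma chain_along_curve:
  fixes g :: "real \<Rightarrow> 'a::metric_space" and f :: "'a \<Rightarrow> real"
  assumes g: "continuous_on {0..1} g" and h: "0 < h" and H: "1 \<le> H"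
    and step: "\<And>a b. a \<in> g ` {0..1} \<Longrightarrow> b \<in> g ` {0..1} \<Longrightarrow> dist a b \<le> h \<Longrightarrow> f a \<le> H * f b"
    and pos: "0 \<le> f (g 1)"
    and t: "t \<in> {0..1}" and len: "curve_length g t 1 \<le> ereal (real N * h)"
  shows "f (g t) \<le> H ^ Suc N * f (g 1)"
  using t len
proof (induction N arbitrary: t)
  case 0
  then have "dist (g t) (g 1) \<le> h"
    using dist_le_curve_length[of g t 1 0] h by (simp add: zero_ereal_def)
  with 0 step show ?case by simp
next
  case (Suc N)
  show ?case
  proof (cases "dist (g t) (g 1) \<le> h")
    case True
    then have "f (g t) \<le> H * f (g 1)"
      using step Suc.prems by simp
    also have "\<dots> \<le> H ^ Suc (Suc N) * f (g 1)"
      using H pos by (intro mult_right_mono self_le_power) auto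
    finally show ?thesis .
  next
    case False
    have "\<exists>\<tau>\<ge>t. \<tau> \<le> 1 \<and> dist (g t) (g \<tau>) = h"
    proof (rule IVT')
      show "continuous_on {t..1} (\<lambda>\<tau>. dist (g t) (g \<tau>))"
        using Suc.prems by (intro continuous_intros continuous_on_subset[OF g]) auto
    qed (use False h Suc.prems in auto)
    then obtain \<tau> where \<tau>: "t \<le> \<tau>" "\<tau> \<le> 1" "dist (g t) (g \<tau>) = h" by blast
    have "curve_length g \<tau> 1 \<le> ereal (real (Suc N) * h - h)"
      using curve_length_tail[OF Suc.prems(2) \<tau>(1,2)] \<tau>(3) by simp
    then have "f (g \<tau>) \<le> H ^ Suc N * f (g 1)"
      using Suc.IH[of \<tau>] \<tau> Suc.prems by (simp add: algebra_simps)
    then have "H * f (g \<tau>) \<le> H ^ Suc (Suc N) * f (g 1)"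
      using H by (simp add: mult_left_mono)
    moreover have "f (g t) \<le> H * f (g \<tau>)"
      using step[of "g t" "g \<tau>"] \<tau> Suc.prems by auto
    ultimately show ?thesis by linarith
  qed
qed

text \<open>No additive error appears, so the inequality can be iterated along chains. Radii stop at
  1 because the error r^2 is absorbed through r^2 \<le> r^\<beta>.\<close>

definition harnack :: "real \<Rightarrow> 'a::euclidean_space set \<Rightarrow> ('a \<Rightarrow> real) \<Rightarrow> bool" where
  "harnack H \<Omega> u \<longleftrightarrow> (\<forall>x\<in>\<Omega>. 0 \<le> u x) \<and>
    (\<forall>x y r. 0 < r \<longrightarrow> r \<le> 1 \<longrightarrow> cball x (4 * r) \<subseteq> \<Omega> \<longrightarrow> dist x y \<le> r \<longrightarrow> u y \<le> H * u x)"

text \<open>The curve of (D2) has length at most K R s and stays at distance at least s / (2 K) from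
  the frontier, so steps of length s / (10 K) traverse it, and their number depends on K and R
  alone.\<close>

lemma harnack_chain:
  fixes K R H :: real
  assumes K: "1 \<le> K" and H: "1 \<le> H"
  obtains H' where "1 \<le> H'"
    "\<And>(\<Omega> :: 'a::euclidean_space set) u x y s.
      \<lbrakk>one_sided_NTA K \<Omega>; harnack H \<Omega> u; x \<in> \<Omega>; y \<in> \<Omega>; 0 < s; s \<le> 1;
        s \<le> infdist x (frontier \<Omega>); s \<le> infdist y (frontier \<Omega>); dist x y \<le> R * s\<rbrakk> \<Longrightarrow> u x \<le> H' * u y"
proof
  define N where "N = nat \<lceil>10 * K\<^sup>2 * R\<rceil>"
  show "1 \<le> H ^ Suc N" using H by (rule one_le_power)
  fix \<Omega> :: "'a set" and u x y s
  assume NTA: "one_sided_NTA K \<Omega>" and u: "harnack H \<Omega> u" and xy: "x \<in> \<Omega>" "y \<in> \<Omega>"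
    and s: "0 < s" "s \<le> 1" and sx: "s \<le> infdist x (frontier \<Omega>)" and sy: "s \<le> infdist y (frontier \<Omega>)"
    and R: "dist x y \<le> R * s"
  obtain g where g: "continuous_on {0..1} g" "g ` {0..1} \<subseteq> \<Omega>" "g 0 = x" "g 1 = y"
    and len: "curve_length g 0 1 \<le> ereal (K * dist x y)"
    and cigar: "\<And>t. t \<in> {0..1} \<Longrightarrow> min (curve_length g 0 t) (curve_length g t 1)
                       \<le> ereal (K * infdist (g t) (frontier \<Omega>))"
  proof -
    have "curve_condition K \<Omega>" using NTA by (simp add: one_sided_NTA_def)
    from this[unfolded curve_condition_def, rule_format, OF xy] show thesis
      using that by blast
  qed
  define h where "h = s / (10 * K)"
  have h: "0 < h" "h \<le> 1"
    using s K by (auto simp: h_def divide_le_eq)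
  \<comment> \<open>A point closer to the frontier would by (D2) lie within K d < s / 2 of one end
    of the curve, and that end would then be closer than s to the frontier.\<close>
  have far: "s / (2 * K) \<le> infdist (g t) (frontier \<Omega>)" if t: "t \<in> {0..1}" for t
  proof (rule ccontr)
    let ?d = "infdist (g t) (frontier \<Omega>)"
    assume "\<not> s / (2 * K) \<le> ?d"
    then have d: "?d < s / (2 * K)" by simp
    then have Kd: "K * ?d < s / 2"
      using K by (simp add: field_simps)
    have "?d \<le> K * ?d"
      using K infdist_nonneg[of "g t" "frontier \<Omega>"] by (simp add: mult_le_cancel_right1)
    with Kd have d2: "?d < s / 2" by linarith
    from cigar[OF t] consider "curve_length g 0 t \<le> ereal (K * ?d)" | "curve_length g t 1 \<le> ereal (K * ?d)"
      by (auto simp: min_le_iff_disj)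
    then have "dist x (g t) \<le> K * ?d \<or> dist y (g t) \<le> K * ?d"
      using dist_le_curve_length[of g 0 t] dist_le_curve_length[of g t 1] t g
      by cases (auto simp: dist_commute)
    then show False
      using infdist_triangle[of x "frontier \<Omega>" "g t"] infdist_triangle[of y "frontier \<Omega>" "g t"]
        sx sy Kd d2 by linarith
  qed
  have step: "u a \<le> H * u b" if ab: "a \<in> g ` {0..1}" "b \<in> g ` {0..1}" "dist a b \<le> h" for a b
  proof -
    have "4 * h < s / (2 * K)"
      using s K by (simp add: h_def field_simps)
    then have "4 * h < infdist b (frontier \<Omega>)"
      using far ab by fastforce
    then have "cball b (4 * h) \<subseteq> ball b (infdist b (frontier \<Omega>))"
      by auto
    also have "\<dots> \<subseteq> \<Omega>"
      using ball_infdist_frontier_subset ab g by blast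
    finally show ?thesis
      using u h ab(3) unfolding harnack_def by (simp add: dist_commute)
  qed
  have "K * dist x y \<le> K * (R * s)"
    using R K by (intro mult_left_mono) auto
  also have "\<dots> = (10 * K\<^sup>2 * R) * h"
    using K by (simp add: h_def power2_eq_square)
  also have "\<dots> \<le> real N * h"
    using h by (intro mult_right_mono) (auto simp: N_def intro: real_nat_ceiling_ge)
  finally have "curve_length g 0 1 \<le> ereal (real N * h)"
    using order_trans[OF len] by simp
  then have "u (g 0) \<le> H ^ Suc N * u (g 1)"
    using u g xy by (intro chain_along_curve[OF g(1) h(1) H step]) (auto simp: harnack_def)
  then show "u x \<le> H ^ Suc N * u y"
    using g by simp
qed

text \<open>\<open>f\<close> is compared with \<open>\<psi>\<close>, built from the exponential
  barrier centred in an exterior corkscrew ball: \<open>\<psi>\<close> is nonnegative on the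
  frontier, at least t at distance 3 s from \<open>z\<close>, and at most (1 - \<theta>) t on
  \<open>ball z s\<close>. Either t is already of the size of the error, or the strictness of the
  barrier excludes a positive interior maximum of \<open>f - \<psi>\<close>.\<close>

lemma boundary_decay:
  fixes K :: real
  assumes K: "1 \<le> K"
  obtains \<theta> C where "0 < \<theta>" "\<theta> < 1" "0 < C"
    "\<And>(\<Omega> :: 'a::euclidean_space set) f z s t L.
      \<lbrakk>open \<Omega>; corkscrew K \<Omega> (- \<Omega>); z \<in> frontier \<Omega>; 0 < s; bounded \<Omega> \<Longrightarrow> s < diameter \<Omega>;
       continuous_on (closure \<Omega>) f; 0 \<le> t; 0 \<le> L;
       \<And>x. x \<in> frontier \<Omega> \<inter> ball z (4 * s) \<Longrightarrow> f x \<le> 0;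
       \<And>x. x \<in> \<Omega> \<inter> ball z (4 * s) \<Longrightarrow> f x \<le> t;
       \<And>x r. 0 < r \<Longrightarrow> cball x r \<subseteq> \<Omega> \<Longrightarrow> - (L * r\<^sup>2) \<le> defect f x r\<rbrakk>
      \<Longrightarrow> \<forall>x \<in> \<Omega> \<inter> ball z s. f x \<le> (1 - \<theta>) * t + C * (L * s\<^sup>2)"
proof -
  have "0 < 1 / (2 * K)" using K by simp
  then obtain \<alpha> q where \<alpha>: "0 < \<alpha>" and q: "0 < q"
    and bar: "\<And>(x::'a) y\<^sub>0 s r. \<lbrakk>0 < s; 0 < r; r \<le> q * s; 1 / (2 * K) * s \<le> dist x y\<^sub>0; dist x y\<^sub>0 \<le> 4 * s\<rbrakk> \<Longrightarrow>
       \<alpha> * exp (- 16 * \<alpha>) * (r / s)\<^sup>2 \<le> defect (\<lambda>z. exp (- \<alpha> * (dist z y\<^sub>0 / s)\<^sup>2)) x r"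
    using exp_barrier by blast
  define \<theta> where "\<theta> = exp (- \<alpha> * (3/2)\<^sup>2) - exp (- \<alpha> * (5/2)\<^sup>2)"
  define C where "C = 1 / (\<alpha> * exp (- 16 * \<alpha>))"
  have "exp (- \<alpha> * (5/2)\<^sup>2) < exp (- \<alpha> * (3/2)\<^sup>2)" "exp (- \<alpha> * (3/2)\<^sup>2) < 1" "0 < exp (- \<alpha> * (5/2)\<^sup>2)"
    using \<alpha> by (auto simp: power2_eq_square)
  then have \<theta>: "0 < \<theta>" "\<theta> < 1"
    unfolding \<theta>_def by linarith+
  have C: "0 < C" using \<alpha> by (simp add: C_def)
  show thesis
  proof (rule that[OF \<theta> C])
    fix \<Omega> :: "'a set" and f z s t L
    assume \<Omega>: "open \<Omega>" "corkscrew K \<Omega> (- \<Omega>)" and z: "z \<in> frontier \<Omega>"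
      and s: "0 < s" "bounded \<Omega> \<Longrightarrow> s < diameter \<Omega>"
      and f: "continuous_on (closure \<Omega>) f" and t: "0 \<le> t" and L: "0 \<le> L"
      and f0: "\<And>x. x \<in> frontier \<Omega> \<inter> ball z (4 * s) \<Longrightarrow> f x \<le> 0"
      and ft: "\<And>x. x \<in> \<Omega> \<inter> ball z (4 * s) \<Longrightarrow> f x \<le> t"
      and df: "\<And>x r. 0 < r \<Longrightarrow> cball x r \<subseteq> \<Omega> \<Longrightarrow> - (L * r\<^sup>2) \<le> defect f x r"
    show "\<forall>x \<in> \<Omega> \<inter> ball z s. f x \<le> (1 - \<theta>) * t + C * (L * s\<^sup>2)"
    proof (cases "t \<le> C * (L * s\<^sup>2)")
      case True
      have "(1 - \<theta>) * t \<ge> 0" using \<theta> t by simp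
      moreover have "f x \<le> t" if "x \<in> \<Omega> \<inter> ball z s" for x
        using that ft[of x] s by auto
      ultimately show ?thesis using True by fastforce
    next
      case False
      have CL: "0 \<le> C * (L * s\<^sup>2)" using C L by simp
      have t: "0 < t" using False CL by linarith
      \<comment> \<open>Scale s / 2 puts the centre within s / 2 of \<open>z\<close>: points of
        \<open>ball z s\<close> are within 3/2 s of it, and those at distance 3 s from
        \<open>z\<close> are at least 5/2 s away. These are the two radii in
        \<open>\<theta>\<close>. The corkscrew radius s / (2 K) is the inner radius of the
        barrier.\<close>
      have "0 < s / 2" "bounded \<Omega> \<longrightarrow> s / 2 < diameter \<Omega>" using s by auto
      then obtain y\<^sub>0 where y0: "ball y\<^sub>0 (s / 2 / K) \<subseteq> - \<Omega> \<inter> ball z (s / 2)"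
        using \<Omega>(2) z unfolding corkscrew_def by blast
      then have y0z: "dist z y\<^sub>0 < s / 2"
      proof -
        have "y\<^sub>0 \<in> ball y\<^sub>0 (s / 2 / K)" using s K by simp
        with y0 have "y\<^sub>0 \<in> ball z (s / 2)" by blast
        then show ?thesis by simp
      qed
      define E where "E x = exp (- \<alpha> * (dist x y\<^sub>0 / s)\<^sup>2)" for x
      define \<psi> where "\<psi> x = - t * E x + t * (1 + exp (- \<alpha> * (5/2)\<^sup>2))" for x
      have cE: "continuous_on S E" for S
        unfolding E_def using s by (intro continuous_intros) auto
      have c\<psi>: "continuous_on S \<psi>" for S
        unfolding \<psi>_def by (intro continuous_intros cE)
      have E_le: "E x \<le> exp (- \<alpha> * (5/2)\<^sup>2)" if "5/2 * s \<le> dist x y\<^sub>0" for x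
      proof -
        have "(5/2)\<^sup>2 \<le> (dist x y\<^sub>0 / s)\<^sup>2"
          using that s by (intro power_mono) (auto simp: field_simps)
        then show ?thesis using \<alpha> by (simp add: E_def)
      qed
      have E_ge: "exp (- \<alpha> * (3/2)\<^sup>2) \<le> E x" if "dist x y\<^sub>0 \<le> 3/2 * s" for x
      proof -
        have "(dist x y\<^sub>0 / s)\<^sup>2 \<le> (3/2)\<^sup>2"
          using that s by (intro power_mono) (auto simp: field_simps)
        then show ?thesis using \<alpha> by (simp add: E_def)
      qed
      let ?G = "closure \<Omega> \<inter> cball z (3 * s)"
      have "compact ?G" "z \<in> ?G"
        using z s by (auto simp: closed_Int_compact frontier_def)
      then obtain x1 where x1: "x1 \<in> ?G" "\<And>y. y \<in> ?G \<Longrightarrow> f y - \<psi> y \<le> f x1 - \<psi> x1"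
      proof -
        have "continuous_on ?G (\<lambda>x. f x - \<psi> x)"
          by (intro continuous_on_diff c\<psi> continuous_on_subset[OF f]) auto
        with \<open>compact ?G\<close> \<open>z \<in> ?G\<close> show thesis
          using continuous_attains_sup[of ?G "\<lambda>x. f x - \<psi> x"] that by blast
      qed
      have max: "f x1 \<le> \<psi> x1"
      proof (rule ccontr)
        assume "\<not> f x1 \<le> \<psi> x1"
        then have gt: "\<psi> x1 < f x1" by simp
        have d1: "dist z x1 \<le> 3 * s" using x1 by simp
        have x1\<Omega>: "x1 \<in> \<Omega>"
        proof (rule ccontr)
          assume "x1 \<notin> \<Omega>"
          then have "x1 \<in> frontier \<Omega>"
            using x1 \<Omega> by (simp add: frontier_def interior_open)
          then have "f x1 \<le> 0" using f0[of x1] d1 s by auto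
          moreover have "0 \<le> t * (1 - E x1)"
            using t \<alpha> by (intro mult_nonneg_nonneg) (auto simp: E_def)
          moreover have "0 \<le> t * exp (- \<alpha> * (5/2)\<^sup>2)" using t by simp
          ultimately show False
            using gt unfolding \<psi>_def distrib_left right_diff_distrib by linarith
        qed
        have d1': "dist z x1 < 3 * s"
        proof (rule ccontr)
          assume "\<not> dist z x1 < 3 * s"
          with d1 have "dist z x1 = 3 * s" by simp
          then have "5/2 * s \<le> dist x1 y\<^sub>0"
            using y0z dist_triangle[of z x1 y\<^sub>0] by (simp add: dist_commute)
          from E_le[OF this] have "t * E x1 \<le> t * exp (- \<alpha> * (5/2)\<^sup>2)"
            using t by (intro mult_left_mono) auto
          then have "t \<le> \<psi> x1" unfolding \<psi>_def distrib_left by linarith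
          moreover have "f x1 \<le> t" using ft[of x1] x1\<Omega> d1 s by auto
          ultimately show False using gt by simp
        qed
        have "open (\<Omega> \<inter> ball z (3 * s))" "x1 \<in> \<Omega> \<inter> ball z (3 * s)"
          using \<Omega> x1\<Omega> d1' by auto
        then obtain e where e: "0 < e" "cball x1 e \<subseteq> \<Omega> \<inter> ball z (3 * s)"
          using open_contains_cball by blast
        define r where "r = min e (q * s)"
        have r: "0 < r" "r \<le> q * s" using e q s by (auto simp: r_def)
        have sub: "cball x1 r \<subseteq> \<Omega>" "cball x1 r \<subseteq> ?G"
          using e(2) subset_cball[of r e x1] closure_subset[of \<Omega>] by (auto simp: r_def)
        have "- (L * r\<^sup>2) \<le> defect f x1 r"
          by (rule df[OF r(1) sub(1)])
        also have "\<dots> \<le> defect \<psi> x1 r"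
        proof (rule defect_mono[OF r(1)])
          show "continuous_on (cball x1 r) f"
            using f sub by (auto intro: continuous_on_subset)
          show "f y - f x1 \<le> \<psi> y - \<psi> x1" if "y \<in> cball x1 r" for y
            using x1(2)[OF subsetD[OF sub(2) that]] by linarith
        qed (rule c\<psi>)
        also have "\<dots> = - t * defect E x1 r + t * defect (\<lambda>_. 1 + exp (- \<alpha> * (5/2)\<^sup>2)) x1 r"
          unfolding \<psi>_def by (rule defect_lincomb[OF r(1) cE]) auto
        also have "defect (\<lambda>_. 1 + exp (- \<alpha> * (5/2)\<^sup>2)) x1 r = 0"
          by (simp add: defect_def)
        finally have "t * defect E x1 r \<le> L * r\<^sup>2" by simp
        moreover have "\<alpha> * exp (- 16 * \<alpha>) * (r / s)\<^sup>2 \<le> defect E x1 r"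
          unfolding E_def
        proof (rule bar[OF s(1) r])
          have "x1 \<notin> ball y\<^sub>0 (s / 2 / K)" using y0 x1\<Omega> by auto
          then show "1 / (2 * K) * s \<le> dist x1 y\<^sub>0" by (simp add: dist_commute)
          show "dist x1 y\<^sub>0 \<le> 4 * s"
            using dist_triangle[of x1 y\<^sub>0 z] d1 y0z s by (simp add: dist_commute)
        qed
        then have "t * (\<alpha> * exp (- 16 * \<alpha>) * (r / s)\<^sup>2) \<le> t * defect E x1 r"
          using t by (intro mult_left_mono) auto
        ultimately have "t * (\<alpha> * exp (- 16 * \<alpha>) * (r / s)\<^sup>2) \<le> L * r\<^sup>2"
          by linarith
        then have "t \<le> C * (L * s\<^sup>2)"
          using r s \<alpha> by (simp add: C_def power_divide field_simps)
        with False show False by simp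
      qed
      show ?thesis
      proof
        fix x assume x: "x \<in> \<Omega> \<inter> ball z s"
        then have "x \<in> ?G" using s closure_subset by fastforce
        then have "f x \<le> \<psi> x" using x1(2)[of x] max by linarith
        moreover have "dist x y\<^sub>0 \<le> 3/2 * s"
          using dist_triangle[of x y\<^sub>0 z] x y0z by (simp add: dist_commute)
        from E_ge[OF this] have "t * exp (- \<alpha> * (3/2)\<^sup>2) \<le> t * E x"
          using t by (intro mult_left_mono) auto
        ultimately have "f x \<le> (1 - \<theta>) * t"
          by (simp add: \<psi>_def \<theta>_def algebra_simps)
        then show "f x \<le> (1 - \<theta>) * t + C * (L * s\<^sup>2)"
          using CL by linarith
      qed
    qed
  qed
qed

section \<open>Admissible functions\<close>

definition admissible :: "real \<Rightarrow> real \<Rightarrow> real \<Rightarrow> 'a::euclidean_space set \<Rightarrow> ('a \<Rightarrow> real) \<Rightarrow> bool" where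
  "admissible c \<beta> m \<Omega> u \<longleftrightarrow>
     continuous_on (closure \<Omega>) u \<and> (\<forall>x\<in>closure \<Omega>. 0 \<le> u x) \<and>
     (\<forall>x\<in>frontier \<Omega> \<inter> ball 0 1. u x = 0) \<and>
     (\<forall>x\<in>\<Omega>. c * infdist x (frontier \<Omega>) powr \<beta> \<le> u x) \<and>
     (\<forall>x r. 0 < r \<longrightarrow> cball x r \<subseteq> \<Omega> \<longrightarrow> \<bar>defect u x r\<bar> \<le> m * r\<^sup>2)"

lemma admissible_defect:
  "admissible c \<beta> m \<Omega> u \<Longrightarrow> 0 < r \<Longrightarrow> cball x r \<subseteq> \<Omega> \<Longrightarrow> \<bar>defect u x r\<bar> \<le> m * r\<^sup>2"
  by (simp add: admissible_def)

lemma admissible_pos: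
  assumes "admissible c \<beta> m \<Omega> u" "0 < c" "open \<Omega>" "frontier \<Omega> \<noteq> {}" "x \<in> \<Omega>"
  shows "0 < u x"
proof -
  have "0 < c * infdist x (frontier \<Omega>) powr \<beta>"
    using infdist_frontier_pos[OF assms(3-5)] assms(2) by simp
  also have "\<dots> \<le> u x" using assms by (simp add: admissible_def)
  finally show ?thesis .
qed

text \<open>The exponent may drop from 2 to \<beta> because r \<le> 1; then the growth bound
  applies, as the depth is at least r / A. Raising \<open>A powr \<beta>\<close> to
  \<open>A powr 2\<close> frees the constant of \<beta>.\<close>

lemma admissible_square_le:
  assumes u: "admissible c \<beta> m \<Omega> u" "x \<in> \<Omega>" and c: "0 < c" and \<beta>: "0 < \<beta>" "\<beta> < 2"
    and A: "1 \<le> A" and r: "0 < r" "r \<le> 1" "r \<le> A * infdist x (frontier \<Omega>)"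
  shows "r\<^sup>2 \<le> A\<^sup>2 / c * u x"
proof -
  let ?d = "infdist x (frontier \<Omega>)"
  have "r\<^sup>2 = r powr 2" using r by simp
  also have "\<dots> \<le> r powr \<beta>"
    using r \<beta> by (intro powr_mono') auto
  also have "\<dots> \<le> (A * ?d) powr \<beta>"
    using r \<beta> by (intro powr_mono2) auto
  also have "\<dots> = A powr \<beta> * ?d powr \<beta>"
    by (rule powr_mult)
  also have "\<dots> \<le> A powr 2 * (u x / c)"
    using A \<beta> u c by (intro mult_mono powr_mono) (auto simp: admissible_def field_simps)
  finally show ?thesis using A by simp
qed

lemma admissible_harnack:
  assumes c: "0 < c" and \<beta>: "0 < \<beta>" "\<beta> < 2" and m: "0 < m"
  obtains H where "1 \<le> H"
    "\<And>(\<Omega> :: 'a::euclidean_space set) u. \<lbrakk>open \<Omega>; frontier \<Omega> \<noteq> {}; admissible c \<beta> m \<Omega> u\<rbrakk> \<Longrightarrow> harnack H \<Omega> u"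
proof -
  obtain C where C: "0 < C"
    "\<And>(u :: 'a \<Rightarrow> real) x y r m.
      \<lbrakk>0 < r; dist x y \<le> r; continuous_on (cball x (4 * r)) u; \<And>z. z \<in> cball x (4 * r) \<Longrightarrow> 0 \<le> u z;
       \<bar>defect u x (4 * r)\<bar> \<le> m * r\<^sup>2; \<bar>defect u y r\<bar> \<le> m * r\<^sup>2\<rbrakk> \<Longrightarrow> u y \<le> C * (u x + m * r\<^sup>2)"
    by (fact harnack_defect)
  define H where "H = 1 + C * (1 + 16 * m / c)"
  show thesis
  proof
    show "1 \<le> H" using C c m by (simp add: H_def)
    fix \<Omega> :: "'a set" and u
    assume \<Omega>: "open \<Omega>" "frontier \<Omega> \<noteq> {}" and u: "admissible c \<beta> m \<Omega> u"
    have u0: "0 \<le> u x" if "x \<in> \<Omega>" for x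
      using u that closure_subset unfolding admissible_def by blast
    show "harnack H \<Omega> u"
      unfolding harnack_def
    proof (intro conjI ballI allI impI u0)
      fix x y r assume r: "0 < r" "r \<le> 1" and sub: "cball x (4 * r) \<subseteq> \<Omega>" and xy: "dist x y \<le> r"
      have x: "x \<in> \<Omega>" using sub r by auto
      have suby: "cball y r \<subseteq> \<Omega>"
      proof -
        have "cball y r \<subseteq> cball x (4 * r)"
          using xy r by (simp add: cball_subset_cball_iff dist_commute)
        with sub show ?thesis by blast
      qed
      \<comment> \<open>The factor 16 is due to the defect at radius 4 r.\<close>
      have "u y \<le> C * (u x + 16 * m * r\<^sup>2)"
      proof (rule C(2)[OF r(1) xy])
        show "continuous_on (cball x (4 * r)) u"
          using u sub closure_subset unfolding admissible_def by (meson continuous_on_subset order_trans)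
        show "0 \<le> u z" if "z \<in> cball x (4 * r)" for z using u0 sub that by blast
        have "\<bar>defect u x (4 * r)\<bar> \<le> m * (4 * r)\<^sup>2" "\<bar>defect u y r\<bar> \<le> m * r\<^sup>2"
          using admissible_defect[OF u, of "4 * r" x] admissible_defect[OF u, of r y] r sub suby by auto
        moreover have "0 \<le> m * r\<^sup>2" using m by simp
        ultimately show "\<bar>defect u x (4 * r)\<bar> \<le> 16 * m * r\<^sup>2" "\<bar>defect u y r\<bar> \<le> 16 * m * r\<^sup>2"
          by (simp_all add: power_mult_distrib)
      qed
      also have "r\<^sup>2 \<le> 1\<^sup>2 / c * u x"
      proof (rule admissible_square_le[OF u x c \<beta> order_refl r])
        have "4 * r \<le> infdist x (frontier \<Omega>)"
          using sub ball_subset_cball[of x "4 * r"] by (intro infdist_frontier_ge \<Omega>) blast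
        then show "r \<le> 1 * infdist x (frontier \<Omega>)" using r by simp
      qed
      then have "C * (u x + 16 * m * r\<^sup>2) \<le> C * (u x + 16 * m * (1\<^sup>2 / c * u x))"
        using C m by (intro mult_left_mono add_left_mono) auto
      also have "\<dots> = C * (1 + 16 * m / c) * u x"
        by (simp add: algebra_simps)
      also have "\<dots> \<le> H * u x"
        using u0[OF x] by (intro mult_right_mono) (auto simp: H_def)
      finally show "u y \<le> H * u x" .
    qed
  qed
qed

lemma corkscrew_point:
  fixes z :: "'a::euclidean_space"
  assumes NTA: "one_sided_NTA K \<Omega>" and z: "z \<in> frontier \<Omega>" and r: "0 < r" "bounded \<Omega> \<Longrightarrow> r < diameter \<Omega>"
  obtains a where "a \<in> \<Omega>" "dist a z < r" "r / K \<le> infdist a (frontier \<Omega>)"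
proof -
  have K: "0 < K" and o: "open \<Omega>" using NTA by (auto simp: one_sided_NTA_def)
  obtain a where a: "ball a (r / K) \<subseteq> \<Omega> \<inter> ball z r"
    using NTA z r unfolding one_sided_NTA_def corkscrew_def by blast
  have "a \<in> ball a (r / K)" using r K by simp
  with a have "a \<in> \<Omega>" "a \<in> ball z r" by blast+
  moreover have "r / K \<le> infdist a (frontier \<Omega>)"
    using a z by (intro infdist_frontier_ge o) auto
  ultimately show thesis using that by (simp add: dist_commute)
qed

text \<open>From depth d, the corkscrew point at scale 2 K d over the nearest frontier point has
  depth at least 2 d and costs one factor H'. About log (r / d) such doublings reach depth r, and H'
  \<le> 2^\<gamma> turns the accumulated factor into the power (r / d)^\<gamma>.\<close>

lemma harnack_power:
  fixes K H :: real
  assumes K: "1 \<le> K" and H: "1 \<le> H"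
  obtains C and \<gamma> :: nat where "0 < C" "0 < \<gamma>"
    "\<And>(\<Omega> :: 'a::euclidean_space set) u z r a x.
      \<lbrakk>one_sided_NTA K \<Omega>; harnack H \<Omega> u; z \<in> frontier \<Omega>; 0 < r; r \<le> 1; bounded \<Omega> \<Longrightarrow> 2 * K * r < diameter \<Omega>;
       a \<in> \<Omega>; dist a z \<le> r; r / K \<le> infdist a (frontier \<Omega>); x \<in> \<Omega>; dist x z \<le> 2 * r\<rbrakk>
      \<Longrightarrow> u x * infdist x (frontier \<Omega>) ^ \<gamma> \<le> C * r ^ \<gamma> * u a"
proof -
  obtain H' where H': "1 \<le> H'" and chain:
    "\<And>(\<Omega> :: 'a set) u x y s.
      \<lbrakk>one_sided_NTA K \<Omega>; harnack H \<Omega> u; x \<in> \<Omega>; y \<in> \<Omega>; 0 < s; s \<le> 1;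
        s \<le> infdist x (frontier \<Omega>); s \<le> infdist y (frontier \<Omega>); dist x y \<le> (3 + 6 * K) * K * s\<rbrakk> \<Longrightarrow> u x \<le> H' * u y"
    using harnack_chain[OF K H] by blast
  obtain n where n: "H' < 2 ^ n"
    using real_arch_pow[of 2 H'] by auto
  \<comment> \<open>The successor makes the exponent positive: in the Carleson estimate the weight
    of exponent \<gamma> has to vanish on the sphere of radius 2 r.\<close>
  define \<gamma> where "\<gamma> = Suc n"
  have \<gamma>: "H' \<le> 2 ^ \<gamma>" using n H' unfolding \<gamma>_def power_Suc by linarith
  show thesis
  proof (rule that[of "H' * 2 ^ \<gamma>" \<gamma>])
    show "0 < H' * 2 ^ \<gamma>" "0 < \<gamma>" using H' by (auto simp: \<gamma>_def)
    fix \<Omega> :: "'a set" and u z r a x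
    assume NTA: "one_sided_NTA K \<Omega>" and u: "harnack H \<Omega> u" and z: "z \<in> frontier \<Omega>"
      and r: "0 < r" "r \<le> 1" and diam: "bounded \<Omega> \<Longrightarrow> 2 * K * r < diameter \<Omega>"
      and a: "a \<in> \<Omega>" "dist a z \<le> r" "r / K \<le> infdist a (frontier \<Omega>)"
      and x: "x \<in> \<Omega>" "dist x z \<le> 2 * r"
    have u0: "0 \<le> u y" if "y \<in> \<Omega>" for y using u that by (simp add: harnack_def)
    have \<Omega>: "open \<Omega>" "frontier \<Omega> \<noteq> {}" using NTA z by (auto simp: one_sided_NTA_def)
    \<comment> \<open>The slack 6 K r / 2^k pays for the walk: the doubling that leads to level k
      moves by at most 3 K d < 3 K r / 2^k, half of the slack there, and the other half is the slack
      of level k + 1.\<close>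
    have claim: "u x \<le> H' ^ Suc k * u a"
      if "x \<in> \<Omega>" "r \<le> 2 ^ k * infdist x (frontier \<Omega>)" "dist x z \<le> 2 * r + 6 * K * r / 2 ^ k" for k x
      using that
    proof (induction k arbitrary: x)
      case 0
      have rK: "r / K \<le> r" using r K by (simp add: field_simps)
      have "u x \<le> H' * u a"
      proof (rule chain[OF NTA u 0(1) a(1)])
        show "0 < r / K" "r / K \<le> 1" "r / K \<le> infdist x (frontier \<Omega>)" "r / K \<le> infdist a (frontier \<Omega>)"
          using r K a rK 0(2) by auto
        have "dist x a \<le> (3 + 6 * K) * r"
          using dist_triangle[of x a z] a 0(3) by (simp add: dist_commute algebra_simps)
        then show "dist x a \<le> (3 + 6 * K) * K * (r / K)" using K by simp
      qed
      then show ?case by simp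
    next
      case (Suc k)
      let ?d = "infdist x (frontier \<Omega>)"
      have half: "6 * K * r / 2 ^ Suc k = 3 * K * r / 2 ^ k" by simp
      have nn: "0 \<le> 3 * K * r / 2 ^ k" using K r by simp
      show ?case
      proof (cases "r \<le> 2 ^ k * ?d")
        case True
        have "u x \<le> H' ^ Suc k * u a"
        proof (rule Suc.IH[OF Suc.prems(1) True])
          show "dist x z \<le> 2 * r + 6 * K * r / 2 ^ k"
            using Suc.prems(3) nn unfolding half by simp
        qed
        also have "\<dots> \<le> H' ^ Suc (Suc k) * u a"
          using H' u0[OF a(1)] by (intro mult_right_mono power_increasing) auto
        finally show ?thesis .
      next
        case False
        then have dk: "?d < r / 2 ^ k" by (simp add: field_simps)
        also have "r / 2 ^ k \<le> r" using r by (simp add: divide_le_eq mult_le_cancel_left1)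
        finally have dr: "?d < r" .
        have d: "0 < ?d" using infdist_frontier_pos \<Omega> Suc.prems by blast
        obtain z' where z': "z' \<in> frontier \<Omega>" "dist x z' = ?d"
          using nearest_frontier_point \<Omega> by blast
        have "0 < 2 * K * ?d" using d K by simp
        moreover have "2 * K * ?d < 2 * K * r" using dr K by simp
        then have "2 * K * ?d < diameter \<Omega>" if "bounded \<Omega>" using diam[OF that] by linarith
        ultimately obtain y where y: "y \<in> \<Omega>" "dist y z' < 2 * K * ?d" "2 * K * ?d / K \<le> infdist y (frontier \<Omega>)"
          using corkscrew_point[OF NTA z'(1)] by blast
        have dy: "2 * ?d \<le> infdist y (frontier \<Omega>)" using y(3) K by simp
        have Kd: "?d \<le> K * ?d" using K d by simp
        have xy: "dist x y \<le> 3 * K * ?d"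
          using dist_triangle[of x y z'] y(2) z'(2) Kd by (simp add: dist_commute)
        have "u x \<le> H' * u y"
        proof (rule chain[OF NTA u Suc.prems(1) y(1) d])
          have "3 * K * ?d \<le> (3 + 6 * K) * K * ?d"
            using K d by (intro mult_right_mono) (auto simp: algebra_simps)
          then show "dist x y \<le> (3 + 6 * K) * K * ?d" using xy by linarith
        qed (use dr r d dy in auto)
        also have "u y \<le> H' ^ Suc k * u a"
        proof (rule Suc.IH[OF y(1)])
          have "2 ^ k * (2 * ?d) \<le> 2 ^ k * infdist y (frontier \<Omega>)"
            using dy by (intro mult_left_mono) auto
          then show "r \<le> 2 ^ k * infdist y (frontier \<Omega>)"
            using order_trans[OF Suc.prems(2), of "2 ^ k * infdist y (frontier \<Omega>)"]
            by (simp only: power_Suc mult.assoc mult.left_commute[of "2::real" "2 ^ k"])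
          have "3 * K * ?d \<le> 3 * K * (r / 2 ^ k)"
            using dk K by (intro mult_left_mono) auto
          then have "dist y z \<le> 3 * K * r / 2 ^ k + (2 * r + 3 * K * r / 2 ^ k)"
            using dist_triangle[of y z x] xy Suc.prems(3) unfolding half by (simp add: dist_commute)
          then show "dist y z \<le> 2 * r + 6 * K * r / 2 ^ k"
            by (simp add: field_simps)
        qed
        finally show ?thesis using H' by (simp add: mult_left_mono)
      qed
    qed
    let ?d = "infdist x (frontier \<Omega>)"
    have d: "0 < ?d" using infdist_frontier_pos \<Omega> x by blast
    have ex: "\<exists>k. r \<le> 2 ^ k * ?d"
    proof -
      obtain k where "r / ?d < 2 ^ k" using real_arch_pow[of 2 "r / ?d"] by auto
      then have "r \<le> 2 ^ k * ?d" using d by (simp add: pos_divide_less_eq)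
      then show ?thesis by blast
    qed
    \<comment> \<open>Minimality gives 2^k d \<le> 2 r, so no more factors are spent than the power
      allows; for k = 0 this comes from d \<le> dist x z.\<close>
    define k where "k = (LEAST k. r \<le> 2 ^ k * ?d)"
    have k: "r \<le> 2 ^ k * ?d" unfolding k_def by (rule LeastI_ex[OF ex])
    have k2: "2 ^ k * ?d \<le> 2 * r"
    proof (cases k)
      case 0
      have "?d \<le> dist x z" by (rule infdist_le[OF z])
      then show ?thesis using x 0 by simp
    next
      case (Suc j)
      then have "j < (LEAST k. r \<le> 2 ^ k * ?d)" by (simp add: k_def)
      then have "\<not> r \<le> 2 ^ j * ?d" by (rule not_less_Least)
      then show ?thesis unfolding Suc by simp
    qed
    have "u x \<le> H' ^ Suc k * u a"
    proof (rule claim[OF x(1) k])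
      have "0 \<le> 6 * K * r / 2 ^ k" using K r by simp
      then show "dist x z \<le> 2 * r + 6 * K * r / 2 ^ k" using x(2) by linarith
    qed
    then have "u x * ?d ^ \<gamma> \<le> (H' ^ Suc k * u a) * ?d ^ \<gamma>"
      using d by (intro mult_right_mono) auto
    also have "\<dots> = H' * u a * (H' ^ k * ?d ^ \<gamma>)" by simp
    also have "\<dots> \<le> H' * u a * (2 * r) ^ \<gamma>"
    proof (intro mult_left_mono)
      have "H' ^ k \<le> (2 ^ \<gamma>) ^ k" using \<gamma> H' by (intro power_mono) auto
      then have "H' ^ k * ?d ^ \<gamma> \<le> (2 ^ \<gamma>) ^ k * ?d ^ \<gamma>"
        using d by (intro mult_right_mono) auto
      also have "\<dots> = (2 ^ k * ?d) ^ \<gamma>"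
        by (simp only: power_mult_distrib power_mult[symmetric] mult.commute[of k \<gamma>])
      also have "\<dots> \<le> (2 * r) ^ \<gamma>"
        using k2 d by (intro power_mono) auto
      finally show "H' ^ k * ?d ^ \<gamma> \<le> (2 * r) ^ \<gamma>" .
    qed (use H' u0[OF a(1)] in auto)
    also have "\<dots> = H' * 2 ^ \<gamma> * r ^ \<gamma> * u a"
      by (simp add: power_mult_distrib)
    finally show "u x * ?d ^ \<gamma> \<le> H' * 2 ^ \<gamma> * r ^ \<gamma> * u a" .
  qed
qed

lemma boundary_decay_iterated:
  fixes K :: real
  assumes K: "1 \<le> K"
  obtains \<theta> C where "0 < \<theta>" "\<theta> < 1" "0 < C"
    "\<And>n (\<Omega> :: 'a::euclidean_space set) f z s t L.
      \<lbrakk>open \<Omega>; corkscrew K \<Omega> (- \<Omega>); z \<in> frontier \<Omega>; 0 < s; bounded \<Omega> \<Longrightarrow> 4 ^ n * s < diameter \<Omega>;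
       continuous_on (closure \<Omega>) f; 0 \<le> t; 0 \<le> L;
       \<And>x. x \<in> frontier \<Omega> \<inter> ball z (4 ^ n * s) \<Longrightarrow> f x \<le> 0;
       \<And>x. x \<in> \<Omega> \<inter> ball z (4 ^ n * s) \<Longrightarrow> f x \<le> t;
       \<And>x r. 0 < r \<Longrightarrow> cball x r \<subseteq> \<Omega> \<Longrightarrow> - (L * r\<^sup>2) \<le> defect f x r\<rbrakk>
      \<Longrightarrow> \<forall>x \<in> \<Omega> \<inter> ball z s. f x \<le> (1 - \<theta>) ^ n * t + C * (L * (4 ^ n * s)\<^sup>2)"
proof -
  obtain \<theta> C where \<theta>: "0 < \<theta>" "\<theta> < 1" and C: "0 < C" and decay:
    "\<And>(\<Omega> :: 'a set) f z s t L.
      \<lbrakk>open \<Omega>; corkscrew K \<Omega> (- \<Omega>); z \<in> frontier \<Omega>; 0 < s; bounded \<Omega> \<Longrightarrow> s < diameter \<Omega>;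
       continuous_on (closure \<Omega>) f; 0 \<le> t; 0 \<le> L;
       \<And>x. x \<in> frontier \<Omega> \<inter> ball z (4 * s) \<Longrightarrow> f x \<le> 0;
       \<And>x. x \<in> \<Omega> \<inter> ball z (4 * s) \<Longrightarrow> f x \<le> t;
       \<And>x r. 0 < r \<Longrightarrow> cball x r \<subseteq> \<Omega> \<Longrightarrow> - (L * r\<^sup>2) \<le> defect f x r\<rbrakk>
      \<Longrightarrow> \<forall>x \<in> \<Omega> \<inter> ball z s. f x \<le> (1 - \<theta>) * t + C * (L * s\<^sup>2)"
    by (fact boundary_decay[OF K])
  show thesis
  proof (rule that[OF \<theta>, of "C / \<theta>"])
    show "0 < C / \<theta>" using \<theta> C by simp
    fix n and \<Omega> :: "'a set" and f z s t L
    assume \<Omega>: "open \<Omega>" "corkscrew K \<Omega> (- \<Omega>)" and z: "z \<in> frontier \<Omega>"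
      and s: "0 < s" and diam: "bounded \<Omega> \<Longrightarrow> 4 ^ n * s < diameter \<Omega>"
      and f: "continuous_on (closure \<Omega>) f" and t: "0 \<le> t" and L: "0 \<le> L"
      and f0: "\<And>x. x \<in> frontier \<Omega> \<inter> ball z (4 ^ n * s) \<Longrightarrow> f x \<le> 0"
      and ft: "\<And>x. x \<in> \<Omega> \<inter> ball z (4 ^ n * s) \<Longrightarrow> f x \<le> t"
      and df: "\<And>x r. 0 < r \<Longrightarrow> cball x r \<subseteq> \<Omega> \<Longrightarrow> - (L * r\<^sup>2) \<le> defect f x r"
    \<comment> \<open>The solution of e = (1 - \<theta>) e + C L (4^n s)^2, hence a bound for the
      accumulated error that no number of further steps exceeds.\<close>
    define e where "e = C / \<theta> * (L * (4 ^ n * s)\<^sup>2)"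
    have e: "0 \<le> e" using C \<theta> L by (simp add: e_def)
    have "\<forall>x \<in> \<Omega> \<inter> ball z (4 ^ k * s). f x \<le> (1 - \<theta>) ^ (n - k) * t + e" if "k \<le> n" for k
      using that
    proof (induction rule: inc_induct)
      case base
      show ?case using order_trans[OF ft add_increasing2[OF e order_refl]] by simp
    next
      case (step k)
      have small: "4 ^ Suc k * s \<le> 4 ^ n * s" "4 ^ k * s \<le> 4 ^ n * s"
        using step.hyps s by (auto intro!: mult_right_mono power_increasing simp del: power_Suc)
      have main: "\<forall>x \<in> \<Omega> \<inter> ball z (4 ^ k * s). f x \<le>
          (1 - \<theta>) * ((1 - \<theta>) ^ (n - Suc k) * t + e) + C * (L * (4 ^ k * s)\<^sup>2)"
      proof (rule decay[OF \<Omega> z _ _ f _ L _ _ df])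
        show "0 < 4 ^ k * s" using s by simp
        show "4 ^ k * s < diameter \<Omega>" if "bounded \<Omega>" using diam[OF that] small by linarith
        show "0 \<le> (1 - \<theta>) ^ (n - Suc k) * t + e" using \<theta> t e by simp
        show "f x \<le> 0" if "x \<in> frontier \<Omega> \<inter> ball z (4 * (4 ^ k * s))" for x
          using that small by (intro f0) auto
        show "f x \<le> (1 - \<theta>) ^ (n - Suc k) * t + e" if "x \<in> \<Omega> \<inter> ball z (4 * (4 ^ k * s))" for x
          using that step.IH by (simp add: mult.assoc)
      qed
      moreover have "C * (L * (4 ^ k * s)\<^sup>2) \<le> C * (L * (4 ^ n * s)\<^sup>2)"
        using small C L s by (intro mult_left_mono power_mono) auto
      moreover have "C * (L * (4 ^ n * s)\<^sup>2) = \<theta> * e" using \<theta> by (simp add: e_def)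
      moreover have pow: "(1 - \<theta>) ^ (n - k) = (1 - \<theta>) * (1 - \<theta>) ^ (n - Suc k)"
        using step.hyps by (metis Suc_diff_Suc power_Suc)
      have "(1 - \<theta>) * ((1 - \<theta>) ^ (n - Suc k) * t + e) = (1 - \<theta>) ^ (n - k) * t + e - \<theta> * e"
        unfolding pow by (simp add: algebra_simps)
      ultimately have "(1 - \<theta>) * ((1 - \<theta>) ^ (n - Suc k) * t + e) + C * (L * (4 ^ k * s)\<^sup>2)
          \<le> (1 - \<theta>) ^ (n - k) * t + e" by linarith
      with main show ?case by (meson order_trans)
    qed
    from this[of 0] show "\<forall>x \<in> \<Omega> \<inter> ball z s. f x \<le> (1 - \<theta>) ^ n * t + C / \<theta> * (L * (4 ^ n * s)\<^sup>2)"
      by (simp add: e_def)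
  qed
qed

text \<open>Where \<open>f\<close> is positive the frontier is closer than s = r / (10 (n + 1)), so
  a decay step around the nearest frontier point takes place within distance 5 s. Then n steps
  consume 5 n s < r / 2, which explains the 10. One halving of the radius thus gains the n-th power
  of 1 - \<theta>, instead of the n factors of 4 spent in
  \<open>boundary_decay_iterated\<close>.\<close>

lemma thin_layer_decay:
  fixes K :: real
  assumes K: "1 \<le> K"
  obtains \<theta> C where "0 < \<theta>" "\<theta> < 1" "0 < C"
    "\<And>n (\<Omega> :: 'a::euclidean_space set) f z r t L.
      \<lbrakk>open \<Omega>; frontier \<Omega> \<noteq> {}; corkscrew K \<Omega> (- \<Omega>); 0 < r; bounded \<Omega> \<Longrightarrow> r < diameter \<Omega>;
       continuous_on (closure \<Omega>) f; 0 \<le> t; 0 \<le> L;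
       \<And>x. x \<in> frontier \<Omega> \<inter> ball z r \<Longrightarrow> f x \<le> 0;
       \<And>x. x \<in> \<Omega> \<inter> ball z r \<Longrightarrow> f x \<le> t;
       \<And>x. x \<in> \<Omega> \<inter> ball z r \<Longrightarrow> r / (10 * real (Suc n)) \<le> infdist x (frontier \<Omega>) \<Longrightarrow> f x \<le> 0;
       \<And>x r. 0 < r \<Longrightarrow> cball x r \<subseteq> \<Omega> \<Longrightarrow> - (L * r\<^sup>2) \<le> defect f x r\<rbrakk>
      \<Longrightarrow> \<forall>x \<in> \<Omega> \<inter> ball z (r / 2). f x \<le> (1 - \<theta>) ^ n * t + C * (L * r\<^sup>2)"
proof -
  obtain \<theta> C where \<theta>: "0 < \<theta>" "\<theta> < 1" and C: "0 < C" and decay: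
    "\<And>(\<Omega> :: 'a set) f z s t L.
      \<lbrakk>open \<Omega>; corkscrew K \<Omega> (- \<Omega>); z \<in> frontier \<Omega>; 0 < s; bounded \<Omega> \<Longrightarrow> s < diameter \<Omega>;
       continuous_on (closure \<Omega>) f; 0 \<le> t; 0 \<le> L;
       \<And>x. x \<in> frontier \<Omega> \<inter> ball z (4 * s) \<Longrightarrow> f x \<le> 0;
       \<And>x. x \<in> \<Omega> \<inter> ball z (4 * s) \<Longrightarrow> f x \<le> t;
       \<And>x r. 0 < r \<Longrightarrow> cball x r \<subseteq> \<Omega> \<Longrightarrow> - (L * r\<^sup>2) \<le> defect f x r\<rbrakk>
      \<Longrightarrow> \<forall>x \<in> \<Omega> \<inter> ball z s. f x \<le> (1 - \<theta>) * t + C * (L * s\<^sup>2)"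
    by (fact boundary_decay[OF K])
  show thesis
  proof (rule that[OF \<theta>, of "C / \<theta>"])
    show "0 < C / \<theta>" using \<theta> C by simp
    fix n and \<Omega> :: "'a set" and f z r t L
    assume \<Omega>: "open \<Omega>" "frontier \<Omega> \<noteq> {}" "corkscrew K \<Omega> (- \<Omega>)"
      and r: "0 < r" and diam: "bounded \<Omega> \<Longrightarrow> r < diameter \<Omega>"
      and f: "continuous_on (closure \<Omega>) f" and t: "0 \<le> t" and L: "0 \<le> L"
      and f0: "\<And>x. x \<in> frontier \<Omega> \<inter> ball z r \<Longrightarrow> f x \<le> 0"
      and ft: "\<And>x. x \<in> \<Omega> \<inter> ball z r \<Longrightarrow> f x \<le> t"
      and thin: "\<And>x. x \<in> \<Omega> \<inter> ball z r \<Longrightarrow> r / (10 * real (Suc n)) \<le> infdist x (frontier \<Omega>) \<Longrightarrow> f x \<le> 0"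
      and df: "\<And>x r. 0 < r \<Longrightarrow> cball x r \<subseteq> \<Omega> \<Longrightarrow> - (L * r\<^sup>2) \<le> defect f x r"
    define s where "s = r / (10 * real (Suc n))"
    have s: "0 < s" "s \<le> r" using r by (auto simp: s_def field_simps)
    define e where "e = C / \<theta> * (L * r\<^sup>2)"
    have e: "0 \<le> e" using C \<theta> L by (simp add: e_def)
    have "\<forall>x \<in> \<Omega> \<inter> ball z (r - 5 * real j * s). f x \<le> (1 - \<theta>) ^ j * t + e" for j
    proof (induction j)
      case 0
      show ?case using order_trans[OF ft add_increasing2[OF e order_refl]] by simp
    next
      case (Suc j)
      show ?case
      proof
        fix x assume x: "x \<in> \<Omega> \<inter> ball z (r - 5 * real (Suc j) * s)"
        have j0: "0 \<le> real j * s" using s by simp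
        have xz: "dist z x < r - 5 * (real j * s) - 5 * s" using x by (simp add: algebra_simps)
        show "f x \<le> (1 - \<theta>) ^ Suc j * t + e"
        proof (cases "s \<le> infdist x (frontier \<Omega>)")
          case True
          have "dist z x < r" using xz j0 s by linarith
          then have "f x \<le> 0"
            using True x by (intro thin) (auto simp: s_def)
          also have "0 \<le> (1 - \<theta>) ^ Suc j * t + e" using \<theta> t e by simp
          finally show ?thesis .
        next
          case False
          obtain z' where z': "z' \<in> frontier \<Omega>" "dist x z' = infdist x (frontier \<Omega>)"
            using nearest_frontier_point \<Omega> by blast
          have near: "dist z y < r - 5 * (real j * s)" if "y \<in> ball z' (4 * s)" for y
          proof -
            have "dist z y \<le> dist z x + dist x z' + dist z' y"
              using dist_triangle[of z y x] dist_triangle[of x y z'] by linarith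
            then show ?thesis using that xz False z' by simp
          qed
          have "\<forall>x \<in> \<Omega> \<inter> ball z' s. f x \<le> (1 - \<theta>) * ((1 - \<theta>) ^ j * t + e) + C * (L * s\<^sup>2)"
          proof (rule decay[OF \<Omega>(1,3) z'(1) s(1) _ f _ L _ _ df])
            show "s < diameter \<Omega>" if "bounded \<Omega>" using diam[OF that] s by linarith
            show "0 \<le> (1 - \<theta>) ^ j * t + e" using \<theta> t e by simp
            show "f y \<le> 0" if "y \<in> frontier \<Omega> \<inter> ball z' (4 * s)" for y
              using that near[of y] j0 by (intro f0) auto
            show "f y \<le> (1 - \<theta>) ^ j * t + e" if "y \<in> \<Omega> \<inter> ball z' (4 * s)" for y
              using that near[of y] Suc.IH by (simp add: mult.assoc)
          qed
          moreover have "x \<in> \<Omega> \<inter> ball z' s"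
            using x False z' by (simp add: dist_commute)
          ultimately have "f x \<le> (1 - \<theta>) * ((1 - \<theta>) ^ j * t + e) + C * (L * s\<^sup>2)" by blast
          also have "C * (L * s\<^sup>2) \<le> C * (L * r\<^sup>2)"
            using s C L by (intro mult_left_mono power_mono) auto
          also have "C * (L * r\<^sup>2) = \<theta> * e" using \<theta> by (simp add: e_def)
          finally show ?thesis by (simp add: algebra_simps)
        qed
      qed
    qed
    then have "\<forall>x \<in> \<Omega> \<inter> ball z (r - 5 * real n * s). f x \<le> (1 - \<theta>) ^ n * t + e" .
    moreover have "r / 2 \<le> r - 5 * real n * s"
      using r by (simp add: s_def field_simps)
    then have "ball z (r / 2) \<subseteq> ball z (r - 5 * real n * s)"
      by (rule subset_ball)
    ultimately show "\<forall>x \<in> \<Omega> \<inter> ball z (r / 2). f x \<le> (1 - \<theta>) ^ n * t + C / \<theta> * (L * r\<^sup>2)"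
      unfolding e_def by blast
  qed
qed

section \<open>Carleson estimate\<close>

lemma admissible_continuous: "admissible c \<beta> m \<Omega> u \<Longrightarrow> continuous_on (closure \<Omega>) u"
  by (simp add: admissible_def)

lemma admissible_nonneg: "admissible c \<beta> m \<Omega> u \<Longrightarrow> x \<in> closure \<Omega> \<Longrightarrow> 0 \<le> u x"
  by (simp add: admissible_def)

lemma admissible_frontier: "admissible c \<beta> m \<Omega> u \<Longrightarrow> x \<in> frontier \<Omega> \<Longrightarrow> x \<in> ball 0 1 \<Longrightarrow> u x = 0"
  by (simp add: admissible_def)

text \<open>\<open>u\<close> is maximised after weighting by the power \<gamma> of the distance to
  the sphere of radius 2 r. If the maximiser is deep relative to that distance D,
  \<open>harnack_power\<close> bounds the weighted value directly. If it is close to the frontier,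
  decay shows that \<open>u\<close> there is at most half of itself plus O(r^2), and the growth
  bound at \<open>a\<close> dominates r^2.\<close>

lemma carleson:
  fixes K c \<beta> m :: real
  assumes K: "1 \<le> K" and c: "0 < c" and \<beta>: "0 < \<beta>" "\<beta> < 2" and m: "0 < m"
  obtains C where "0 < C"
    "\<And>(\<Omega> :: 'a::euclidean_space set) u z r a x.
      \<lbrakk>NTA K \<Omega>; admissible c \<beta> m \<Omega> u; z \<in> frontier \<Omega>; 0 < r; r \<le> 1; bounded \<Omega> \<Longrightarrow> 2 * K * r < diameter \<Omega>;
       ball z (3 * r) \<subseteq> ball 0 1;
       a \<in> \<Omega>; dist a z \<le> r; r / K \<le> infdist a (frontier \<Omega>); x \<in> \<Omega>; dist x z \<le> r\<rbrakk>
      \<Longrightarrow> u x \<le> C * u a"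
proof -
  obtain H where H: "1 \<le> H" and Har:
    "\<And>(\<Omega> :: 'a set) u. \<lbrakk>open \<Omega>; frontier \<Omega> \<noteq> {}; admissible c \<beta> m \<Omega> u\<rbrakk> \<Longrightarrow> harnack H \<Omega> u"
    by (fact admissible_harnack[OF c \<beta> m])
  obtain C1 and \<gamma> :: nat where C1: "0 < C1" and \<gamma>: "0 < \<gamma>" and pow:
    "\<And>(\<Omega> :: 'a set) u z r a x.
      \<lbrakk>one_sided_NTA K \<Omega>; harnack H \<Omega> u; z \<in> frontier \<Omega>; 0 < r; r \<le> 1; bounded \<Omega> \<Longrightarrow> 2 * K * r < diameter \<Omega>;
       a \<in> \<Omega>; dist a z \<le> r; r / K \<le> infdist a (frontier \<Omega>); x \<in> \<Omega>; dist x z \<le> 2 * r\<rbrakk>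
      \<Longrightarrow> u x * infdist x (frontier \<Omega>) ^ \<gamma> \<le> C1 * r ^ \<gamma> * u a"
    by (fact harnack_power[OF K H])
  obtain \<theta> C2 where \<theta>: "0 < \<theta>" "\<theta> < 1" and C2: "0 < C2" and decay:
    "\<And>n (\<Omega> :: 'a set) f z s t L.
      \<lbrakk>open \<Omega>; corkscrew K \<Omega> (- \<Omega>); z \<in> frontier \<Omega>; 0 < s; bounded \<Omega> \<Longrightarrow> 4 ^ n * s < diameter \<Omega>;
       continuous_on (closure \<Omega>) f; 0 \<le> t; 0 \<le> L;
       \<And>x. x \<in> frontier \<Omega> \<inter> ball z (4 ^ n * s) \<Longrightarrow> f x \<le> 0;
       \<And>x. x \<in> \<Omega> \<inter> ball z (4 ^ n * s) \<Longrightarrow> f x \<le> t;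
       \<And>x r. 0 < r \<Longrightarrow> cball x r \<subseteq> \<Omega> \<Longrightarrow> - (L * r\<^sup>2) \<le> defect f x r\<rbrakk>
      \<Longrightarrow> \<forall>x \<in> \<Omega> \<inter> ball z s. f x \<le> (1 - \<theta>) ^ n * t + C2 * (L * (4 ^ n * s)\<^sup>2)"
    by (fact boundary_decay_iterated[OF K])
  \<comment> \<open>The decay has to beat the factor 2^\<gamma> by which \<open>u\<close> may exceed
    its value at the maximiser nearby, with 1/2 to spare for absorption. \<open>\<epsilon>\<close>
    is the relative depth for which n scales fit into D / 4.\<close>
  obtain n where n: "(1 - \<theta>) ^ n < 1 / (2 * 2 ^ \<gamma>)"
    using real_arch_pow_inv[of "1 / (2 * 2 ^ \<gamma>)" "1 - \<theta>"] \<theta> by auto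
  define \<epsilon> where "\<epsilon> = 1 / (4 * 4 ^ n :: real)"
  have \<epsilon>: "0 < \<epsilon>" "\<epsilon> \<le> 1/4" "4 ^ n * (\<epsilon> * D) = D / 4" for D
    by (auto simp: \<epsilon>_def field_simps)
  define C where "C = C1 / \<epsilon> ^ \<gamma> + 2 * C2 * m * (K\<^sup>2 / c) * 2 ^ \<gamma>"
  show thesis
  proof
    show "0 < C" using C1 C2 m K c \<epsilon> by (auto simp: C_def intro!: add_pos_pos)
    fix \<Omega> :: "'a set" and u z r a x
    assume NTA: "NTA K \<Omega>" and u: "admissible c \<beta> m \<Omega> u" and z: "z \<in> frontier \<Omega>"
      and r: "0 < r" "r \<le> 1" and diam: "bounded \<Omega> \<Longrightarrow> 2 * K * r < diameter \<Omega>"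
      and unit: "ball z (3 * r) \<subseteq> ball 0 1"
      and a: "a \<in> \<Omega>" "dist a z \<le> r" "r / K \<le> infdist a (frontier \<Omega>)"
      and x: "x \<in> \<Omega>" "dist x z \<le> r"
    have NTA': "one_sided_NTA K \<Omega>" "corkscrew K \<Omega> (- \<Omega>)" and \<Omega>: "open \<Omega>" "frontier \<Omega> \<noteq> {}"
      using NTA z by (auto simp: NTA_def one_sided_NTA_def)
    have har: "harnack H \<Omega> u" by (rule Har[OF \<Omega> u])
    have ua: "0 < u a" by (rule admissible_pos[OF u c \<Omega> a(1)])
    have cu: "continuous_on (closure \<Omega>) u" by (rule admissible_continuous[OF u])
    let ?G = "closure \<Omega> \<inter> cball z (2 * r)"
    let ?\<Phi> = "\<lambda>y. u y * (2 * r - dist y z) ^ \<gamma>"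
    have "compact ?G" by (simp add: closed_Int_compact)
    moreover have "z \<in> ?G" using z r by (auto simp: frontier_def)
    moreover have "continuous_on ?G ?\<Phi>"
      by (intro continuous_intros continuous_on_subset[OF cu]) auto
    ultimately obtain x1 where x1: "x1 \<in> ?G" "\<And>y. y \<in> ?G \<Longrightarrow> ?\<Phi> y \<le> ?\<Phi> x1"
      using continuous_attains_sup[of ?G ?\<Phi>] by blast
    define D where "D = 2 * r - dist x1 z"
    have D: "0 \<le> D" "D \<le> 2 * r" using x1(1) by (auto simp: D_def dist_commute)
    have u1: "0 \<le> u x1" using admissible_nonneg[OF u] x1(1) by blast
    have key: "u x1 * D ^ \<gamma> \<le> C * r ^ \<gamma> * u a"
    proof (cases "x1 \<in> \<Omega> \<and> 0 < D")
      case False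
      have "u x1 * D ^ \<gamma> = 0"
      proof (cases "0 < D")
        case True
        with False have "x1 \<in> frontier \<Omega>"
          using x1 \<Omega> by (simp add: frontier_def interior_open)
        moreover have "x1 \<in> ball z (3 * r)" using x1(1) r by auto
        ultimately have "u x1 = 0" using admissible_frontier[OF u] unit by blast
        then show ?thesis by simp
      next
        case False
        then show ?thesis using D \<gamma> by simp
      qed
      moreover have "0 \<le> C * r ^ \<gamma> * u a" using \<open>0 < C\<close> r ua by simp
      ultimately show ?thesis by linarith
    next
      case True
      let ?d = "infdist x1 (frontier \<Omega>)"
      show ?thesis
      proof (cases "\<epsilon> * D \<le> ?d")
        case far: True
        have "u x1 * (\<epsilon> * D) ^ \<gamma> \<le> u x1 * ?d ^ \<gamma>"
          using far u1 \<epsilon> D by (intro mult_left_mono power_mono) auto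
        also have "\<dots> \<le> C1 * r ^ \<gamma> * u a"
          using x1(1) True by (intro pow[OF NTA'(1) har z r diam a]) (auto simp: dist_commute)
        finally have "u x1 * D ^ \<gamma> \<le> C1 / \<epsilon> ^ \<gamma> * r ^ \<gamma> * u a"
          using \<epsilon>(1) by (simp add: power_mult_distrib field_simps)
        also have "\<dots> \<le> C * r ^ \<gamma> * u a"
          using C2 m K c r ua by (intro mult_right_mono) (auto simp: C_def)
        finally show ?thesis .
      next
        case near: False
        obtain z1 where z1: "z1 \<in> frontier \<Omega>" "dist x1 z1 = ?d"
          using nearest_frontier_point \<Omega> by blast
        have dD: "dist x1 z1 < D / 4"
        proof -
          have "\<epsilon> * D \<le> 1/4 * D" using \<epsilon> D by (intro mult_right_mono) auto
          then show ?thesis using near z1 by linarith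
        qed
        have close: "dist y z \<le> 2 * r - D / 2" if "y \<in> ball z1 (D / 4)" for y
        proof -
          have "dist y z \<le> dist y z1 + dist z1 x1 + dist x1 z"
            using dist_triangle[of y z z1] dist_triangle[of z1 z x1] by linarith
          moreover have "dist y z1 < D / 4" using that by (simp add: dist_commute)
          moreover have "dist x1 z = 2 * r - D" by (simp add: D_def)
          ultimately show ?thesis using dD dist_commute[of z1 x1] by linarith
        qed
        have "\<forall>y \<in> \<Omega> \<inter> ball z1 (\<epsilon> * D). u y \<le> (1 - \<theta>) ^ n * (2 ^ \<gamma> * u x1) + C2 * (m * (4 ^ n * (\<epsilon> * D))\<^sup>2)"
        proof (rule decay[OF \<Omega>(1) NTA'(2) z1(1) _ _ cu], unfold \<epsilon>(3))
          show "0 < \<epsilon> * D" using \<epsilon> True by simp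
          show "D / 4 < diameter \<Omega>" if "bounded \<Omega>"
          proof -
            have "r \<le> K * r" using K r by simp
            then show ?thesis using diam[OF that] D r by linarith
          qed
          show "0 \<le> 2 ^ \<gamma> * u x1" "0 \<le> m" using u1 m by auto
          show "u y \<le> 0" if "y \<in> frontier \<Omega> \<inter> ball z1 (D / 4)" for y
          proof -
            have "y \<in> ball z (3 * r)" using close[of y] that D r by (simp add: dist_commute)
            then have "u y = 0" using admissible_frontier[OF u] unit that by blast
            then show ?thesis by simp
          qed
          \<comment> \<open>Here 2 r - dist y z is at least D / 2, so maximality costs no more than
            2^\<gamma>.\<close>
          show "u y \<le> 2 ^ \<gamma> * u x1" if y: "y \<in> \<Omega> \<inter> ball z1 (D / 4)" for y
          proof -
            have cy: "dist y z \<le> 2 * r - D / 2" using close y by blast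
            have yG: "y \<in> ?G"
              using y cy D closure_subset[of \<Omega>] by (auto simp: dist_commute)
            have "u y * (D / 2) ^ \<gamma> \<le> ?\<Phi> y"
              using cy D admissible_nonneg[OF u] yG by (intro mult_left_mono power_mono) auto
            also have "\<dots> \<le> u x1 * D ^ \<gamma>" using x1(2)[OF yG] by (simp add: D_def)
            finally show ?thesis using True by (simp add: power_divide field_simps)
          qed
          show "- (m * \<rho>\<^sup>2) \<le> defect u y \<rho>" if "0 < \<rho>" "cball y \<rho> \<subseteq> \<Omega>" for y \<rho>
            using admissible_defect[OF u that] by linarith
        qed
        moreover have "x1 \<in> \<Omega> \<inter> ball z1 (\<epsilon> * D)"
          using True near z1 by (simp add: dist_commute)
        ultimately have "u x1 \<le> (1 - \<theta>) ^ n * (2 ^ \<gamma> * u x1) + C2 * (m * (D / 4)\<^sup>2)"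
          unfolding \<epsilon>(3) by blast
        moreover have "(1 - \<theta>) ^ n * (2 ^ \<gamma> * u x1) \<le> 1 / (2 * 2 ^ \<gamma>) * (2 ^ \<gamma> * u x1)"
          using n u1 by (intro mult_right_mono) auto
        moreover have "C2 * (m * (D / 4)\<^sup>2) \<le> C2 * (m * r\<^sup>2)"
          using C2 m D r by (intro mult_left_mono power_mono) auto
        ultimately have "u x1 \<le> 2 * C2 * m * r\<^sup>2" by simp
        also have "\<dots> \<le> 2 * C2 * m * (K\<^sup>2 / c * u a)"
        proof (rule mult_left_mono)
          show "r\<^sup>2 \<le> K\<^sup>2 / c * u a"
            using a K by (intro admissible_square_le[OF u a(1) c \<beta> K r]) (simp add: field_simps)
        qed (use C2 m in auto)
        finally have "u x1 * D ^ \<gamma> \<le> 2 * C2 * m * (K\<^sup>2 / c * u a) * (2 * r) ^ \<gamma>"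
          using D u1 by (intro mult_mono power_mono) auto
        also have "\<dots> = 2 * C2 * m * (K\<^sup>2 / c) * 2 ^ \<gamma> * r ^ \<gamma> * u a"
          by (simp add: power_mult_distrib)
        also have "\<dots> \<le> C * r ^ \<gamma> * u a"
          using C1 \<epsilon>(1) r ua by (intro mult_right_mono) (auto simp: C_def)
        finally show ?thesis .
      qed
    qed
    have xG: "x \<in> ?G" using x r closure_subset[of \<Omega>] by (auto simp: dist_commute)
    have "u x * r ^ \<gamma> \<le> ?\<Phi> x"
      using x r admissible_nonneg[OF u] xG by (intro mult_left_mono power_mono) auto
    also have "\<dots> \<le> u x1 * D ^ \<gamma>" using x1(2)[OF xG] by (simp add: D_def)
    also note key
    finally have "u x * r ^ \<gamma> \<le> (C * u a) * r ^ \<gamma>" by (simp add: mult.commute mult.left_commute)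
    then show "u x \<le> C * u a" using r by simp
  qed
qed

text \<open>In a very small domain the whole frontier lies in the unit ball, so \<open>u\<close>
  vanishes on all of it. Decay at the frontier point nearest to a maximum of \<open>u\<close> then
  bounds \<theta> times that maximum, which is at least \<theta>, by a multiple of the squared
  diameter. The bound makes one radius usable in the corkscrew conditions of all domains.\<close>

lemma diameter_lower_bound:
  fixes K c \<beta> m :: real
  assumes K: "1 \<le> K" and m: "0 < m"
  obtains \<rho> where "0 < \<rho>"
    "\<And>(\<Omega> :: 'a::euclidean_space set) u x.
      \<lbrakk>NTA K \<Omega>; admissible c \<beta> m \<Omega> u; 0 \<in> frontier \<Omega>; bounded \<Omega>; x \<in> \<Omega>; u x = 1\<rbrakk> \<Longrightarrow> \<rho> \<le> diameter \<Omega>"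
proof -
  obtain \<theta> C where \<theta>: "0 < \<theta>" "\<theta> < 1" and C: "0 < C" and decay:
    "\<And>(\<Omega> :: 'a set) f z s t L.
      \<lbrakk>open \<Omega>; corkscrew K \<Omega> (- \<Omega>); z \<in> frontier \<Omega>; 0 < s; bounded \<Omega> \<Longrightarrow> s < diameter \<Omega>;
       continuous_on (closure \<Omega>) f; 0 \<le> t; 0 \<le> L;
       \<And>x. x \<in> frontier \<Omega> \<inter> ball z (4 * s) \<Longrightarrow> f x \<le> 0;
       \<And>x. x \<in> \<Omega> \<inter> ball z (4 * s) \<Longrightarrow> f x \<le> t;
       \<And>x r. 0 < r \<Longrightarrow> cball x r \<subseteq> \<Omega> \<Longrightarrow> - (L * r\<^sup>2) \<le> defect f x r\<rbrakk>
      \<Longrightarrow> \<forall>x \<in> \<Omega> \<inter> ball z s. f x \<le> (1 - \<theta>) * t + C * (L * s\<^sup>2)"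
    by (fact boundary_decay[OF K])
  define \<rho> where "\<rho> = min (1/2) (sqrt (\<theta> / (C * m)))"
  show thesis
  proof
    show "0 < \<rho>" using \<theta> C m by (simp add: \<rho>_def)
    fix \<Omega> :: "'a set" and u x
    assume NTA: "NTA K \<Omega>" and u: "admissible c \<beta> m \<Omega> u" and zero: "0 \<in> frontier \<Omega>"
      and bdd: "bounded \<Omega>" and x: "x \<in> \<Omega>" "u x = 1"
    have \<Omega>: "open \<Omega>" "frontier \<Omega> \<noteq> {}" "corkscrew K \<Omega> (- \<Omega>)"
      using NTA zero by (auto simp: NTA_def one_sided_NTA_def)
    show "\<rho> \<le> diameter \<Omega>"
    proof (rule ccontr)
      assume "\<not> \<rho> \<le> diameter \<Omega>"
      then have small: "diameter \<Omega> < 1/2" "diameter \<Omega> < sqrt (\<theta> / (C * m))"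
        by (auto simp: \<rho>_def)
      have f0: "u y \<le> 0" if "y \<in> frontier \<Omega>" for y
      proof -
        have "dist 0 y \<le> diameter (closure \<Omega>)"
          using that zero bdd by (intro diameter_bounded_bound) (auto simp: frontier_def)
        then have "y \<in> ball 0 1" using small diameter_closure[OF bdd] by simp
        then show ?thesis using admissible_frontier[OF u that] by simp
      qed
      have cu: "continuous_on (closure \<Omega>) u" by (rule admissible_continuous[OF u])
      have "compact (closure \<Omega>)" using bdd by simp
      then obtain x1 where x1: "x1 \<in> closure \<Omega>" "\<And>y. y \<in> closure \<Omega> \<Longrightarrow> u y \<le> u x1"
        using continuous_attains_sup[OF _ _ cu] x closure_subset by blast
      have u1: "1 \<le> u x1" using x1(2)[of x] x closure_subset by auto
      have x1\<Omega>: "x1 \<in> \<Omega>"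
      proof (rule ccontr)
        assume "x1 \<notin> \<Omega>"
        then have "x1 \<in> frontier \<Omega>" using x1 \<Omega> by (simp add: frontier_def interior_open)
        then show False using f0 u1 by fastforce
      qed
      let ?d = "infdist x1 (frontier \<Omega>)"
      have d: "0 < ?d" by (rule infdist_frontier_pos[OF \<Omega>(1,2) x1\<Omega>])
      have "diameter (ball x1 ?d) \<le> diameter \<Omega>"
        by (rule diameter_subset[OF ball_infdist_frontier_subset[OF x1\<Omega>] bdd])
      then have dd: "2 * ?d \<le> diameter \<Omega>" using d by simp
      obtain z where z: "z \<in> frontier \<Omega>" "dist x1 z = ?d"
        using nearest_frontier_point \<Omega>(2) by blast
      \<comment> \<open>The open ball must contain \<open>x1\<close>, at distance exactly
        \<open>?d\<close>, while its radius must stay below the diameter, which is at least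
        \<open>2 * ?d\<close>; the factor 3/2 lies between.\<close>
      have "\<forall>y \<in> \<Omega> \<inter> ball z (3/2 * ?d). u y \<le> (1 - \<theta>) * u x1 + C * (m * (3/2 * ?d)\<^sup>2)"
      proof (rule decay[OF \<Omega>(1,3) z(1) _ _ cu])
        show "u y \<le> u x1" if "y \<in> \<Omega> \<inter> ball z (4 * (3/2 * ?d))" for y
          using x1(2) that closure_subset by blast
        show "- (m * r\<^sup>2) \<le> defect u y r" if "0 < r" "cball y r \<subseteq> \<Omega>" for y r
          using admissible_defect[OF u that] by linarith
      qed (use d dd u1 m f0 in auto)
      moreover have "x1 \<in> \<Omega> \<inter> ball z (3/2 * ?d)"
        using x1\<Omega> z d by (simp add: dist_commute)
      ultimately have "u x1 \<le> (1 - \<theta>) * u x1 + C * (m * (3/2 * ?d)\<^sup>2)" by blast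
      then have "\<theta> * u x1 \<le> C * (m * (3/2 * ?d)\<^sup>2)" by (simp add: algebra_simps)
      also have "\<dots> \<le> C * (m * (diameter \<Omega>)\<^sup>2)"
        using dd d C m by (intro mult_left_mono power_mono) auto
      finally have "\<theta> \<le> C * (m * (diameter \<Omega>)\<^sup>2)"
        using mult_left_mono[OF u1, of \<theta>] \<theta> by linarith
      then have "\<theta> / (C * m) \<le> (diameter \<Omega>)\<^sup>2"
        using C m by (simp add: field_simps)
      then have "sqrt (\<theta> / (C * m)) \<le> diameter \<Omega>"
        using dd d by (intro real_le_lsqrt) auto
      with small show False by linarith
    qed
  qed
qed

section \<open>Boundary Harnack inequality\<close>

text \<open>\<open>\<mu>\<close> is the factor by which r^(2 - \<beta>) shrinks when r is halved.
  The next tolerance is spent in two halves: the choice of \<open>n\<close> fits the decayed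
  positive part into one, \<open>r_small\<close> the error of the thin layer step into the
  other.\<close>

lemma boundary_harnack_iteration:
  fixes K c \<beta> m :: real and \<Omega> :: "'a::euclidean_space set"
  defines "\<mu> \<equiv> 2 powr (\<beta> - 2)"
  assumes K: "1 \<le> K" and c: "0 < c" and \<beta>: "0 < \<beta>" "\<beta> < 2" and m: "0 < m"
    and H1: "1 \<le> H1" and H2: "1 \<le> H2" and A: "0 < A" and C: "0 < C" and \<theta>: "0 < \<theta>" "\<theta> < 1"
    and n: "(1 - \<theta>) ^ n \<le> \<mu> / (2 * H1)"
    and NTA: "NTA K \<Omega>" and u: "admissible c \<beta> m \<Omega> u" and v: "admissible c \<beta> m \<Omega> v"
    and z: "z \<in> frontier \<Omega>" and r: "0 < r" "r \<le> 1" and diam: "bounded \<Omega> \<Longrightarrow> r < diameter \<Omega>"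
    and unit: "ball z r \<subseteq> ball 0 1"
    and r_small: "C * m * r powr (2 - \<beta>) \<le> \<mu> * c / (4 * (2 * K) powr \<beta>)"
    and a: "\<And>k. a k \<in> \<Omega>" "\<And>k. dist (a k) z < r / 2 ^ k" "\<And>k. r / 2 ^ k / K \<le> infdist (a k) (frontier \<Omega>)"
    and chain1: "\<And>k w. w = u \<or> w = v \<Longrightarrow> w (a k) \<le> H1 * w (a (Suc k))"
    and chain2: "\<And>k x. x \<in> \<Omega> \<inter> ball z (r / 2 ^ k) \<Longrightarrow>
        r / 2 ^ k / (10 * real (Suc n)) \<le> infdist x (frontier \<Omega>) \<Longrightarrow> u (a k) \<le> H2 * u x"
    and start: "\<And>x. x \<in> \<Omega> \<inter> ball z r \<Longrightarrow> v x \<le> A * v (a 0)"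
    and thin: "\<And>f w \<rho> t L.
      \<lbrakk>0 < \<rho>; bounded \<Omega> \<Longrightarrow> \<rho> < diameter \<Omega>; continuous_on (closure \<Omega>) f; 0 \<le> t; 0 \<le> L;
       \<And>x. x \<in> frontier \<Omega> \<inter> ball w \<rho> \<Longrightarrow> f x \<le> 0;
       \<And>x. x \<in> \<Omega> \<inter> ball w \<rho> \<Longrightarrow> f x \<le> t;
       \<And>x. x \<in> \<Omega> \<inter> ball w \<rho> \<Longrightarrow> \<rho> / (10 * real (Suc n)) \<le> infdist x (frontier \<Omega>) \<Longrightarrow> f x \<le> 0;
       \<And>x s. 0 < s \<Longrightarrow> cball x s \<subseteq> \<Omega> \<Longrightarrow> - (L * s\<^sup>2) \<le> defect f x s\<rbrakk>
      \<Longrightarrow> \<forall>x \<in> \<Omega> \<inter> ball w (\<rho> / 2). f x \<le> (1 - \<theta>) ^ n * t + C * (L * \<rho>\<^sup>2)"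
    and x: "x \<in> \<Omega>" "dist x z = infdist x (frontier \<Omega>)" "dist x z < r"
  shows "v x \<le> 2 * A * exp (2 * H2 / (1 - \<mu>)) * (v (a 0) / u (a 0)) * u x"
proof -
  have \<Omega>: "open \<Omega>" "frontier \<Omega> \<noteq> {}" using NTA z by (auto simp: NTA_def one_sided_NTA_def)
  have \<mu>: "0 < \<mu>" "\<mu> < 1" using \<beta> by (auto simp: \<mu>_def powr_less_one)
  have up: "0 < u y" and vp: "0 < v y" if "y \<in> \<Omega>" for y
    using admissible_pos[OF _ c \<Omega> that] u v by auto
  define \<rho> where "\<rho> k = r / 2 ^ k" for k :: nat
  \<comment> \<open>This is 4 \<open>H2\<close> times the tolerance \<open>\<tau> k\<close> below: 4
    comes from S \<le> 4 Q u (a k), \<open>H2\<close> from moving from \<open>a k\<close> to a point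
    outside the layer. The factor 2 in \<open>Q\<close> at 0 matches the first tolerance
    1/2.\<close>
  define \<sigma> where "\<sigma> k = 2 * H2 * \<mu> ^ k" for k :: nat
  define Q where "Q = rec_nat (2 * A * (v (a 0) / u (a 0))) (\<lambda>k q. q * (1 + \<sigma> k))"
  have Q_0: "Q 0 = 2 * A * (v (a 0) / u (a 0))" and Q_Suc: "Q (Suc k) = Q k * (1 + \<sigma> k)" for k
    by (simp_all add: Q_def)
  have \<sigma>: "0 \<le> \<sigma> k" for k using H2 \<mu> by (simp add: \<sigma>_def)
  have Q: "0 < Q k" for k
  proof (induction k)
    case 0
    show ?case using A up[OF a(1)] vp[OF a(1)] by (simp add: Q_0)
  next
    case (Suc k)
    then show ?case using \<sigma>[of k] by (simp add: Q_Suc)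
  qed
  have Q_mono: "Q k \<le> Q (Suc k)" for k
    using Q[of k] \<sigma>[of k] by (simp add: Q_Suc)
  \<comment> \<open>The exponent is the sum of \<open>\<sigma>\<close> over the first
    \<open>k\<close> indices, a geometric series.\<close>
  have Q_le: "Q k \<le> Q 0 * exp (2 * H2 * (1 - \<mu> ^ k) / (1 - \<mu>))" for k
  proof (induction k)
    case (Suc k)
    have "Q (Suc k) \<le> Q 0 * exp (2 * H2 * (1 - \<mu> ^ k) / (1 - \<mu>)) * exp (\<sigma> k)"
      unfolding Q_Suc using Suc Q[of 0] \<sigma>[of k] exp_ge_add_one_self[of "\<sigma> k"]
      by (intro mult_mono) auto
    also have "\<dots> = Q 0 * exp (2 * H2 * (1 - \<mu> ^ k) / (1 - \<mu>) + \<sigma> k)"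
      by (simp add: exp_add)
    also have "2 * H2 * (1 - \<mu> ^ k) / (1 - \<mu>) + \<sigma> k = 2 * H2 * (1 - \<mu> ^ Suc k) / (1 - \<mu>)"
      using \<mu> by (simp add: \<sigma>_def field_simps)
    finally show ?case .
  qed simp
  have Q_bound: "Q k \<le> 2 * A * exp (2 * H2 / (1 - \<mu>)) * (v (a 0) / u (a 0))" for k
  proof -
    have "2 * H2 * (1 - \<mu> ^ k) / (1 - \<mu>) \<le> 2 * H2 / (1 - \<mu>)"
      using \<mu> H2 by (intro divide_right_mono) (auto simp: mult_left_le)
    then have "Q 0 * exp (2 * H2 * (1 - \<mu> ^ k) / (1 - \<mu>)) \<le> Q 0 * exp (2 * H2 / (1 - \<mu>))"
      using Q[of 0] by simp
    with Q_le[of k] have "Q k \<le> Q 0 * exp (2 * H2 / (1 - \<mu>))" by (rule order_trans)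
    then show ?thesis by (simp only: Q_0 mult_ac)
  qed
  have \<rho>: "0 < \<rho> k" "\<rho> k \<le> r" "\<rho> (Suc k) = \<rho> k / 2" for k
    using r by (auto simp: \<rho>_def divide_le_eq mult_le_cancel_left1)
  define S where "S k = Q k * u (a k) + v (a k)" for k
  have S: "0 < S k" for k
    using Q[of k] up[OF a(1)] vp[OF a(1)] by (simp add: S_def add_pos_pos)
  define \<tau> where "\<tau> k = \<mu> ^ k / 2" for k :: nat
  have \<tau>: "0 < \<tau> k" "\<tau> k \<le> 1/2" for k
    using \<mu> by (auto simp: \<tau>_def power_le_one)
  let ?step = "\<lambda>k. \<forall>x\<in>\<Omega> \<inter> ball z (\<rho> k). v x - Q k * u x \<le> \<tau> k * S k"
  \<comment> \<open>The induction hypothesis at \<open>a k\<close> itself, with tolerance at most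
    1/2, gives v \<le> 3 Q u there; so S k is bounded by u (a k) alone and can be carried over to
    \<open>x\<close>.\<close>
  have layer: "v x \<le> Q (Suc k) * u x"
    if step: "?step k" and x: "x \<in> \<Omega> \<inter> ball z (\<rho> k)"
      and far: "\<rho> k / (10 * real (Suc n)) \<le> infdist x (frontier \<Omega>)" for k x
  proof -
    have "a k \<in> \<Omega> \<inter> ball z (\<rho> k)"
      using a(1,2)[of k] by (auto simp: \<rho>_def dist_commute)
    with step have "v (a k) - Q k * u (a k) \<le> \<tau> k * S k" by blast
    also have "\<dots> \<le> 1/2 * S k" using \<tau>[of k] S[of k] by (intro mult_right_mono) auto
    finally have "v (a k) \<le> 3 * (Q k * u (a k))" by (simp add: S_def)
    then have "S k \<le> 4 * Q k * u (a k)" by (simp add: S_def)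
    also have "\<dots> \<le> 4 * Q k * (H2 * u x)"
      using chain2[of x k] x far Q[of k] by (intro mult_left_mono) (auto simp: \<rho>_def)
    finally have "\<tau> k * S k \<le> \<tau> k * (4 * Q k * (H2 * u x))"
      using \<tau>[of k] by (intro mult_left_mono) auto
    also have "\<dots> = Q k * \<sigma> k * u x" by (simp add: \<tau>_def \<sigma>_def)
    finally have "v x - Q k * u x \<le> Q k * \<sigma> k * u x"
      using bspec[OF step x] by (rule order_trans[rotated])
    then show ?thesis by (simp add: Q_Suc algebra_simps)
  qed
  have step: "?step k" for k
  proof (induction k)
    case 0
    show ?case
    proof
      fix x assume x: "x \<in> \<Omega> \<inter> ball z (\<rho> 0)"
      have "v x - Q 0 * u x \<le> v x" using Q[of 0] up[of x] x by simp
      also have "\<dots> \<le> A * v (a 0)" using start x by (simp add: \<rho>_def)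
      also have "\<dots> = 1/2 * (Q 0 * u (a 0))" using up[OF a(1), of 0] by (simp add: Q_0)
      also have "\<dots> \<le> \<tau> 0 * S 0" using vp[OF a(1), of 0] by (simp add: \<tau>_def S_def)
      finally show "v x - Q 0 * u x \<le> \<tau> 0 * S 0" .
    qed
  next
    case (Suc k)
    let ?L = "m * (1 + Q (Suc k))"
    \<comment> \<open>The difference is spelled as a linear combination to match
      \<open>defect_lincomb\<close>.\<close>
    have "\<forall>x \<in> \<Omega> \<inter> ball z (\<rho> k / 2). 1 * v x + (- Q (Suc k)) * u x
        \<le> (1 - \<theta>) ^ n * (\<tau> k * S k) + C * (?L * (\<rho> k)\<^sup>2)"
    proof (rule thin[OF \<rho>(1)])
      show "\<rho> k < diameter \<Omega>" if "bounded \<Omega>" using \<rho>[of k] diam[OF that] by linarith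
      show "continuous_on (closure \<Omega>) (\<lambda>x. 1 * v x + (- Q (Suc k)) * u x)"
        by (intro continuous_intros admissible_continuous[OF u] admissible_continuous[OF v])
      show "0 \<le> \<tau> k * S k" using \<tau>[of k] S[of k] by simp
      show "0 \<le> ?L" using m Q[of "Suc k"] by simp
      show "1 * v x + (- Q (Suc k)) * u x \<le> 0" if "x \<in> frontier \<Omega> \<inter> ball z (\<rho> k)" for x
      proof -
        have "x \<in> ball z r" using that \<rho>(2)[of k] by simp
        then have "x \<in> ball 0 1" using unit by blast
        then show ?thesis
          using admissible_frontier[OF u] admissible_frontier[OF v] that by simp
      qed
      show "1 * v x + (- Q (Suc k)) * u x \<le> \<tau> k * S k" if x: "x \<in> \<Omega> \<inter> ball z (\<rho> k)" for x
      proof -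
        have "Q k * u x \<le> Q (Suc k) * u x"
          using Q_mono[of k] up[of x] x by (intro mult_right_mono) auto
        moreover have "v x - Q k * u x \<le> \<tau> k * S k" using Suc x by blast
        ultimately show ?thesis by simp
      qed
      show "1 * v x + (- Q (Suc k)) * u x \<le> 0"
        if "x \<in> \<Omega> \<inter> ball z (\<rho> k)" "\<rho> k / (10 * real (Suc n)) \<le> infdist x (frontier \<Omega>)" for x
        using layer[OF Suc that] by simp
      show "- (?L * s\<^sup>2) \<le> defect (\<lambda>x. 1 * v x + (- Q (Suc k)) * u x) x s"
        if s: "0 < s" "cball x s \<subseteq> \<Omega>" for x s
      proof -
        have "cball x s \<subseteq> closure \<Omega>" using s closure_subset by blast
        then have "defect (\<lambda>x. 1 * v x + (- Q (Suc k)) * u x) x s = 1 * defect v x s + (- Q (Suc k)) * defect u x s"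
          by (intro defect_lincomb s continuous_on_subset[OF admissible_continuous[OF u]]
              continuous_on_subset[OF admissible_continuous[OF v]])
        moreover have "- (m * s\<^sup>2) \<le> defect v x s"
          using admissible_defect[OF v s] by linarith
        moreover have "Q (Suc k) * defect u x s \<le> Q (Suc k) * (m * s\<^sup>2)"
          using admissible_defect[OF u s] Q[of "Suc k"] by (intro mult_left_mono) auto
        ultimately show ?thesis by (simp add: algebra_simps)
      qed
    qed
    moreover have "(1 - \<theta>) ^ n * (\<tau> k * S k) + C * (?L * (\<rho> k)\<^sup>2) \<le> \<tau> (Suc k) * S (Suc k)"
    proof -
      have "S k \<le> H1 * S (Suc k)"
      proof -
        have "Q k * u (a k) \<le> Q (Suc k) * (H1 * u (a (Suc k)))"
          using Q_mono[of k] Q[of "Suc k"] up[OF a(1), of k] chain1[of u k] by (intro mult_mono) auto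
        then show ?thesis using chain1[of v k] by (simp add: S_def algebra_simps)
      qed
      then have "(1 - \<theta>) ^ n * (\<tau> k * S k) \<le> \<mu> / (2 * H1) * (\<tau> k * (H1 * S (Suc k)))"
        using n \<tau>[of k] S[of k] H1 \<mu> \<theta> by (intro mult_mono) auto
      also have "\<dots> = \<tau> (Suc k) * S (Suc k) / 2"
        using H1 by (simp add: \<tau>_def)
      finally have 1: "(1 - \<theta>) ^ n * (\<tau> k * S k) \<le> \<tau> (Suc k) * S (Suc k) / 2" .
      let ?b = "\<rho> (Suc k) / K"
      have b: "?b = \<rho> k / (2 * K)" by (simp add: \<rho>)
      have b0: "0 \<le> ?b" using K \<rho>(1)[of "Suc k"] by simp
      have b1: "?b \<le> infdist (a (Suc k)) (frontier \<Omega>)"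
        using a(3)[of "Suc k"] by (simp only: \<rho>_def)
      have "c * ?b powr \<beta> \<le> w (a (Suc k))" if w: "admissible c \<beta> m \<Omega> w" for w
      proof -
        have "c * ?b powr \<beta> \<le> c * infdist (a (Suc k)) (frontier \<Omega>) powr \<beta>"
          using c \<beta> b0 b1 by (intro mult_left_mono powr_mono2) auto
        also have "\<dots> \<le> w (a (Suc k))" using w a(1) by (simp add: admissible_def)
        finally show ?thesis .
      qed
      from this[OF u] this[OF v] have "Q (Suc k) * (c * ?b powr \<beta>) + c * ?b powr \<beta> \<le> S (Suc k)"
        unfolding S_def using Q[of "Suc k"] by (intro add_mono mult_left_mono) auto
      then have S_ge: "(1 + Q (Suc k)) * (c * ?b powr \<beta>) \<le> S (Suc k)"
        by (simp add: algebra_simps)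
      \<comment> \<open>The square splits into \<rho>^(2 - \<beta>), which supplies
        \<open>\<mu> ^ k\<close>, and \<rho>^\<beta>, which the growth bound at
        \<open>a (Suc k)\<close> controls.\<close>
      have "C * m * (\<rho> k)\<^sup>2 = C * m * r powr (2 - \<beta>) * \<mu> ^ k * \<rho> k powr \<beta>"
      proof -
        have "(\<rho> k)\<^sup>2 = \<rho> k powr (2 - \<beta>) * \<rho> k powr \<beta>"
          using \<rho>(1)[of k] by (simp flip: powr_add)
        also have "\<rho> k powr (2 - \<beta>) = r powr (2 - \<beta>) / (2 ^ k) powr (2 - \<beta>)"
          using r by (simp add: \<rho>_def powr_divide)
        also have "(2 ^ k) powr (2 - \<beta>) = inverse (\<mu> ^ k)"
        proof -
          have "(2 ^ k :: real) powr (2 - \<beta>) = 2 powr (real k * (2 - \<beta>))"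
            by (simp add: powr_powr flip: powr_realpow)
          also have "\<dots> = inverse (2 powr (real k * (\<beta> - 2)))"
            by (simp add: algebra_simps flip: powr_minus)
          also have "2 powr (real k * (\<beta> - 2)) = \<mu> ^ k"
            by (simp add: \<mu>_def powr_powr mult.commute flip: powr_realpow)
          finally show ?thesis .
        qed
        finally show ?thesis by (simp add: divide_inverse)
      qed
      also have "\<dots> \<le> \<mu> * c / (4 * (2 * K) powr \<beta>) * \<mu> ^ k * \<rho> k powr \<beta>"
        using \<mu> by (intro mult_right_mono r_small) auto
      also have "\<dots> = \<tau> (Suc k) / 2 * (c * ?b powr \<beta>)"
        unfolding b using K \<rho>(1)[of k] by (simp add: powr_divide \<tau>_def)
      finally have "(1 + Q (Suc k)) * (C * m * (\<rho> k)\<^sup>2) \<le> (1 + Q (Suc k)) * (\<tau> (Suc k) / 2 * (c * ?b powr \<beta>))"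
        using Q[of "Suc k"] by (intro mult_left_mono) auto
      also have "\<dots> = \<tau> (Suc k) / 2 * ((1 + Q (Suc k)) * (c * ?b powr \<beta>))" by simp
      also have "\<dots> \<le> \<tau> (Suc k) / 2 * S (Suc k)"
        using \<tau>[of "Suc k"] by (intro mult_left_mono S_ge) auto
      finally have "C * (?L * (\<rho> k)\<^sup>2) \<le> \<tau> (Suc k) * S (Suc k) / 2"
        by (simp add: mult.commute mult.left_commute)
      with 1 show ?thesis by linarith
    qed
    ultimately show ?case unfolding \<rho>(3) by (auto intro: order_trans)
  qed
  let ?d = "infdist x (frontier \<Omega>)"
  have d: "0 < ?d" by (rule infdist_frontier_pos[OF \<Omega> x(1)])
  have ex: "\<exists>k. \<rho> (Suc k) \<le> ?d"
  proof -
    obtain k where "r / ?d < 2 ^ k" using real_arch_pow[of 2 "r / ?d"] by auto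
    then have "r < ?d * 2 ^ k" using d by (simp add: pos_divide_less_eq mult.commute)
    then have "\<rho> k < ?d" by (simp add: \<rho>_def pos_divide_less_eq)
    then have "\<rho> (Suc k) \<le> ?d" using \<rho>[of k] by simp
    then show ?thesis ..
  qed
  \<comment> \<open>As \<open>z\<close> is a frontier point nearest to \<open>x\<close>, the depth
    of \<open>x\<close> equals its distance to \<open>z\<close>. At the scale comparable to that
    distance \<open>x\<close> is outside the layer, so finitely many steps of the induction reach
    it.\<close>
  define k where "k = (LEAST k. \<rho> (Suc k) \<le> ?d)"
  have k: "\<rho> (Suc k) \<le> ?d" unfolding k_def by (rule LeastI_ex[OF ex])
  have k2: "?d < \<rho> k"
  proof (cases k)
    case 0
    then show ?thesis using x by (simp add: \<rho>_def)
  next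
    case (Suc j)
    then have "j < (LEAST k. \<rho> (Suc k) \<le> ?d)" by (simp add: k_def)
    then have "\<not> \<rho> (Suc j) \<le> ?d" by (rule not_less_Least)
    then show ?thesis unfolding Suc by simp
  qed
  have "\<rho> k / (10 * real (Suc n)) \<le> \<rho> k / 2"
    using \<rho>(1)[of k] by (intro divide_left_mono) auto
  also have "\<rho> k / 2 \<le> ?d" using k by (simp only: \<rho>(3))
  finally have far: "\<rho> k / (10 * real (Suc n)) \<le> ?d" .
  have "x \<in> \<Omega> \<inter> ball z (\<rho> k)"
    using x k2 by (simp add: dist_commute)
  then have "v x \<le> Q (Suc k) * u x"
    by (rule layer[OF step _ far])
  also have "\<dots> \<le> 2 * A * exp (2 * H2 / (1 - \<mu>)) * (v (a 0) / u (a 0)) * u x"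
    using up[OF x(1)] by (intro mult_right_mono Q_bound) auto
  finally show ?thesis .
qed

lemma boundary_harnack:
  fixes K c \<beta> m :: real
  assumes K: "1 \<le> K" and c: "0 < c" and \<beta>: "0 < \<beta>" "\<beta> < 2" and m: "0 < m"
  obtains r\<^sub>0 B where "0 < r\<^sub>0" "0 < B"
    "\<And>(\<Omega> :: 'a::euclidean_space set) u v z r a x.
      \<lbrakk>NTA K \<Omega>; admissible c \<beta> m \<Omega> u; admissible c \<beta> m \<Omega> v; z \<in> frontier \<Omega>; 0 < r; r \<le> r\<^sub>0;
       bounded \<Omega> \<Longrightarrow> 2 * K * r < diameter \<Omega>; ball z (3 * r) \<subseteq> ball 0 1;
       a \<in> \<Omega>; dist a z < r; r / K \<le> infdist a (frontier \<Omega>);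
       x \<in> \<Omega>; dist x z = infdist x (frontier \<Omega>); dist x z < r\<rbrakk>
      \<Longrightarrow> v x \<le> B * (v a / u a) * u x"
proof -
  obtain H where H: "1 \<le> H" and Har:
    "\<And>(\<Omega> :: 'a set) u. \<lbrakk>open \<Omega>; frontier \<Omega> \<noteq> {}; admissible c \<beta> m \<Omega> u\<rbrakk> \<Longrightarrow> harnack H \<Omega> u"
    by (fact admissible_harnack[OF c \<beta> m])
  obtain A where A: "0 < A" and carl:
    "\<And>(\<Omega> :: 'a set) u z r a x.
      \<lbrakk>NTA K \<Omega>; admissible c \<beta> m \<Omega> u; z \<in> frontier \<Omega>; 0 < r; r \<le> 1; bounded \<Omega> \<Longrightarrow> 2 * K * r < diameter \<Omega>;
       ball z (3 * r) \<subseteq> ball 0 1;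
       a \<in> \<Omega>; dist a z \<le> r; r / K \<le> infdist a (frontier \<Omega>); x \<in> \<Omega>; dist x z \<le> r\<rbrakk>
      \<Longrightarrow> u x \<le> A * u a"
    by (fact carleson[OF K c \<beta> m])
  obtain \<theta> C where \<theta>: "0 < \<theta>" "\<theta> < 1" and C: "0 < C" and thin:
    "\<And>n (\<Omega> :: 'a set) f z r t L.
      \<lbrakk>open \<Omega>; frontier \<Omega> \<noteq> {}; corkscrew K \<Omega> (- \<Omega>); 0 < r; bounded \<Omega> \<Longrightarrow> r < diameter \<Omega>;
       continuous_on (closure \<Omega>) f; 0 \<le> t; 0 \<le> L;
       \<And>x. x \<in> frontier \<Omega> \<inter> ball z r \<Longrightarrow> f x \<le> 0;
       \<And>x. x \<in> \<Omega> \<inter> ball z r \<Longrightarrow> f x \<le> t;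
       \<And>x. x \<in> \<Omega> \<inter> ball z r \<Longrightarrow> r / (10 * real (Suc n)) \<le> infdist x (frontier \<Omega>) \<Longrightarrow> f x \<le> 0;
       \<And>x r. 0 < r \<Longrightarrow> cball x r \<subseteq> \<Omega> \<Longrightarrow> - (L * r\<^sup>2) \<le> defect f x r\<rbrakk>
      \<Longrightarrow> \<forall>x \<in> \<Omega> \<inter> ball z (r / 2). f x \<le> (1 - \<theta>) ^ n * t + C * (L * r\<^sup>2)"
    by (fact thin_layer_decay[OF K])
  obtain H1 where H1: "1 \<le> H1" and ch1:
    "\<And>(\<Omega> :: 'a set) u x y s.
      \<lbrakk>one_sided_NTA K \<Omega>; harnack H \<Omega> u; x \<in> \<Omega>; y \<in> \<Omega>; 0 < s; s \<le> 1;
        s \<le> infdist x (frontier \<Omega>); s \<le> infdist y (frontier \<Omega>); dist x y \<le> 4 * K * s\<rbrakk> \<Longrightarrow> u x \<le> H1 * u y"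
    using harnack_chain[OF K H] by blast
  define \<mu> where "\<mu> = 2 powr (\<beta> - 2)"
  have \<mu>: "0 < \<mu>" "\<mu> < 1" using \<beta> by (auto simp: \<mu>_def powr_less_one)
  \<comment> \<open>This depends on \<theta>, \<mu> and \<open>H1\<close> only, so the chain
    constant \<open>H2\<close>, which involves the width of the layer, can be chosen
    afterwards.\<close>
  obtain n where n: "(1 - \<theta>) ^ n < \<mu> / (2 * H1)"
    using real_arch_pow_inv[of "\<mu> / (2 * H1)" "1 - \<theta>"] \<theta> \<mu> H1 by auto
  define N where "N = 10 * real (Suc n)"
  have N: "1 \<le> N" by (simp add: N_def)
  obtain H2 where H2: "1 \<le> H2" and ch2:
    "\<And>(\<Omega> :: 'a set) u x y s.
      \<lbrakk>one_sided_NTA K \<Omega>; harnack H \<Omega> u; x \<in> \<Omega>; y \<in> \<Omega>; 0 < s; s \<le> 1;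
        s \<le> infdist x (frontier \<Omega>); s \<le> infdist y (frontier \<Omega>); dist x y \<le> 2 * N * K * s\<rbrakk> \<Longrightarrow> u x \<le> H2 * u y"
    using harnack_chain[OF K H] by blast
  define \<kappa> where "\<kappa> = \<mu> * c / (4 * (2 * K) powr \<beta>) / (C * m)"
  have \<kappa>: "0 < \<kappa>" using \<mu> c K C m by (simp add: \<kappa>_def)
  \<comment> \<open>The second entry is the radius at which \<open>r_small\<close> becomes an
    equality.\<close>
  define r\<^sub>0 where "r\<^sub>0 = min 1 (\<kappa> powr (1 / (2 - \<beta>)))"
  have r0: "0 < r\<^sub>0" using \<kappa> by (simp add: r\<^sub>0_def)
  show thesis
  proof (rule that[OF r0])
    show "0 < 2 * A * exp (2 * H2 / (1 - \<mu>))" using A by simp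
    fix \<Omega> :: "'a set" and u v z r a x
    assume NTA: "NTA K \<Omega>" and u: "admissible c \<beta> m \<Omega> u" and v: "admissible c \<beta> m \<Omega> v"
      and z: "z \<in> frontier \<Omega>" and r: "0 < r" "r \<le> r\<^sub>0" and diam: "bounded \<Omega> \<Longrightarrow> 2 * K * r < diameter \<Omega>"
      and unit: "ball z (3 * r) \<subseteq> ball 0 1"
      and a: "a \<in> \<Omega>" "dist a z < r" "r / K \<le> infdist a (frontier \<Omega>)"
      and x: "x \<in> \<Omega>" "dist x z = infdist x (frontier \<Omega>)" "dist x z < r"
    have NTA': "one_sided_NTA K \<Omega>" "corkscrew K \<Omega> (- \<Omega>)" and \<Omega>: "open \<Omega>" "frontier \<Omega> \<noteq> {}"
      using NTA z by (auto simp: NTA_def one_sided_NTA_def)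
    have hu: "harnack H \<Omega> u" and hv: "harnack H \<Omega> v"
      using Har[OF \<Omega>] u v by auto
    have r1: "r \<le> 1" using r by (simp add: r\<^sub>0_def)
    have diam': "r < diameter \<Omega>" if "bounded \<Omega>"
    proof -
      have "r \<le> K * r" using K r by simp
      then show ?thesis using diam[OF that] r by linarith
    qed
    have \<rho>: "0 < r / 2 ^ k" "r / 2 ^ k \<le> r" for k :: nat
      using r by (auto simp: divide_le_eq mult_le_cancel_left1)
    \<comment> \<open>The point at scale 0 is fixed to be the given \<open>a\<close>, since the
      ratio in the conclusion is taken there.\<close>
    have "\<exists>y. y \<in> \<Omega> \<and> dist y z < r / 2 ^ k \<and> r / 2 ^ k / K \<le> infdist y (frontier \<Omega>) \<and> (k = 0 \<longrightarrow> y = a)" for k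
    proof (cases k)
      case 0
      then show ?thesis using a by auto
    next
      case (Suc j)
      have "r / 2 ^ k < diameter \<Omega>" if "bounded \<Omega>" using diam'[OF that] \<rho>[of k] by linarith
      then obtain y where "y \<in> \<Omega>" "dist y z < r / 2 ^ k" "r / 2 ^ k / K \<le> infdist y (frontier \<Omega>)"
        using corkscrew_point[OF NTA'(1) z \<rho>(1)] by blast
      then show ?thesis using Suc by blast
    qed
    then obtain b where b: "\<And>k. b k \<in> \<Omega>" "\<And>k. dist (b k) z < r / 2 ^ k"
        "\<And>k. r / 2 ^ k / K \<le> infdist (b k) (frontier \<Omega>)" and b0: "b 0 = a"
      by metis
    have "v x \<le> 2 * A * exp (2 * H2 / (1 - 2 powr (\<beta> - 2))) * (v (b 0) / u (b 0)) * u x"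
    proof (rule boundary_harnack_iteration[OF K c \<beta> m H1 H2 A C \<theta> _ NTA u v z r(1) r1 diam' _ _ b])
      show "(1 - \<theta>) ^ n \<le> 2 powr (\<beta> - 2) / (2 * H1)" using n by (simp add: \<mu>_def)
      show "ball z r \<subseteq> ball 0 1" using unit r by (auto intro: order_trans[OF subset_ball])
      have "r powr (2 - \<beta>) \<le> (\<kappa> powr (1 / (2 - \<beta>))) powr (2 - \<beta>)"
        using r \<beta> by (intro powr_mono2) (auto simp: r\<^sub>0_def)
      also have "\<dots> = \<kappa>" using \<beta> \<kappa> by (simp add: powr_powr)
      finally have "C * m * r powr (2 - \<beta>) \<le> C * m * \<kappa>"
        using C m by (intro mult_left_mono) auto
      then show "C * m * r powr (2 - \<beta>) \<le> 2 powr (\<beta> - 2) * c / (4 * (2 * K) powr \<beta>)"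
        using C m by (simp add: \<kappa>_def \<mu>_def)
      show "w (b k) \<le> H1 * w (b (Suc k))" if "w = u \<or> w = v" for k w
      proof (rule ch1[OF NTA'(1)])
        show "harnack H \<Omega> w" using that hu hv by auto
        let ?s = "r / 2 ^ Suc k / K"
        have s: "?s \<le> r / 2 ^ k / K" "?s \<le> r / 2 ^ Suc k" "0 < ?s"
          using K \<rho>[of k] \<rho>[of "Suc k"] by (auto simp: field_simps)
        show "0 < ?s" "?s \<le> 1" using s(2,3) \<rho>(2)[of "Suc k"] r1 by auto
        show "?s \<le> infdist (b k) (frontier \<Omega>)" using s(1) b(3)[of k] by linarith
        show "?s \<le> infdist (b (Suc k)) (frontier \<Omega>)" by (rule b(3))
        have "dist (b (Suc k)) z < r / 2 ^ k"
          using b(2)[of "Suc k"] \<rho>(1)[of k] by simp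
        then have "dist (b k) (b (Suc k)) \<le> 2 * (r / 2 ^ k)"
          using b(2)[of k] dist_triangle2[of "b k" "b (Suc k)" z] by linarith
        also have "\<dots> = 4 * K * ?s" using K by simp
        finally show "dist (b k) (b (Suc k)) \<le> 4 * K * ?s" .
      qed (rule b)+
      show "u (b k) \<le> H2 * u y" if y: "y \<in> \<Omega> \<inter> ball z (r / 2 ^ k)"
        and far: "r / 2 ^ k / (10 * real (Suc n)) \<le> infdist y (frontier \<Omega>)" for k y
      proof (rule ch2[OF NTA'(1) hu b(1)])
        \<comment> \<open>Below both depths: that of \<open>b k\<close> is at least r / 2^k / K,
          that of \<open>y\<close> at least r / 2^k / N.\<close>
        let ?s = "r / 2 ^ k / (N * K)"
        have NK: "N \<le> N * K" "K \<le> N * K" "1 \<le> N * K"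
          using N K by (auto simp: mult_le_cancel_left1 mult_le_cancel_right1 intro: order_trans)
        have s: "?s \<le> r / 2 ^ k / N" "?s \<le> r / 2 ^ k / K" "?s \<le> r / 2 ^ k / 1"
          using NK N K \<rho>(1)[of k] by (intro divide_left_mono; simp)+
        show "y \<in> \<Omega>" using y by simp
        show "0 < ?s" using N K by (intro divide_pos_pos \<rho>(1) mult_pos_pos) auto
        show "?s \<le> 1" using s(3) \<rho>(2)[of k] r1 by simp
        show "?s \<le> infdist (b k) (frontier \<Omega>)" using s(2) b(3)[of k] by linarith
        show "?s \<le> infdist y (frontier \<Omega>)" using s(1) far by (simp add: N_def)
        have "dist (b k) y \<le> 2 * (r / 2 ^ k)"
          using b(2)[of k] y dist_triangle2[of "b k" y z] by (simp add: dist_commute)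
        also have "\<dots> = 2 * N * K * ?s" using N K by simp
        finally show "dist (b k) y \<le> 2 * N * K * ?s" .
      qed
      show "v y \<le> A * v (b 0)" if "y \<in> \<Omega> \<inter> ball z r" for y
        unfolding b0 using that a
        by (intro carl[OF NTA v z r(1) r1 diam unit]) (auto simp: dist_commute)
    qed (assumption | fact x | fact thin[OF \<Omega> NTA'(2)])+
    then show "v x \<le> 2 * A * exp (2 * H2 / (1 - \<mu>)) * (v a / u a) * u x"
      by (simp add: b0 \<mu>_def)
  qed
qed

section \<open>Comparison of two solutions\<close>

text \<open>A corkscrew ball of radius e / K sits in a ball of radius e. Taking e from a ball inside
  the domain keeps it below the diameter.\<close>

lemma NTA_constant_ge_1:
  fixes \<Omega> :: "'a::euclidean_space set"
  assumes NTA: "NTA K \<Omega>" and z: "z \<in> frontier \<Omega>"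
  shows "1 \<le> K"
proof -
  have K: "0 < K" and \<Omega>: "open \<Omega>" "\<Omega> \<noteq> {}" "corkscrew K \<Omega> \<Omega>"
    using NTA by (auto simp: NTA_def one_sided_NTA_def)
  obtain x e where e: "0 < e" "ball x e \<subseteq> \<Omega>"
    using \<Omega> open_contains_ball by blast
  have "e < diameter \<Omega>" if "bounded \<Omega>"
    using diameter_subset[OF e(2) that] e(1) by simp
  then obtain y where "ball y (e / K) \<subseteq> \<Omega> \<inter> ball z e"
    using \<Omega>(3) z e(1) unfolding corkscrew_def by blast
  then have "ball y (e / K) \<subseteq> ball z e" by blast
  then have "dist y z + e / K \<le> e"
    using e(1) K by (auto simp: ball_subset_ball_iff not_less[symmetric])
  then have "e / K \<le> e" using zero_le_dist[of y z] by linarith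
  then show ?thesis using e(1) K by (simp add: pos_divide_le_eq)
qed

text \<open>One point \<open>a\<close> of controlled depth and position suffices. Harnack chains
  transport the ratio to all points of depth \<open>s\<close> in the unit ball, at the cost of one
  factor H' for each function; shallower points are compared with a corkscrew point through the
  boundary Harnack inequality.\<close>

lemma comparison_from_point:
  fixes K c \<beta> m B s\<^sub>0 R :: real
  assumes K: "1 \<le> K" and c: "0 < c" and \<beta>: "0 < \<beta>" "\<beta> < 2" and m: "0 < m"
    and B: "0 < B" and s0: "0 < s\<^sub>0" and r: "0 < r" "r \<le> 1/8"
    and bh: "0 < A" "\<And>(\<Omega> :: 'a::euclidean_space set) u v z a x.
      \<lbrakk>NTA K \<Omega>; admissible c \<beta> m \<Omega> u; admissible c \<beta> m \<Omega> v; z \<in> frontier \<Omega>;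
       bounded \<Omega> \<Longrightarrow> 2 * K * r < diameter \<Omega>; ball z (3 * r) \<subseteq> ball 0 1;
       a \<in> \<Omega>; dist a z < r; r / K \<le> infdist a (frontier \<Omega>);
       x \<in> \<Omega>; dist x z = infdist x (frontier \<Omega>); dist x z < r\<rbrakk>
      \<Longrightarrow> v x \<le> A * (v a / u a) * u x"
  obtains C where
    "\<And>(\<Omega> :: 'a set) u v a x.
      \<lbrakk>NTA K \<Omega>; admissible c \<beta> m \<Omega> u; admissible c \<beta> m \<Omega> v; 0 \<in> frontier \<Omega>;
       bounded \<Omega> \<Longrightarrow> 2 * K * r < diameter \<Omega>;
       a \<in> \<Omega>; s\<^sub>0 \<le> infdist a (frontier \<Omega>); norm a \<le> R; v a \<le> B * u a;
       x \<in> \<Omega>; x \<in> ball 0 (1/2)\<rbrakk>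
      \<Longrightarrow> v x \<le> C * u x"
proof -
  obtain H where H: "1 \<le> H" and Har:
    "\<And>(\<Omega> :: 'a set) u. \<lbrakk>open \<Omega>; frontier \<Omega> \<noteq> {}; admissible c \<beta> m \<Omega> u\<rbrakk> \<Longrightarrow> harnack H \<Omega> u"
    by (fact admissible_harnack[OF c \<beta> m])
  define s where "s = min s\<^sub>0 (r / K)"
  have s: "0 < s" "s \<le> s\<^sub>0" "s \<le> r / K" "s \<le> r" "s \<le> 1"
  proof -
    show "0 < s" "s \<le> s\<^sub>0" "s \<le> r / K" using s0 r K by (auto simp: s_def)
    moreover have "r / K \<le> r" using r K by (simp add: pos_divide_le_eq)
    ultimately show "s \<le> r" "s \<le> 1" using r by linarith+
  qed
  obtain H' where H': "1 \<le> H'" and chain: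
    "\<And>(\<Omega> :: 'a set) u x y t.
      \<lbrakk>one_sided_NTA K \<Omega>; harnack H \<Omega> u; x \<in> \<Omega>; y \<in> \<Omega>; 0 < t; t \<le> 1;
        t \<le> infdist x (frontier \<Omega>); t \<le> infdist y (frontier \<Omega>); dist x y \<le> (R + 1) / s * t\<rbrakk> \<Longrightarrow> u x \<le> H' * u y"
    by (fact harnack_chain[OF K H])
  define C where "C = (1 + A) * (H'\<^sup>2 * B)"
  show thesis
  proof (rule that[of C])
    fix \<Omega> :: "'a set" and u v a x
    assume NTA: "NTA K \<Omega>" and u: "admissible c \<beta> m \<Omega> u" and v: "admissible c \<beta> m \<Omega> v"
      and zero: "0 \<in> frontier \<Omega>" and diam: "bounded \<Omega> \<Longrightarrow> 2 * K * r < diameter \<Omega>"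
      and a: "a \<in> \<Omega>" "s\<^sub>0 \<le> infdist a (frontier \<Omega>)" "norm a \<le> R" and va: "v a \<le> B * u a"
      and x: "x \<in> \<Omega>" "x \<in> ball 0 (1/2)"
    have NTA': "one_sided_NTA K \<Omega>" and \<Omega>: "open \<Omega>" "frontier \<Omega> \<noteq> {}"
      using NTA zero by (auto simp: NTA_def one_sided_NTA_def)
    have up: "0 < u y" if "y \<in> \<Omega>" for y
      by (rule admissible_pos[OF u c \<Omega> that])
    have reach: "v y \<le> H'\<^sup>2 * B * u y"
      if y: "y \<in> \<Omega>" "s \<le> infdist y (frontier \<Omega>)" "norm y \<le> 1" for y
    proof -
      have d: "dist y a \<le> (R + 1) / s * s"
        using s y(3) a(3) norm_triangle_ineq4[of y a] by (simp add: dist_norm)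
      have "v y \<le> H' * v a"
        using s a d by (intro chain[OF NTA' Har[OF \<Omega> v] y(1) a(1) s(1,5) y(2)]) auto
      also have "\<dots> \<le> H' * (B * u a)" using va H' by (intro mult_left_mono) auto
      also have "\<dots> \<le> H' * (B * (H' * u y))"
        using s a d y H' B
        by (intro mult_left_mono chain[OF NTA' Har[OF \<Omega> u] a(1) y(1) s(1,5) _ y(2)]) (auto simp: dist_commute)
      finally show ?thesis by (simp add: power2_eq_square mult_ac)
    qed
    have HB: "0 \<le> H'\<^sup>2 * B" using B by simp
    show "v x \<le> C * u x"
    proof (cases "r \<le> infdist x (frontier \<Omega>)")
      case True
      then have "v x \<le> H'\<^sup>2 * B * u x"
        using x s by (intro reach) auto
      also have "\<dots> \<le> C * u x"
        using up[OF x(1)] HB mult_nonneg_nonneg[OF less_imp_le[OF bh(1)] HB]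
        by (intro mult_right_mono) (auto simp: C_def distrib_right)
      finally show ?thesis .
    next
      case False
      obtain z where z: "z \<in> frontier \<Omega>" "dist x z = infdist x (frontier \<Omega>)"
        using nearest_frontier_point \<Omega> by blast
      \<comment> \<open>With r \<le> 1/8 this leaves room for \<open>ball z (3 * r)\<close> in the
        unit ball.\<close>
      have nz: "norm z < 1/2 + r"
        using norm_triangle_ineq4[of x "x - z"] x(2) False z(2) by (simp add: dist_norm)
      have rd: "r < diameter \<Omega>" if "bounded \<Omega>"
      proof -
        have "r \<le> K * r" using K r by simp
        then show ?thesis using diam[OF that] r by linarith
      qed
      obtain b where b: "b \<in> \<Omega>" "dist b z < r" "r / K \<le> infdist b (frontier \<Omega>)"
        using corkscrew_point[OF NTA' z(1) r(1) rd] by blast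
      have "norm b \<le> 1"
        using norm_triangle_ineq[of "b - z" z] b(2) nz r by (simp add: dist_norm)
      then have "v b \<le> H'\<^sup>2 * B * u b"
        using b s by (intro reach) auto
      then have ratio: "v b / u b \<le> H'\<^sup>2 * B"
        using up[OF b(1)] by (simp add: pos_divide_le_eq)
      have "v x \<le> A * (v b / u b) * u x"
      proof (rule bh(2)[OF NTA u v z(1) diam _ b x(1) z(2)])
        show "ball z (3 * r) \<subseteq> ball 0 1"
          using nz r by (simp add: ball_subset_ball_iff)
        show "dist x z < r" using False z by simp
      qed
      also have "\<dots> \<le> A * (H'\<^sup>2 * B) * u x"
        using ratio bh(1) up[OF x(1)] by (intro mult_right_mono mult_left_mono) auto
      also have "\<dots> \<le> C * u x"
        using up[OF x(1)] HB by (intro mult_right_mono) (auto simp: C_def distrib_right)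
      finally show ?thesis .
    qed
  qed
qed

lemma comparison_inside:
  fixes K c \<beta> m d :: real
  assumes K: "1 \<le> K" and c: "0 < c" and \<beta>: "0 < \<beta>" "\<beta> < 2" and m: "0 < m" and d: "0 < d"
  obtains C where
    "\<And>(\<Omega> :: 'a::euclidean_space set) u v x\<^sub>0 x.
      \<lbrakk>NTA K \<Omega>; admissible c \<beta> m \<Omega> u; admissible c \<beta> m \<Omega> v; 0 \<in> frontier \<Omega>;
       x\<^sub>0 \<in> \<Omega>; norm x\<^sub>0 \<le> 1 - d; u x\<^sub>0 = 1; v x\<^sub>0 = 1; x \<in> \<Omega>; x \<in> ball 0 (1/2)\<rbrakk>
      \<Longrightarrow> v x \<le> C * u x"
proof -
  obtain r\<^sub>0 A where r0: "0 < r\<^sub>0" and A: "0 < A" and bh: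
    "\<And>(\<Omega> :: 'a set) u v z r a x.
      \<lbrakk>NTA K \<Omega>; admissible c \<beta> m \<Omega> u; admissible c \<beta> m \<Omega> v; z \<in> frontier \<Omega>; 0 < r; r \<le> r\<^sub>0;
       bounded \<Omega> \<Longrightarrow> 2 * K * r < diameter \<Omega>; ball z (3 * r) \<subseteq> ball 0 1;
       a \<in> \<Omega>; dist a z < r; r / K \<le> infdist a (frontier \<Omega>);
       x \<in> \<Omega>; dist x z = infdist x (frontier \<Omega>); dist x z < r\<rbrakk>
      \<Longrightarrow> v x \<le> A * (v a / u a) * u x"
    by (fact boundary_harnack[OF K c \<beta> m])
  obtain \<rho> where \<rho>: "0 < \<rho>" and dl:
    "\<And>(\<Omega> :: 'a set) u x.
      \<lbrakk>NTA K \<Omega>; admissible c \<beta> m \<Omega> u; 0 \<in> frontier \<Omega>; bounded \<Omega>; x \<in> \<Omega>; u x = 1\<rbrakk> \<Longrightarrow> \<rho> \<le> diameter \<Omega>"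
    by (fact diameter_lower_bound[OF K m])
  \<comment> \<open>d / 8 keeps the balls of radius 3 r about frontier points near
    \<open>x\<^sub>0\<close> inside the unit ball, and \<rho> / (4 K) keeps 2 K r below the
    diameter.\<close>
  define r where "r = Min {r\<^sub>0, 1/8, d/8, \<rho> / (4 * K)}"
  have r: "0 < r" "r \<le> r\<^sub>0" "r \<le> 1/8" "r \<le> d / 8" "r \<le> \<rho> / (4 * K)"
    using r0 d \<rho> K by (auto simp: r_def)
  show thesis
  proof (rule comparison_from_point[OF K c \<beta> m, where B = "1 + A" and s\<^sub>0 = "r / K" and r = r and A = A and R = "1"])
    show "0 < 1 + A" "0 < r / K" "0 < r" "r \<le> 1/8" "0 < A" using A r K by auto
    show "v x \<le> A * (v a / u a) * u x"
      if "NTA K \<Omega>" "admissible c \<beta> m \<Omega> u" "admissible c \<beta> m \<Omega> v" "z \<in> frontier \<Omega>"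
        "bounded \<Omega> \<Longrightarrow> 2 * K * r < diameter \<Omega>" "ball z (3 * r) \<subseteq> ball 0 1"
        "a \<in> \<Omega>" "dist a z < r" "r / K \<le> infdist a (frontier \<Omega>)"
        "x \<in> \<Omega>" "dist x z = infdist x (frontier \<Omega>)" "dist x z < r"
      for \<Omega> :: "'a set" and u v z a x
      by (rule bh[OF that(1-4) r(1,2) that(5-12)])
    fix C
    assume comp:
    "\<And>(\<Omega> :: 'a set) u v a x.
      \<lbrakk>NTA K \<Omega>; admissible c \<beta> m \<Omega> u; admissible c \<beta> m \<Omega> v; 0 \<in> frontier \<Omega>;
       bounded \<Omega> \<Longrightarrow> 2 * K * r < diameter \<Omega>;
       a \<in> \<Omega>; r / K \<le> infdist a (frontier \<Omega>); norm a \<le> 1; v a \<le> (1 + A) * u a;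
       x \<in> \<Omega>; x \<in> ball 0 (1/2)\<rbrakk>
      \<Longrightarrow> v x \<le> C * u x"
    show thesis
    proof (rule that[of C])
      fix \<Omega> :: "'a set" and u v x\<^sub>0 x
      assume NTA: "NTA K \<Omega>" and u: "admissible c \<beta> m \<Omega> u" and v: "admissible c \<beta> m \<Omega> v"
        and zero: "0 \<in> frontier \<Omega>" and x0: "x\<^sub>0 \<in> \<Omega>" "norm x\<^sub>0 \<le> 1 - d" "u x\<^sub>0 = 1" "v x\<^sub>0 = 1"
        and x: "x \<in> \<Omega>" "x \<in> ball 0 (1/2)"
      have NTA': "one_sided_NTA K \<Omega>" and \<Omega>: "open \<Omega>" "frontier \<Omega> \<noteq> {}"
        using NTA zero by (auto simp: NTA_def one_sided_NTA_def)
      have diam: "2 * K * r < diameter \<Omega>" if "bounded \<Omega>"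
      proof -
        have "2 * K * r \<le> 2 * K * (\<rho> / (4 * K))" using r(5) K by (intro mult_left_mono) auto
        also have "\<dots> = \<rho> / 2" using K by simp
        also have "\<dots> < \<rho>" using \<rho> by simp
        also have "\<rho> \<le> diameter \<Omega>" by (rule dl[OF NTA u zero that x0(1,3)])
        finally show ?thesis .
      qed
      have "\<exists>a\<in>\<Omega>. r / K \<le> infdist a (frontier \<Omega>) \<and> norm a \<le> 1 \<and> v a \<le> (1 + A) * u a"
      proof (cases "r \<le> infdist x\<^sub>0 (frontier \<Omega>)")
        case True
        have "r / K \<le> r" using r K by (simp add: pos_divide_le_eq)
        then show ?thesis using True x0 d A by (intro bexI[of _ x\<^sub>0]) auto
      next
        case False
        obtain z where z: "z \<in> frontier \<Omega>" "dist x\<^sub>0 z = infdist x\<^sub>0 (frontier \<Omega>)"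
          using nearest_frontier_point \<Omega> by blast
        have nz: "norm z < 1 - d + r"
          using norm_triangle_ineq4[of x\<^sub>0 "x\<^sub>0 - z"] x0(2) False z(2) by (simp add: dist_norm)
        have rd: "r < diameter \<Omega>" if "bounded \<Omega>"
        proof -
          have "r \<le> K * r" using K r by simp
          then show ?thesis using diam[OF that] r by linarith
        qed
        obtain a where a: "a \<in> \<Omega>" "dist a z < r" "r / K \<le> infdist a (frontier \<Omega>)"
          using corkscrew_point[OF NTA' z(1) r(1) rd] by blast
        have na: "norm a \<le> 1"
          using norm_triangle_ineq[of "a - z" z] a(2) nz r by (simp add: dist_norm)
        have ua: "0 < u a" and va: "0 < v a"
          using admissible_pos[OF _ c \<Omega> a(1)] u v by auto
        \<comment> \<open>At \<open>x\<^sub>0\<close> both functions are \<open>1\<close>: comparing \<open>u\<close> against \<open>v\<close> there bounds \<open>v a / u a\<close>.\<close>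
        have "u x\<^sub>0 \<le> A * (u a / v a) * v x\<^sub>0"
        proof (rule bh[OF NTA v u z(1) r(1,2) diam _ a x0(1) z(2)])
          show "ball z (3 * r) \<subseteq> ball 0 1"
            using nz r by (simp add: ball_subset_ball_iff)
          show "dist x\<^sub>0 z < r" using False z by simp
        qed
        then have "v a \<le> A * u a" using va x0 by (simp add: field_simps)
        also have "\<dots> \<le> (1 + A) * u a" using ua by (intro mult_right_mono) auto
        finally show ?thesis using a na by blast
      qed
      then show "v x \<le> C * u x"
        using comp[OF NTA u v zero diam _ _ _ _ x] by blast
    qed
  qed
qed

text \<open>Outside the unit ball \<open>u\<close> and \<open>v\<close> are not assumed to vanish on
  the frontier near \<open>x\<^sub>0\<close>, so exchanging them gives nothing there. Instead
  \<open>x\<^sub>0\<close> itself serves as the point of comparison, and its depth enters the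
  constant. The diameter is at least 1 because 0 is a frontier point.\<close>

lemma comparison_outside:
  fixes K c \<beta> m d \<delta> :: real
  assumes K: "1 \<le> K" and c: "0 < c" and \<beta>: "0 < \<beta>" "\<beta> < 2" and m: "0 < m" and \<delta>: "0 < \<delta>"
  obtains C where
    "\<And>(\<Omega> :: 'a::euclidean_space set) u v x\<^sub>0 x.
      \<lbrakk>NTA K \<Omega>; admissible c \<beta> m \<Omega> u; admissible c \<beta> m \<Omega> v; 0 \<in> frontier \<Omega>;
       x\<^sub>0 \<in> \<Omega>; 1 \<le> norm x\<^sub>0; norm x\<^sub>0 \<le> 1 + d; infdist x\<^sub>0 (frontier \<Omega>) = \<delta>;
       u x\<^sub>0 = 1; v x\<^sub>0 = 1; x \<in> \<Omega>; x \<in> ball 0 (1/2)\<rbrakk>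
      \<Longrightarrow> v x \<le> C * u x"
proof -
  obtain r\<^sub>0 A where r0: "0 < r\<^sub>0" and A: "0 < A" and bh:
    "\<And>(\<Omega> :: 'a set) u v z r a x.
      \<lbrakk>NTA K \<Omega>; admissible c \<beta> m \<Omega> u; admissible c \<beta> m \<Omega> v; z \<in> frontier \<Omega>; 0 < r; r \<le> r\<^sub>0;
       bounded \<Omega> \<Longrightarrow> 2 * K * r < diameter \<Omega>; ball z (3 * r) \<subseteq> ball 0 1;
       a \<in> \<Omega>; dist a z < r; r / K \<le> infdist a (frontier \<Omega>);
       x \<in> \<Omega>; dist x z = infdist x (frontier \<Omega>); dist x z < r\<rbrakk>
      \<Longrightarrow> v x \<le> A * (v a / u a) * u x"
    by (fact boundary_harnack[OF K c \<beta> m])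
  define r where "r = Min {r\<^sub>0, 1/8, 1 / (4 * K)}"
  have r: "0 < r" "r \<le> r\<^sub>0" "r \<le> 1/8" "r \<le> 1 / (4 * K)"
    using r0 K by (auto simp: r_def)
  show thesis
  proof (rule comparison_from_point[OF K c \<beta> m, where B = "1" and s\<^sub>0 = "\<delta>" and r = r and A = A and R = "1 + d"])
    show "0 < (1::real)" "0 < \<delta>" "0 < r" "r \<le> 1/8" "0 < A" using A r K \<delta> by auto
    show "v x \<le> A * (v a / u a) * u x"
      if "NTA K \<Omega>" "admissible c \<beta> m \<Omega> u" "admissible c \<beta> m \<Omega> v" "z \<in> frontier \<Omega>"
        "bounded \<Omega> \<Longrightarrow> 2 * K * r < diameter \<Omega>" "ball z (3 * r) \<subseteq> ball 0 1"
        "a \<in> \<Omega>" "dist a z < r" "r / K \<le> infdist a (frontier \<Omega>)"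
        "x \<in> \<Omega>" "dist x z = infdist x (frontier \<Omega>)" "dist x z < r"
      for \<Omega> :: "'a set" and u v z a x
      by (rule bh[OF that(1-4) r(1,2) that(5-12)])
    fix C
    assume comp:
    "\<And>(\<Omega> :: 'a set) u v a x.
      \<lbrakk>NTA K \<Omega>; admissible c \<beta> m \<Omega> u; admissible c \<beta> m \<Omega> v; 0 \<in> frontier \<Omega>;
       bounded \<Omega> \<Longrightarrow> 2 * K * r < diameter \<Omega>;
       a \<in> \<Omega>; \<delta> \<le> infdist a (frontier \<Omega>); norm a \<le> 1 + d; v a \<le> 1 * u a;
       x \<in> \<Omega>; x \<in> ball 0 (1/2)\<rbrakk>
      \<Longrightarrow> v x \<le> C * u x"
    show thesis
    proof (rule that[of C])
      fix \<Omega> :: "'a set" and u v x\<^sub>0 x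
      assume NTA: "NTA K \<Omega>" and u: "admissible c \<beta> m \<Omega> u" and v: "admissible c \<beta> m \<Omega> v"
        and zero: "0 \<in> frontier \<Omega>" and x0: "x\<^sub>0 \<in> \<Omega>" "1 \<le> norm x\<^sub>0" "norm x\<^sub>0 \<le> 1 + d"
          "infdist x\<^sub>0 (frontier \<Omega>) = \<delta>" "u x\<^sub>0 = 1" "v x\<^sub>0 = 1"
        and x: "x \<in> \<Omega>" "x \<in> ball 0 (1/2)"
      have diam: "2 * K * r < diameter \<Omega>" if "bounded \<Omega>"
      proof -
        have "2 * K * r \<le> 2 * K * (1 / (4 * K))" using r(4) K by (intro mult_left_mono) auto
        also have "\<dots> < 1" using K by simp
        also have "1 \<le> dist 0 x\<^sub>0" using x0 by simp
        also have "\<dots> \<le> diameter (closure \<Omega>)"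
          using zero x0(1) closure_subset[of \<Omega>] that
          by (intro diameter_bounded_bound) (auto simp: frontier_def)
        also have "\<dots> = diameter \<Omega>" by (rule diameter_closure[OF that])
        finally show ?thesis .
      qed
      show "v x \<le> C * u x"
        using x0 by (intro comp[OF NTA u v zero diam x0(1) _ x0(3) _ x]) auto
    qed
  qed
qed

lemma infdist_unit_sphere:
  fixes x :: "'a::euclidean_space"
  shows "norm x \<le> 1 + infdist x (sphere 0 1)"
    and "norm x < 1 \<Longrightarrow> 0 < infdist x (sphere 0 1)"
    and "norm x < 1 \<Longrightarrow> norm x \<le> 1 - infdist x (sphere 0 1)"
proof -
  let ?S = "sphere 0 1 :: 'a set"
  obtain b :: 'a where b: "b \<in> Basis" using nonempty_Basis by blast
  have S: "?S \<noteq> {}" "closed ?S" by (auto simp: sphere_eq_empty)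
  obtain y where y: "y \<in> ?S" "infdist x ?S = dist x y"
    using infdist_attains_inf[OF S(2,1)] by blast
  then show "norm x \<le> 1 + infdist x ?S"
    using norm_triangle_ineq2[of x y] by (simp add: dist_norm)
  show "0 < infdist x ?S" if "norm x < 1"
    using y that by auto
  show "norm x \<le> 1 - infdist x ?S" if "norm x < 1"
  proof (cases "x = 0")
    case True
    have "infdist x ?S \<le> dist x b" using b by (intro infdist_le) simp
    then show ?thesis using True b by simp
  next
    case False
    have "infdist x ?S \<le> dist x (x /\<^sub>R norm x)"
      using False by (intro infdist_le) simp
    also have "x - x /\<^sub>R norm x = (1 - inverse (norm x)) *\<^sub>R x"
      by (simp add: scaleR_left_diff_distrib)
    then have "dist x (x /\<^sub>R norm x) = \<bar>1 - inverse (norm x)\<bar> * norm x"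
      by (simp add: dist_norm)
    also have "\<dots> = 1 - norm x"
      using False that by (simp add: abs_if field_simps)
    finally show ?thesis by simp
  qed
qed

theorem theorem1p3:
  fixes \<beta> c K d :: real
  assumes n: "2 \<le> CARD('n::finite)"
    and beta: "0 < \<beta>" "\<beta> < 2"
    and c: "0 < c"
  shows "\<exists>(C\<^sub>0::real) (C\<^sub>1::real \<Rightarrow> real).
    \<forall>(\<Omega>::(real^'n) set) (x\<^sub>0::real^'n) (u::real^'n \<Rightarrow> real) (v::real^'n \<Rightarrow> real).
      NTA K \<Omega> \<longrightarrow> 0 \<in> frontier \<Omega> \<longrightarrow>
      x\<^sub>0 \<in> \<Omega> \<longrightarrow> infdist x\<^sub>0 (sphere 0 1) = d \<longrightarrow>
      continuous_on (closure \<Omega>) u \<longrightarrow> continuous_on (closure \<Omega>) v \<longrightarrow>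
      u x\<^sub>0 = 1 \<longrightarrow> v x\<^sub>0 = 1 \<longrightarrow>
      (\<forall>x\<in>closure \<Omega>. 0 \<le> u x \<and> 0 \<le> v x) \<longrightarrow>
      (\<forall>x\<in>frontier \<Omega> \<inter> ball 0 1. u x = 0 \<and> v x = 0) \<longrightarrow>
      (\<forall>x\<in>\<Omega>. c * infdist x (frontier \<Omega>) powr \<beta> \<le> u x \<and>
              c * infdist x (frontier \<Omega>) powr \<beta> \<le> v x) \<longrightarrow>
      laplacian_ge \<Omega> u (-1) \<longrightarrow> laplacian_le \<Omega> u 1 \<longrightarrow>
      laplacian_ge \<Omega> v (-1) \<longrightarrow> laplacian_le \<Omega> v 1 \<longrightarrow>
      (\<forall>x\<in>\<Omega> \<inter> ball 0 (1/2).
         v x / u x \<le> (if x\<^sub>0 \<in> ball 0 1 then C\<^sub>0 else C\<^sub>1 (infdist x\<^sub>0 (frontier \<Omega>))))"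
proof (cases "1 \<le> K")
  case False
  \<comment> \<open>For \<open>K\<close> < 1 no domain with 0 on its frontier satisfies the
    hypotheses, so any constants do.\<close>
  then show ?thesis using NTA_constant_ge_1 by (metis (no_types, lifting))
next
  case K: True
  define m where "m = unit_ball_vol (real DIM(real^'n))"
  have m: "0 < m" by (simp add: m_def)
  \<comment> \<open>Positivity of \<open>d\<close> stands inside the existential because it is known
    only once \<open>x\<^sub>0\<close> lies in the unit ball.\<close>
  have "\<exists>C. 0 < d \<longrightarrow> (\<forall>(\<Omega> :: (real^'n) set) u v x\<^sub>0 x.
      NTA K \<Omega> \<longrightarrow> admissible c \<beta> m \<Omega> u \<longrightarrow> admissible c \<beta> m \<Omega> v \<longrightarrow> 0 \<in> frontier \<Omega> \<longrightarrow>
       x\<^sub>0 \<in> \<Omega> \<longrightarrow> norm x\<^sub>0 \<le> 1 - d \<longrightarrow> u x\<^sub>0 = 1 \<longrightarrow> v x\<^sub>0 = 1 \<longrightarrow> x \<in> \<Omega> \<longrightarrow> x \<in> ball 0 (1/2) \<longrightarrow> v x \<le> C * u x)"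
    using comparison_inside[OF K c beta m, of d, where 'a="real^'n"] by metis
  then obtain C0 where C0: "\<And>(\<Omega> :: (real^'n) set) u v x\<^sub>0 x.
      \<lbrakk>0 < d; NTA K \<Omega>; admissible c \<beta> m \<Omega> u; admissible c \<beta> m \<Omega> v; 0 \<in> frontier \<Omega>;
       x\<^sub>0 \<in> \<Omega>; norm x\<^sub>0 \<le> 1 - d; u x\<^sub>0 = 1; v x\<^sub>0 = 1; x \<in> \<Omega>; x \<in> ball 0 (1/2)\<rbrakk> \<Longrightarrow> v x \<le> C0 * u x"
    by blast
  have "\<forall>\<delta>. \<exists>C. 0 < \<delta> \<longrightarrow> (\<forall>(\<Omega> :: (real^'n) set) u v x\<^sub>0 x.
      NTA K \<Omega> \<longrightarrow> admissible c \<beta> m \<Omega> u \<longrightarrow> admissible c \<beta> m \<Omega> v \<longrightarrow> 0 \<in> frontier \<Omega> \<longrightarrow>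
       x\<^sub>0 \<in> \<Omega> \<longrightarrow> 1 \<le> norm x\<^sub>0 \<longrightarrow> norm x\<^sub>0 \<le> 1 + d \<longrightarrow> infdist x\<^sub>0 (frontier \<Omega>) = \<delta> \<longrightarrow>
       u x\<^sub>0 = 1 \<longrightarrow> v x\<^sub>0 = 1 \<longrightarrow> x \<in> \<Omega> \<longrightarrow> x \<in> ball 0 (1/2) \<longrightarrow> v x \<le> C * u x)"
    using comparison_outside[OF K c beta m, of _ d, where 'a="real^'n"] by metis
  then obtain C1 where C1: "\<And>\<delta> (\<Omega> :: (real^'n) set) u v x\<^sub>0 x.
      \<lbrakk>0 < \<delta>; NTA K \<Omega>; admissible c \<beta> m \<Omega> u; admissible c \<beta> m \<Omega> v; 0 \<in> frontier \<Omega>;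
       x\<^sub>0 \<in> \<Omega>; 1 \<le> norm x\<^sub>0; norm x\<^sub>0 \<le> 1 + d; infdist x\<^sub>0 (frontier \<Omega>) = \<delta>;
       u x\<^sub>0 = 1; v x\<^sub>0 = 1; x \<in> \<Omega>; x \<in> ball 0 (1/2)\<rbrakk> \<Longrightarrow> v x \<le> C1 \<delta> * u x"
    by metis
  show ?thesis
  proof (intro exI[of _ C0] exI[of _ C1] allI impI ballI)
    fix \<Omega> :: "(real^'n) set" and x\<^sub>0 u v x
    assume NTA: "NTA K \<Omega>" and zero: "0 \<in> frontier \<Omega>" and x0: "x\<^sub>0 \<in> \<Omega>" "infdist x\<^sub>0 (sphere 0 1) = d"
      and cont: "continuous_on (closure \<Omega>) u" "continuous_on (closure \<Omega>) v"
      and one: "u x\<^sub>0 = 1" "v x\<^sub>0 = 1"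
      and nonneg: "\<forall>x\<in>closure \<Omega>. 0 \<le> u x \<and> 0 \<le> v x"
      and bdry: "\<forall>x\<in>frontier \<Omega> \<inter> ball 0 1. u x = 0 \<and> v x = 0"
      and growth: "\<forall>x\<in>\<Omega>. c * infdist x (frontier \<Omega>) powr \<beta> \<le> u x \<and> c * infdist x (frontier \<Omega>) powr \<beta> \<le> v x"
      and lap: "laplacian_ge \<Omega> u (-1)" "laplacian_le \<Omega> u 1" "laplacian_ge \<Omega> v (-1)" "laplacian_le \<Omega> v 1"
      and x: "x \<in> \<Omega> \<inter> ball 0 (1/2)"
    have \<Omega>: "open \<Omega>" "frontier \<Omega> \<noteq> {}" using NTA zero by (auto simp: NTA_def one_sided_NTA_def)
    have cont': "continuous_on \<Omega> u" "continuous_on \<Omega> v"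
      using cont closure_subset continuous_on_subset by blast+
    have "\<bar>defect u y r\<bar> \<le> m * r\<^sup>2" "\<bar>defect v y r\<bar> \<le> m * r\<^sup>2" if "0 < r" "cball y r \<subseteq> \<Omega>" for y r
      unfolding m_def
      using abs_defect_le[OF cont'(1) that lap(1,2)] abs_defect_le[OF cont'(2) that lap(3,4)] by auto
    then have u: "admissible c \<beta> m \<Omega> u" and v: "admissible c \<beta> m \<Omega> v"
      using cont nonneg bdry growth unfolding admissible_def by auto
    have ux: "0 < u x" using x by (intro admissible_pos[OF u c \<Omega>]) auto
    have "v x \<le> (if x\<^sub>0 \<in> ball 0 1 then C0 else C1 (infdist x\<^sub>0 (frontier \<Omega>))) * u x"
    proof (cases "x\<^sub>0 \<in> ball 0 1")
      case True
      then have "norm x\<^sub>0 < 1" by simp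
      then have "0 < d" "norm x\<^sub>0 \<le> 1 - d"
        using infdist_unit_sphere(2,3)[of x\<^sub>0] x0(2) by auto
      then show ?thesis
        using True C0[OF _ NTA u v zero x0(1) _ one, of x] x by simp
    next
      case False
      then have "1 \<le> norm x\<^sub>0" "norm x\<^sub>0 \<le> 1 + d"
        using infdist_unit_sphere(1)[of x\<^sub>0] x0(2) by auto
      then show ?thesis
        using False C1[OF infdist_frontier_pos[OF \<Omega> x0(1)] NTA u v zero x0(1) _ _ refl one, of x] x by simp
    qed
    then show "v x / u x \<le> (if x\<^sub>0 \<in> ball 0 1 then C0 else C1 (infdist x\<^sub>0 (frontier \<Omega>)))"
      using ux by (simp add: pos_divide_le_eq)
  qed
qed

end
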